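(* Let $\mathcal T$ be the Poisson Weighted Infinite Tree, and let the initial messages $(\langle v\to\dot v\rangle^0_{\mathcal T})_{v\in\mathcal V^*}$ be i.i.d., independent of $\mathcal T$, with $\mathbb E\big[(\langle v\to\dot v\rangle^0_{\mathcal T})^+\big]<\infty$ and with tail distribution function not identically $0$ (i.e. they are not almost surely equal to $-\infty$). Define recursively, for $k\ge0$ and $v\in\mathcal V^*$, $$\langle v\to\dot v\rangle^{k+1}_{\mathcal T}=\inf_{i\ge1}\big\{\|v,v.i\|_{\mathcal T}-\langle v.i\to v\rangle^k_{\mathcal T}\big\}.$$ Then there exists a constant $\gamma\in\mathbb R$ such that, for every $v\in\mathcal V^*$, $$\langle v\to\dot v\rangle^{2k}_{\mathcal T}\xrightarrow[k\to\infty]{L^2}\langle v\to\dot v\rangle^*_{\mathcal T}+\gamma\qquad\text{and}\qquad\langle v\to\dot v\rangle^{2k+1}_{\mathcal T}\xrightarrow[k\to\infty]{L^2}\langle v\to\dot v\rangle^*_{\mathcal T}-\gamma,$$ where $\langle\cdot\to\cdot\rangle^*_{\mathcal T}$ is the unique stationary configuration. Further, the decisions at the root converge: $$\pi^k_{\mathcal T}(\varnothing)\xrightarrow[k\to\infty]{P}\pi^*_{\mathcal T}(\varnothing).$$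
   Context: $\mathcal V$ is the set of finite words over $\{1,2,3,\dots\}$, $\varnothing$ the empty word, $\mathcal V^*=\mathcal V\setminus\{\varnothing\}$, and for $v\in\mathcal V^*$, $\dot v$ is $v$ with its last letter deleted. The Poisson Weighted Infinite Tree $\mathcal T$ is the tree on $\mathcal V$ rooted at $\varnothing$ with edges $\{v,v.i\}$, $v\in\mathcal V$, $i\ge1$, with weights $\|v,v.i\|_{\mathcal T}=\xi_i^v$, where $(\xi^v=(\xi^v_1<\xi^v_2<\cdots))_{v\in\mathcal V}$ are independent ordered Poisson point processes of intensity 1 on $\mathbb R^+$. Stationary configuration (existence and a.s. uniqueness are known, due to Aldous and Bandyopadhyay): $(\langle v\to\dot v\rangle^*_{\mathcal T})_{v\in\mathcal V^*}$ is the process such that each $\langle v\to\dot v\rangle_{\mathcal T}^*$ is a measurable function of the edge weights of the subtree of descendants of $v$, has the logistic law $\mathbb P(\langle v\to\dot v\rangle^*_{\mathcal T}>x)=\frac1{1+e^x}$, and almost surely $\langle v\to\dot v\rangle^*_{\mathcal T}=\min_{i\ge1}\{\|v,v.i\|_{\mathcal T}-\langle v.i\to v\rangle^*_{\mathcal T}\}$ for all $v\in\mathcal V^*$. Decisions at the root: $\pi^k_{\mathcal T}(\varnothing)=\operatorname{arg\,min}_{i\ge1}\{\|\varnothing,i\|_{\mathcal T}-\langle i\to\varnothing\rangle^k_{\mathcal T}\}$ (almost surely well defined for $k\ge4$) and $\pi^*_{\mathcal T}(\varnothing)=\operatorname{arg\,min}_{i\ge1}\{\|\varnothing,i\|_{\mathcal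 T}-\langle i\to\varnothing\rangle^*_{\mathcal T}\}$ (almost surely well defined). *)

theory Defs
  imports "HOL-Probability.Probability"
begin

text \<open>
  The vertices of the infinite tree are the finite words over \<open>{1, 2, 3, \<dots>}\<close>. The \<open>i\<close>-th child
  of \<open>v\<close> is \<open>v @ [i]\<close> (with \<open>i \<ge> 1\<close>), so that the parent of \<open>v \<noteq> []\<close> is \<open>butlast v\<close>.
\<close>

definition words :: "nat list set" where
  "words = lists {1..}"

definition words1 :: "nat list set" where
  "words1 = words - {[]}"

definition num_points :: "(nat \<Rightarrow> 'a \<Rightarrow> real) \<Rightarrow> real set \<Rightarrow> 'a \<Rightarrow> nat" where
  "num_points \<xi> B \<omega> = card {i \<in> {1..}. \<xi> i \<omega> \<in> B}"

text \<open>
  A Poisson point process of intensity 1 on \<open>{0..}\<close>, with its points listed in increasing order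
  \<open>\<xi> 1 < \<xi> 2 < \<dots>\<close>: the numbers of points in disjoint Borel sets of finite Lebesgue measure are
  independent and Poisson distributed, the parameter being the measure of the set. (The set of
  points is required to be almost surely finite separately, because the cardinality of an
  infinite set is 0.)
\<close>

definition ordered_poisson_process :: "'a measure \<Rightarrow> (nat \<Rightarrow> 'a \<Rightarrow> real) \<Rightarrow> bool" where
  "ordered_poisson_process M \<xi> \<longleftrightarrow>
     (\<forall>i\<ge>1. \<xi> i \<in> borel_measurable M) \<and>
     (AE \<omega> in M. 0 \<le> \<xi> 1 \<omega> \<and> strict_mono_on {1..} (\<lambda>i. \<xi> i \<omega>)) \<and>
     (\<forall>B \<in> sets borel. B \<subseteq> {0..} \<longrightarrow> emeasure lborel B < \<infinity> \<longrightarrow>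
        (AE \<omega> in M. finite {i \<in> {1..}. \<xi> i \<omega> \<in> B}) \<and>
        (\<forall>n. measure M {\<omega> \<in> space M. num_points \<xi> B \<omega> = n}
               = measure lborel B ^ n / fact n * exp (- measure lborel B))) \<and>
     (\<forall>(m::nat) B. (\<forall>j<m. B j \<in> sets borel \<and> B j \<subseteq> {0..} \<and> emeasure lborel (B j) < \<infinity>) \<longrightarrow>
        disjoint_family_on B {..<m} \<longrightarrow>
        prob_space.indep_vars M (\<lambda>_. count_space UNIV) (\<lambda>j. num_points \<xi> (B j)) {..<m})"

text \<open>
  The Poisson Weighted Infinite Tree: \<open>\<xi> v i\<close> is the weight of the edge between \<open>v\<close> and \<open>v @ [i]\<close>.
\<close>

definition pwit :: "'a measure \<Rightarrow> (nat list \<Rightarrow> nat \<Rightarrow> 'a \<Rightarrow> real) \<Rightarrow> bool" where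
  "pwit M \<xi> \<longleftrightarrow>
     (\<forall>v \<in> words. ordered_poisson_process M (\<xi> v)) \<and>
     prob_space.indep_vars M (\<lambda>_. Pi\<^sub>M {1..} (\<lambda>_. borel)) (\<lambda>v \<omega>. \<lambda>i\<in>{1..}. \<xi> v i \<omega>) words"

text \<open>
  All edge weights of the subtree consisting of \<open>v\<close> and its descendants; \<open>v = []\<close> gives the
  weights of the whole tree.
\<close>

definition subtree_weights ::
  "(nat list \<Rightarrow> nat \<Rightarrow> 'a \<Rightarrow> real) \<Rightarrow> nat list \<Rightarrow> 'a \<Rightarrow> (nat list \<times> nat \<Rightarrow> real)" where
  "subtree_weights \<xi> v \<omega> = (\<lambda>(w, i)\<in>words \<times> {1..}. \<xi> (v @ w) i \<omega>)"

abbreviation weight_space :: "(nat list \<times> nat \<Rightarrow> real) measure" where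
  "weight_space \<equiv> Pi\<^sub>M (words \<times> {1..}) (\<lambda>_. borel)"

text \<open>
  Messages are indexed by their source: the message from \<open>v\<close> to its parent is indexed by
  \<open>v \<in> words1\<close>. Initial messages may take the value \<open>-\<infinity>\<close>, hence the extended reals.
  Independence of the messages from the tree is independence of the generated sigma-algebras
  (\<open>indep_var\<close> needs both variables to have the same type).
\<close>

definition initial_messages ::
  "'a measure \<Rightarrow> (nat list \<Rightarrow> nat \<Rightarrow> 'a \<Rightarrow> real) \<Rightarrow> (nat list \<Rightarrow> 'a \<Rightarrow> ereal) \<Rightarrow> bool" where
  "initial_messages M \<xi> X0 \<longleftrightarrow>
     prob_space.indep_vars M (\<lambda>_. borel) X0 words1 \<and>
     (\<forall>v \<in> words1. \<forall>w \<in> words1. distr M borel (X0 v) = distr M borel (X0 w)) \<and>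
     prob_space.indep_set M
       (sets (vimage_algebra (space M) (subtree_weights \<xi> []) weight_space))
       (sets (vimage_algebra (space M) (\<lambda>\<omega>. \<lambda>v\<in>words1. X0 v \<omega>) (Pi\<^sub>M words1 (\<lambda>_. borel)))) \<and>
     (\<forall>v \<in> words1. (\<integral>\<^sup>+\<omega>. e2ennreal (max 0 (X0 v \<omega>)) \<partial>M) < \<infinity>) \<and>
     (\<forall>v \<in> words1. \<exists>x::real. measure M {\<omega> \<in> space M. ereal x < X0 v \<omega>} \<noteq> 0)"

fun message ::
  "(nat list \<Rightarrow> nat \<Rightarrow> 'a \<Rightarrow> real) \<Rightarrow> (nat list \<Rightarrow> 'a \<Rightarrow> ereal) \<Rightarrow> nat \<Rightarrow> nat list \<Rightarrow> 'a \<Rightarrow> ereal" where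
  "message \<xi> X0 0 v \<omega> = X0 v \<omega>"
| "message \<xi> X0 (Suc k) v \<omega> = (INF i\<in>{1..}. ereal (\<xi> v i \<omega>) - message \<xi> X0 k (v @ [i]) \<omega>)"

definition stationary_configuration ::
  "'a measure \<Rightarrow> (nat list \<Rightarrow> nat \<Rightarrow> 'a \<Rightarrow> real) \<Rightarrow> (nat list \<Rightarrow> 'a \<Rightarrow> real) \<Rightarrow> bool" where
  "stationary_configuration M \<xi> X \<longleftrightarrow>
     (\<forall>v \<in> words1. \<exists>f \<in> borel_measurable weight_space.
        \<forall>\<omega> \<in> space M. X v \<omega> = f (subtree_weights \<xi> v \<omega>)) \<and>
     (\<forall>v \<in> words1. \<forall>x. measure M {\<omega> \<in> space M. x < X v \<omega>} = 1 / (1 + exp x)) \<and>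
     (AE \<omega> in M. \<forall>v \<in> words1. \<exists>i.
        is_arg_min (\<lambda>j. \<xi> v j \<omega> - X (v @ [j]) \<omega>) (\<lambda>j. 1 \<le> j) i \<and>
        X v \<omega> = \<xi> v i \<omega> - X (v @ [i]) \<omega>)"

text \<open>
  The arg min over the indices \<open>i \<ge> 1\<close>, when there is exactly one minimiser; otherwise 0, which
  is not an index. A fixed default is used instead of \<open>arg_min\<close> so that a
  decision is a measurable function of \<open>\<omega>\<close> also where the arg min is not well defined.
\<close>

definition the_arg_min :: "(nat \<Rightarrow> 'b::linorder) \<Rightarrow> nat" where
  "the_arg_min f =
     (if \<exists>!i. is_arg_min f (\<lambda>j. 1 \<le> j) i then THE i. is_arg_min f (\<lambda>j. 1 \<le> j) i else 0)"

definition root_decision ::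
  "(nat list \<Rightarrow> nat \<Rightarrow> 'a \<Rightarrow> real) \<Rightarrow> (nat list \<Rightarrow> 'a \<Rightarrow> ereal) \<Rightarrow> nat \<Rightarrow> 'a \<Rightarrow> nat" where
  "root_decision \<xi> X0 k \<omega> = the_arg_min (\<lambda>i. ereal (\<xi> [] i \<omega>) - message \<xi> X0 k [i] \<omega>)"

definition stationary_root_decision ::
  "(nat list \<Rightarrow> nat \<Rightarrow> 'a \<Rightarrow> real) \<Rightarrow> (nat list \<Rightarrow> 'a \<Rightarrow> real) \<Rightarrow> 'a \<Rightarrow> nat" where
  "stationary_root_decision \<xi> X \<omega> = the_arg_min (\<lambda>i. \<xi> [] i \<omega> - X [i] \<omega>)"

text \<open>
  Convergence in \<open>L\<^sup>2\<close> of extended real random variables to a real one. Where \<open>Z n\<close> is infinite the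
  integrand is \<open>\<infinity>\<close>, and \<open>Y\<close> is square integrable, so all but finitely many \<open>Z n\<close> are almost
  surely finite and square integrable.
\<close>

definition converges_L2 :: "'a measure \<Rightarrow> (nat \<Rightarrow> 'a \<Rightarrow> ereal) \<Rightarrow> ('a \<Rightarrow> real) \<Rightarrow> bool" where
  "converges_L2 M Z Y \<longleftrightarrow>
     (\<forall>n. Z n \<in> borel_measurable M) \<and> Y \<in> borel_measurable M \<and>
     integrable M (\<lambda>\<omega>. (Y \<omega>)\<^sup>2) \<and>
     (\<lambda>n. \<integral>\<^sup>+\<omega>. e2ennreal ((Z n \<omega> - ereal (Y \<omega>))\<^sup>2) \<partial>M) \<longlonglongrightarrow> 0"

text \<open>
  Convergence in probability of random variables with values in the discrete space of natural
  numbers.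
\<close>

definition converges_in_probability ::
  "'a measure \<Rightarrow> (nat \<Rightarrow> 'a \<Rightarrow> nat) \<Rightarrow> ('a \<Rightarrow> nat) \<Rightarrow> bool" where
  "converges_in_probability M Z Y \<longleftrightarrow>
     (\<forall>n. Z n \<in> M \<rightarrow>\<^sub>M count_space UNIV) \<and> Y \<in> M \<rightarrow>\<^sub>M count_space UNIV \<and>
     (\<lambda>n. measure M {\<omega> \<in> space M. Z n \<omega> \<noteq> Y \<omega>}) \<longlonglongrightarrow> 0"

end

theory Submission
  imports Defs "HOL-Real_Asymp.Real_Asymp"
begin

text \<open>
  The tail function of the messages evolves by \<open>(T F) x = exp (- (\<integral>u\<ge>-x. F u))\<close>, an order-reversing map that sends the
  logistic tail shifted by \<open>t\<close> to the one shifted by \<open>-t\<close>. After four steps a tail function lies between two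
  shifts of the logistic tail, and two further steps shrink the gap between the best such shifts by a
  definite amount, so the even iterates are attracted to one shift \<open>\<gamma>\<close>. A quantile coupling then
  replaces the messages after many rounds by \<open>\<gamma>\<close> plus i.i.d. logistic ones, with a uniformly small error
  which the min-recursion does not increase. Started from logistic messages at depth \<open>n\<close>, the recursion
  has, jointly with the weights at smaller depths, the same law as the stationary configuration. The latter
  being a function of the weights, its events are almost determined by the weights up to some finite depth,
  and therefore agree up to a small probability with those obtained from the logistic boundary messages.
\<close>

section \<open>The distributional recursion\<close>

text \<open>Closeness of tails is measured horizontally, by shifts, and not in a norm. Such a bound
  is what a quantile coupling turns into one almost sure error band for all vertices at once, which
  serves both the second moments and the comparison of infinitely many candidates in the arg min.
  The price is that every shift of the logistic tail is fixed by two applications of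
  \<open>rde\<close>: there is a whole line of possible limits, \<open>\<gamma>\<close> appears only
  as a supremum, and the contraction has to be extracted quantitatively from monotonicity. The
  second obstacle is that equality of laws does not give a mean-square limit. It does settle
  integrability: messages run from a logistic boundary have the law of the stationary ones after any
  number of rounds, so only the convergence of single events is left, and there it is decisive that
  the stationary messages are functions of the weights.\<close>

definition logis :: "real \<Rightarrow> real \<Rightarrow> real" where
  "logis t x = 1 / (1 + exp (x - t))"

definition tail_integral :: "(real \<Rightarrow> real) \<Rightarrow> real \<Rightarrow> real" where
  "tail_integral F x = (LBINT u:{x..}. F u)"

text \<open>The tail of the minimum of \<open>\<xi> i - Y i\<close> over a Poisson process of rate 1
  with independent marks of tail \<open>F\<close>: the number of points that push the minimum below
  \<open>x\<close> is Poisson with mean \<open>tail_integral F (- x)\<close>, and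
  \<open>rde F x\<close> is the probability that there are none.\<close>

definition rde :: "(real \<Rightarrow> real) \<Rightarrow> real \<Rightarrow> real" where
  "rde F x = exp (- tail_integral F (- x))"

text \<open>Integrability on the positive axis encodes the finite mean of the positive part, and a
  positive value somewhere excludes the law concentrated at \<open>-\<infinity>\<close>. The limit
  at \<open>-\<infinity>\<close> may be below 1, the missing part being the mass at that
  point.\<close>

definition tail_function :: "(real \<Rightarrow> real) \<Rightarrow> bool" where
  "tail_function F \<longleftrightarrow> antimono F \<and> (\<forall>x. 0 \<le> F x \<and> F x \<le> 1) \<and>
     set_integrable lborel {0..} F \<and> (\<exists>x. 0 < F x)"

definition sandwiched :: "real \<Rightarrow> real \<Rightarrow> (real \<Rightarrow> real) \<Rightarrow> bool" where
  "sandwiched a b F \<longleftrightarrow> (\<forall>x. logis a x \<le> F x \<and> F x \<le> logis b x)"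

section \<open>Tail integrals of logistic and exponential functions\<close>

lemma borel_measurable_antimono:
  fixes F :: "real \<Rightarrow> real"
  assumes "antimono F"
  shows "F \<in> borel_measurable borel"
proof -
  have "mono (\<lambda>x. - F x)"
    using assms by (auto simp: mono_def antimono_def)
  then have "(\<lambda>x. - F x) \<in> borel_measurable borel"
    by (rule borel_measurable_mono)
  then show ?thesis
    by simp
qed

lemma set_integrable_Icc_bounded:
  fixes F :: "real \<Rightarrow> real"
  assumes "F \<in> borel_measurable borel" "\<And>x. \<bar>F x\<bar> \<le> c"
  shows "set_integrable lborel {a..b} F"
proof (rule set_integrable_bound[where f = "\<lambda>_. c"])
  show "set_integrable lborel {a..b} (\<lambda>_. c)"
    unfolding set_integrable_def by (simp add: emeasure_lborel_Icc_eq)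
  show "set_borel_measurable lborel {a..b} F"
    using assms(1) unfolding set_borel_measurable_def by measurable
  show "AE x in lborel. x \<in> {a..b} \<longrightarrow> norm (F x) \<le> norm c"
    using assms(2) by (auto intro!: AE_I2 order_trans[OF _ abs_ge_self])
qed

lemma tail_FTC:
  fixes f :: "real \<Rightarrow> real"
  assumes "f \<in> borel_measurable borel"
    and "\<And>u. x \<le> u \<Longrightarrow> (G has_real_derivative f u) (at u)"
    and "\<And>u. x \<le> u \<Longrightarrow> 0 \<le> f u"
    and "(G \<longlongrightarrow> 0) at_top"
  shows "set_integrable lborel {x..} f" "(LBINT u:{x..}. f u) = - G x"
proof -
  have *: "(\<integral>\<^sup>+u. ennreal (indicator {x..} u *\<^sub>R f u) \<partial>lborel) = ennreal (- G x)"
  proof -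
    have "(\<integral>\<^sup>+u. ennreal (indicator {x..} u *\<^sub>R f u) \<partial>lborel) = (\<integral>\<^sup>+u. ennreal (f u) * indicator {x..} u \<partial>lborel)"
      by (rule nn_integral_cong) (auto split: split_indicator)
    then show ?thesis
      using nn_integral_FTC_atLeast[of f x G 0] assms by simp
  qed
  have G: "0 \<le> - G x"
  proof -
    have "G x \<le> G u" if "x \<le> u" for u
      using that assms(2,3) by (intro DERIV_nonneg_imp_nondecreasing[of x u G]) auto
    then have "\<forall>\<^sub>F u in at_top. G x \<le> G u"
      by (auto intro: eventually_mono[OF eventually_ge_at_top[of x]])
    with assms(4) have "G x \<le> 0"
      by (intro tendsto_lowerbound) auto
    then show ?thesis by simp
  qed
  have "has_bochner_integral lborel (\<lambda>u. indicator {x..} u *\<^sub>R f u) (- G x)"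
    by (rule has_bochner_integral_nn_integral)
       (use * G assms(1,3) in \<open>auto split: split_indicator\<close>)
  then show "set_integrable lborel {x..} f" "(LBINT u:{x..}. f u) = - G x"
    unfolding set_integrable_def set_lebesgue_integral_def
    by (auto simp: has_bochner_integral_iff)
qed

lemma set_integrable_logis: "set_integrable lborel {x..} (logis t)"
    and tail_integral_logis: "tail_integral (logis t) x = ln (1 + exp (t - x))"
proof -
  let ?G = "\<lambda>u::real. - ln (1 + exp (t - u))"
  have 1: "logis t \<in> borel_measurable borel"
    unfolding logis_def by measurable
  have 2: "(?G has_real_derivative logis t u) (at u)" for u
  proof -
    have p: "0 < 1 + exp (t - u)" "0 < 1 + exp (u - t)"
      by (auto intro: add_pos_pos)
    have "(?G has_real_derivative exp (t - u) / (1 + exp (t - u))) (at u)"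
      by (rule derivative_eq_intros refl p | simp)+
    also have "exp (t - u) / (1 + exp (t - u)) = logis t u"
      using p unfolding logis_def by (simp add: field_simps exp_diff)
    finally show ?thesis .
  qed
  have 3: "(?G \<longlongrightarrow> 0) at_top"
  proof -
    have "((\<lambda>u. exp (t - u)) \<longlongrightarrow> 0) at_top"
      using tendsto_mult[OF tendsto_const[of "exp t"] filterlim_compose[OF exp_at_bot filterlim_uminus_at_bot_at_top]]
      by (simp add: exp_add[symmetric] comp_def)
    then have "(?G \<longlongrightarrow> - ln (1 + 0)) at_top"
      by (intro tendsto_intros) auto
    then show ?thesis by simp
  qed
  have 4: "0 \<le> logis t u" for u
    unfolding logis_def by (auto intro: add_nonneg_nonneg)
  show "set_integrable lborel {x..} (logis t)" "tail_integral (logis t) x = ln (1 + exp (t - x))"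
    using tail_FTC[of "logis t" x ?G, OF 1 2 4 3] by (auto simp: tail_integral_def)
qed

lemma exp_tail:
  fixes c C :: real
  assumes "0 < c" "0 \<le> C"
  shows "set_integrable lborel {x..} (\<lambda>u. C * exp (- c * u))"
    and "(LBINT u:{x..}. C * exp (- c * u)) = C / c * exp (- c * x)"
proof -
  let ?G = "\<lambda>u. - (C / c * exp (- c * u))"
  have 2: "(?G has_real_derivative C * exp (- c * u)) (at u)" for u
    using assms by (auto intro!: derivative_eq_intros)
  have 3: "(?G \<longlongrightarrow> 0) at_top"
  proof -
    have "((\<lambda>u. exp (- c * u)) \<longlongrightarrow> 0) at_top"
      using assms(1)
      by (intro filterlim_compose[OF exp_at_bot] filterlim_tendsto_neg_mult_at_bot[OF tendsto_const _ filterlim_ident]) auto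
    then have "(?G \<longlongrightarrow> - (C / c * 0)) at_top"
      by (intro tendsto_intros)
    then show ?thesis by simp
  qed
  show "set_integrable lborel {x..} (\<lambda>u. C * exp (- c * u))"
    "(LBINT u:{x..}. C * exp (- c * u)) = C / c * exp (- c * x)"
    using tail_FTC[of "\<lambda>u. C * exp (- c * u)" x ?G, OF _ 2 _ 3] assms by auto
qed

lemma logis_pos: "0 < logis t x" and logis_less_1: "logis t x < 1"
  unfolding logis_def by (auto simp: add_pos_pos intro!: divide_pos_pos)

lemma logis_antimono: "antimono (logis t)"
  unfolding logis_def antimono_def
  by (auto intro!: divide_left_mono mult_pos_pos add_pos_pos)

lemma logis_mono: "s \<le> t \<Longrightarrow> logis s x \<le> logis t x"
  unfolding logis_def by (auto intro!: divide_left_mono mult_pos_pos add_pos_pos)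

lemma logis_le_iff: "logis s x \<le> logis t x \<longleftrightarrow> s \<le> t"
proof -
  have "logis s x \<le> logis t x \<longleftrightarrow> 1 + exp (x - t) \<le> 1 + exp (x - s)"
    using add_pos_pos[OF zero_less_one exp_gt_zero[of "x - t"]] add_pos_pos[OF zero_less_one exp_gt_zero[of "x - s"]]
    unfolding logis_def by (simp add: field_simps)
  then show ?thesis by simp
qed

lemma logis_shift: "logis (t + u) (x + u) = logis t x"
  by (simp add: logis_def)

lemma sandwiched_le: "sandwiched a b F \<Longrightarrow> a \<le> b"
  unfolding sandwiched_def using logis_le_iff[of a 0 b] by (meson order_trans)

lemma sandwiched_mono: "sandwiched a b F \<Longrightarrow> a' \<le> a \<Longrightarrow> b \<le> b' \<Longrightarrow> sandwiched a' b' F"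
  unfolding sandwiched_def by (meson logis_mono order_trans)

section \<open>Tail functions and a single application of \<open>rde\<close>\<close>

context
  fixes F :: "real \<Rightarrow> real"
  assumes F: "tail_function F"
begin

lemma tail_function_antimono: "x \<le> y \<Longrightarrow> F y \<le> F x"
  using F by (auto simp: tail_function_def antimono_def)

lemma tail_function_bounds: "0 \<le> F x" "F x \<le> 1"
  using F by (auto simp: tail_function_def)

lemma tail_function_measurable [measurable]: "F \<in> borel_measurable borel"
  using F by (auto simp: tail_function_def intro: borel_measurable_antimono)

lemma tail_function_Icc: "set_integrable lborel {x..y} F"
  by (rule set_integrable_Icc_bounded[where c = 1]) (use tail_function_bounds in \<open>auto simp: abs_le_iff intro: order_trans[of _ 0]\<close>)

lemma tail_function_integrable: "set_integrable lborel {x..} F"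
proof -
  have "set_integrable lborel ({x..0} \<union> {0..}) F"
    using F tail_function_Icc[of x 0] by (intro set_integrable_Un) (auto simp: tail_function_def)
  then show ?thesis
    by (rule set_integrable_subset) auto
qed

lemma tail_integral_diff:
  assumes "x \<le> y"
  shows "tail_integral F x = (LBINT u:{x..<y}. F u) + tail_integral F y"
proof -
  have *: "{x..} = {x..<y} \<union> {y..}" using assms by auto
  have "set_integrable lborel {x..<y} F"
    by (rule set_integrable_subset[OF tail_function_integrable[of x]]) auto
  then show ?thesis
    unfolding tail_integral_def *
    by (intro set_integral_Un tail_function_integrable) auto
qed

lemma set_integral_const_Ico: "x \<le> y \<Longrightarrow> (LBINT u:{x..<y}. c) = (y - x) * (c::real)"
  unfolding set_lebesgue_integral_def by simp

lemma set_integrable_const_Ico: "set_integrable lborel {x..<y} (\<lambda>_::real. c::real)"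
  by (rule set_integrable_subset[of _ "{x..y}"])
    (auto simp: set_integrable_def emeasure_lborel_Icc_eq)

lemma tail_integral_diff_bounds:
  assumes "x \<le> y"
  shows "(y - x) * F y \<le> tail_integral F x - tail_integral F y"
    and "tail_integral F x - tail_integral F y \<le> (y - x) * F x"
proof -
  have i: "set_integrable lborel {x..<y} F"
    by (rule set_integrable_subset[OF tail_function_integrable[of x]]) auto
  have "(LBINT u:{x..<y}. F y) \<le> (LBINT u:{x..<y}. F u)"
    by (rule set_integral_mono) (auto simp: i set_integrable_const_Ico tail_function_antimono)
  then show "(y - x) * F y \<le> tail_integral F x - tail_integral F y"
    using assms tail_integral_diff[OF assms] by (simp add: set_integral_const_Ico)
  have "(LBINT u:{x..<y}. F u) \<le> (LBINT u:{x..<y}. F x)"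
    by (rule set_integral_mono) (auto simp: i set_integrable_const_Ico tail_function_antimono)
  then show "tail_integral F x - tail_integral F y \<le> (y - x) * F x"
    using assms tail_integral_diff[OF assms] by (simp add: set_integral_const_Ico)
qed

lemma tail_integral_nonneg: "0 \<le> tail_integral F x"
  unfolding tail_integral_def set_lebesgue_integral_def
  by (rule integral_nonneg_AE) (auto intro!: AE_I2 simp: tail_function_bounds)

lemma tail_integral_antimono: "x \<le> y \<Longrightarrow> tail_integral F y \<le> tail_integral F x"
  using tail_integral_diff_bounds(1)[of x y] tail_function_bounds(1)[of y]
  by (smt (verit) mult_nonneg_nonneg)

lemma tail_integral_lipschitz: "\<bar>tail_integral F x - tail_integral F y\<bar> \<le> \<bar>x - y\<bar>"
proof -
  have *: "\<bar>tail_integral F x - tail_integral F y\<bar> \<le> \<bar>x - y\<bar>" if "x \<le> y" for x y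
    using tail_integral_diff_bounds(2)[OF that] tail_integral_antimono[OF that]
      mult_left_mono[OF tail_function_bounds(2)[of x], of "y - x"] that by auto
  show ?thesis
    using *[of x y] *[of y x] by (cases "x \<le> y") (auto simp: abs_minus_commute)
qed

lemma continuous_tail_integral: "isCont (tail_integral F) x"
  unfolding isCont_def
proof (rule LIM_I)
  fix r :: real assume "0 < r"
  then show "\<exists>s>0. \<forall>y. y \<noteq> x \<and> norm (y - x) < s \<longrightarrow> norm (tail_integral F y - tail_integral F x) < r"
    by (intro exI[of _ r]) (auto intro: le_less_trans[OF tail_integral_lipschitz])
qed

lemma rde_continuous: "isCont (rde F) x"
  unfolding rde_def
  by (intro continuous_intros isCont_o2[OF _ continuous_tail_integral])

lemma rde_bounds: "0 < rde F x" "rde F x \<le> 1"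
  by (auto simp: rde_def tail_integral_nonneg)

lemma rde_antimono: "antimono (rde F)"
  by (auto simp: antimono_def rde_def intro: tail_integral_antimono)

text \<open>To the left of \<open>y\<close> the tail is at least \<open>c = F y\<close>, so the tail
  integral at \<open>- x\<close> grows at least linearly in \<open>x\<close> with slope
  \<open>c\<close>. Where \<open>- x\<close> exceeds \<open>y\<close>, the right-hand side is at
  least 1.\<close>

lemma rde_exp_decay: "\<exists>C c. 1 \<le> C \<and> 0 < c \<and> (\<forall>x. rde F x \<le> C * exp (- c * x))"
proof -
  obtain y where y: "0 < F y" using F by (auto simp: tail_function_def)
  define c where "c = F y"
  define C where "C = max 1 (exp (- c * y))"
  have "rde F x \<le> C * exp (- c * x)" for x
  proof (cases "- x \<le> y")
    case True
    have "(y + x) * c \<le> tail_integral F (- x)"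
      using tail_integral_diff_bounds(1)[OF True] tail_integral_nonneg[of y] by (simp add: c_def)
    then have "rde F x \<le> exp (- c * y) * exp (- c * x)"
      unfolding rde_def exp_add[symmetric] by (simp add: algebra_simps)
    also have "\<dots> \<le> C * exp (- c * x)"
      by (intro mult_right_mono) (auto simp: C_def)
    finally show ?thesis .
  next
    case False
    have "1 \<le> exp (- c * y) * exp (- c * x)"
    proof -
      have "c * (y + x) \<le> 0"
        using False y by (intro mult_nonneg_nonpos) (auto simp: c_def)
      then show ?thesis
        unfolding exp_add[symmetric] one_le_exp_iff by (simp add: algebra_simps)
    qed
    also have "\<dots> \<le> C * exp (- c * x)"
      by (intro mult_right_mono) (auto simp: C_def)
    finally show ?thesis
      using rde_bounds(2)[of x] by simp
  qed
  then show ?thesis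
    using y by (intro exI[of _ C] exI[of _ c]) (auto simp: C_def c_def)
qed

lemma tail_function_rde: "tail_function (rde F)"
proof -
  obtain C c where C: "1 \<le> C" "0 < c" "\<And>x. rde F x \<le> C * exp (- c * x)"
    using rde_exp_decay by auto
  have [measurable]: "rde F \<in> borel_measurable borel"
    by (rule borel_measurable_antimono[OF rde_antimono])
  have "set_integrable lborel {0..} (rde F)"
  proof (rule set_integrable_bound)
    show "set_integrable lborel {0..} (\<lambda>u. C * exp (- c * u))"
      by (rule exp_tail) (use C in auto)
    show "set_borel_measurable lborel {0..} (rde F)"
      unfolding set_borel_measurable_def by measurable
    show "AE x in lborel. x \<in> {0..} \<longrightarrow> norm (rde F x) \<le> norm (C * exp (- c * x))"
      using C rde_bounds by (intro AE_I2) (auto simp: abs_mult less_imp_le)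
  qed
  then show ?thesis
    unfolding tail_function_def using rde_antimono rde_bounds by (auto simp: less_imp_le)
qed

text \<open>By \<open>1 - exp (- I) \<le> I\<close>, decay of \<open>F\<close> at the right end
  becomes decay of \<open>1 - rde F\<close> at the left end, with the same rate.\<close>

lemma one_minus_rde_decay:
  assumes "0 < c" "0 \<le> C" "\<And>x. F x \<le> C * exp (- c * x)"
  shows "1 - rde F x \<le> C / c * exp (c * x)"
proof -
  have "tail_integral F (- x) \<le> (LBINT u:{-x..}. C * exp (- c * u))"
    unfolding tail_integral_def
    by (intro set_integral_mono exp_tail tail_function_integrable assms)
  also have "\<dots> = C / c * exp (c * x)"
    using exp_tail(2)[OF assms(1,2), of "-x"] by simp
  finally show ?thesis
    using exp_ge_add_one_self[of "- tail_integral F (- x)"] by (simp add: rde_def)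
qed

text \<open>The integral of \<open>1 - F\<close> over the negative axis is at most
  \<open>C / c\<close>, so the tail integral at \<open>- x\<close> is at least
  \<open>x - C / c\<close>. An arbitrary rate \<open>c\<close> at the left end thus becomes rate
  exactly 1 at the right end.\<close>

lemma rde_sharp_decay:
  assumes "0 < c" "0 \<le> C" "\<And>x. 1 - F x \<le> C * exp (c * x)"
  shows "rde F x \<le> exp (C / c) * exp (- x)"
proof (cases "0 \<le> x")
  case True
  let ?G = "\<lambda>u. u - C / c * exp (c * u)"
  let ?f = "\<lambda>u. 1 - C * exp (c * u)"
  have FTC: "has_bochner_integral lborel (\<lambda>u. ?f u * indicator {-x..0} u) (?G 0 - ?G (- x))"
    by (rule has_bochner_integral_FTC_Icc_real)
       (use True assms(1) in \<open>auto intro!: derivative_eq_intros continuous_intros\<close>)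
  have "?G 0 - ?G (- x) = (\<integral>u. ?f u * indicator {-x..0} u \<partial>lborel)"
    using FTC by (simp add: has_bochner_integral_iff)
  also have "\<dots> \<le> (\<integral>u. indicator {-x..} u *\<^sub>R F u \<partial>lborel)"
  proof (rule integral_mono)
    show "integrable lborel (\<lambda>u. ?f u * indicator {-x..0} u)"
      using FTC by (simp add: has_bochner_integral_iff)
    show "integrable lborel (\<lambda>u. indicator {-x..} u *\<^sub>R F u)"
      using tail_function_integrable[of "-x"] by (simp add: set_integrable_def)
    show "?f u * indicator {-x..0} u \<le> indicator {-x..} u *\<^sub>R F u" for u
      using assms(3)[of u] tail_function_bounds[of u] by (auto split: split_indicator)
  qed
  finally have "x - C / c + C / c * exp (- c * x) \<le> tail_integral F (- x)"
    by (simp add: tail_integral_def set_lebesgue_integral_def)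
  moreover have "0 \<le> C / c * exp (- c * x)"
    using assms by auto
  ultimately show ?thesis
    by (simp add: rde_def exp_add[symmetric])
next
  case False
  have "0 \<le> C / c" using assms by simp
  then have "1 \<le> exp (C / c) * exp (- x)"
    using False unfolding exp_add[symmetric] one_le_exp_iff by linarith
  then show ?thesis
    using rde_bounds(2)[of x] by simp
qed

lemma rde_lower: "0 \<le> x \<Longrightarrow> exp (- tail_integral F 0) * exp (- x) \<le> rde F x"
  using tail_integral_lipschitz[of "-x" 0] by (simp add: rde_def exp_add[symmetric])

text \<open>The tail integral is at least \<open>y = c * exp x\<close>, and
  \<open>1 - exp (- y)\<close> is at least \<open>y / (1 + y)\<close>. For \<open>x \<le> 0\<close>
  one has \<open>y \<le> c\<close>, which makes the factor uniform.\<close>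

lemma one_minus_rde_lower:
  assumes c: "0 < c" "\<And>x. 0 \<le> x \<Longrightarrow> c * exp (- x) \<le> F x" and x: "x \<le> 0"
  shows "c / (1 + c) * exp x \<le> 1 - rde F x"
proof -
  have "c * exp x = (LBINT u:{-x..}. c * exp (- 1 * u))"
    using exp_tail(2)[of 1 c "-x"] c by simp
  also have "\<dots> \<le> tail_integral F (- x)"
    unfolding tail_integral_def
    by (rule set_integral_mono) (use c x exp_tail(1)[of 1 c "-x"] tail_function_integrable in auto)
  finally have I: "c * exp x \<le> tail_integral F (- x)" .
  define y where "y = c * exp x"
  have y: "0 < y" "y \<le> c" using c x by (auto simp: y_def mult_le_cancel_left1)
  have "rde F x \<le> exp (- y)" using I by (simp add: rde_def y_def)
  also have "\<dots> \<le> 1 / (1 + y)"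
    using exp_ge_add_one_self[of y] y by (simp add: exp_minus divide_inverse le_imp_inverse_le)
  finally have "1 - 1 / (1 + y) \<le> 1 - rde F x" by simp
  moreover have "1 - 1 / (1 + y) = y / (1 + y)" using y by (simp add: field_simps)
  moreover have "y / (1 + c) \<le> y / (1 + y)"
    using y by (intro divide_left_mono) auto
  ultimately show ?thesis by (simp add: y_def)
qed

end

section \<open>Iterates and the logistic sandwich\<close>

definition tail_seq :: "(real \<Rightarrow> real) \<Rightarrow> nat \<Rightarrow> real \<Rightarrow> real" where
  "tail_seq F k = (rde ^^ k) F"

lemma tail_seq_0 [simp]: "tail_seq F 0 = F"
  and tail_seq_Suc [simp]: "tail_seq F (Suc k) = rde (tail_seq F k)"
  by (simp_all add: tail_seq_def)

lemma tail_function_tail_seq: "tail_function F \<Longrightarrow> tail_function (tail_seq F k)"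
  by (induction k) (auto intro: tail_function_rde)

lemma tail_function_logis: "tail_function (logis t)"
  unfolding tail_function_def
  using logis_antimono set_integrable_logis by (auto intro: less_imp_le logis_pos logis_less_1)

text \<open>From the fourth iterate on, both tails are comparable with those of the logistic law: this
  explains the condition \<open>k \<ge> 4\<close> for the decisions to be well defined.\<close>

lemma sandwiched_tail_seq_4:
  assumes "tail_function F"
  shows "\<exists>B. sandwiched (- B) B (tail_seq F 4)"
proof -
  define f where "f = tail_seq F"
  have f: "tail_function (f k)" for k
    using assms by (simp add: f_def tail_function_tail_seq)
  have fS: "f (Suc k) = rde (f k)" for k by (simp add: f_def)
  \<comment> \<open>Each round carries a bound to the other end: decay at some rate on the right
    gives the same rate for \<open>1 - f\<close> on the left, this gives rate 1 on the right, and
    the fourth round gives rate 1 on the left as well.\<close>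
  have up: "\<exists>C c. 0 \<le> C \<and> 0 < c \<and> (\<forall>x. 1 - f (Suc (Suc k)) x \<le> C * exp (c * x))" for k
  proof -
    obtain C c where C: "1 \<le> C" "0 < c" "\<And>x. f (Suc k) x \<le> C * exp (- c * x)"
      using rde_exp_decay[OF f[of k]] unfolding fS by auto
    show ?thesis
      using one_minus_rde_decay[OF f[of "Suc k"] C(2) _ C(3)] C(1,2)
      unfolding fS[of "Suc k"] by (intro exI[of _ "C / c"] exI[of _ c]) auto
  qed
  have up': "\<exists>C\<ge>1. \<forall>x. f (Suc (Suc (Suc k))) x \<le> C * exp (- x)" for k
  proof -
    obtain C c where C: "0 \<le> C" "0 < c" "\<And>x. 1 - f (Suc (Suc k)) x \<le> C * exp (c * x)"
      using up[of k] by auto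
    show ?thesis
      using rde_sharp_decay[OF f[of "Suc (Suc k)"] C(2,1,3)] C(1,2)
      unfolding fS[of "Suc (Suc k)"] by (intro exI[of _ "exp (C / c)"]) auto
  qed
  have lo: "\<exists>c>0. \<forall>x\<ge>0. c * exp (- x) \<le> f (Suc k) x" for k
    using rde_lower[OF f[of k]] unfolding fS by (intro exI[of _ "exp (- tail_integral (f k) 0)"]) auto
  have lo': "\<exists>c>0. \<forall>x\<le>0. c * exp x \<le> 1 - f (Suc (Suc k)) x" for k
  proof -
    obtain c where c: "0 < c" "\<And>x. 0 \<le> x \<Longrightarrow> c * exp (- x) \<le> f (Suc k) x"
      using lo[of k] by auto
    show ?thesis
      using one_minus_rde_lower[OF f[of "Suc k"] c] c(1)
      unfolding fS[of "Suc k"] by (intro exI[of _ "c / (1 + c)"]) auto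
  qed
  define g where "g = f 4"
  have g4: "g = f (Suc (Suc (Suc (Suc 0))))" by (simp add: g_def numeral_eq_Suc)
  obtain C1 where C1: "1 \<le> C1" "\<And>x. g x \<le> C1 * exp (- x)"
    using up'[of "Suc 0"] unfolding g4 by auto
  obtain C0 where C0: "1 \<le> C0" "\<And>x. f (Suc (Suc (Suc 0))) x \<le> C0 * exp (- x)"
    using up'[of 0] by auto
  have C2: "1 - g x \<le> C0 * exp x" for x
    using one_minus_rde_decay[OF f[of 3], of 1 C0] C0
    unfolding g4 fS[of "Suc (Suc (Suc 0))"] by (simp add: numeral_eq_Suc)
  obtain c1 where c1: "0 < c1" "\<And>x. 0 \<le> x \<Longrightarrow> c1 * exp (- x) \<le> g x"
    using lo[of "Suc (Suc (Suc 0))"] unfolding g4 by auto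
  obtain c2 where c2: "0 < c2" "\<And>x. x \<le> 0 \<Longrightarrow> c2 * exp x \<le> 1 - g x"
    using lo'[of "Suc (Suc 0)"] unfolding g4 by auto
  have g: "tail_function g" by (simp add: g_def f)
  note gb = tail_function_bounds[OF g]
  have c12: "c1 \<le> 1" "c2 \<le> 1" using c1(2)[of 0] c2(2)[of 0] gb[of 0] by auto
  \<comment> \<open>\<open>logis t x\<close> is the value \<open>h\<close> with
    \<open>h * exp x / (1 - h) = exp t\<close>, so the sandwich amounts to keeping this ratio for
    \<open>g\<close> between \<open>1 / K\<close> and \<open>K\<close>. On each half-line the
    exponential bound for one of numerator and denominator is played against the bound at 0, or the
    exponential bound, for the other.\<close>
  define K where "K = max (C1 / c2) (C0 / c1)"
  have K: "C1 \<le> K * c2" "C0 \<le> K * c1" "0 < K"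
    using c1(1) c2(1) C1(1) C0(1) by (auto simp: K_def max_def field_simps less_max_iff_disj split: if_splits)
  have K1: "1 \<le> K * c2" "1 \<le> K * c1" using K C1(1) C0(1) by auto
  have upper: "g x * exp x \<le> K * (1 - g x)" for x
  proof (cases "0 \<le> x")
    case True
    have "g x * exp x \<le> C1"
      using mult_right_mono[OF C1(2)[of x], of "exp x"] by (simp add: mult.assoc exp_add[symmetric])
    also have "\<dots> \<le> K * c2" by (rule K)
    also have "c2 \<le> 1 - g x"
      using c2(2)[of 0] tail_function_antimono[OF g True] by simp
    finally show ?thesis using K(3) by simp
  next
    case False
    then have "c2 * exp x \<le> 1 - g x" by (intro c2) auto
    then have "K * (c2 * exp x) \<le> K * (1 - g x)" using K(3) by simp
    moreover have "1 * exp x \<le> (K * c2) * exp x" using K1(1) by (rule mult_right_mono) simp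
    moreover have "g x * exp x \<le> 1 * exp x" using gb(2) by (rule mult_right_mono) simp
    ultimately show ?thesis by (simp only: mult.assoc mult_1)
  qed
  have lower: "1 - g x \<le> K * (g x * exp x)" for x
  proof (cases "0 \<le> x")
    case True
    have "1 - g x \<le> K * c1" using K1 gb[of x] by linarith
    also have "c1 \<le> g x * exp x"
      using mult_right_mono[OF c1(2)[OF True], of "exp x"] by (simp add: mult.assoc exp_add[symmetric])
    finally show ?thesis using K(3) by simp
  next
    case False
    have "1 - g x \<le> C0 * exp x" by (rule C2)
    also have "\<dots> \<le> K * c1 * exp x" using K by (intro mult_right_mono) auto
    also have "c1 \<le> g x"
      using c1(2)[of 0] tail_function_antimono[OF g, of x 0] False by simp
    finally show ?thesis using K(3) by (simp add: mult.assoc)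
  qed
  define B where "B = ln K"
  have eB: "exp B = K" using K(3) by (simp add: B_def)
  have "logis (- B) x \<le> g x" for x
  proof -
    have p: "0 < 1 + K * exp x" using K(3) by (simp add: add_pos_pos)
    have "logis (- B) x = 1 / (1 + K * exp x)" by (simp add: logis_def exp_add eB mult.commute)
    also have "\<dots> \<le> g x" using lower[of x] p by (simp add: field_simps)
    finally show ?thesis .
  qed
  moreover have "g x \<le> logis B x" for x
  proof -
    have p: "0 < 1 + exp x / K" using K(3) by (simp add: add_pos_pos)
    have "logis B x = 1 / (1 + exp x / K)" by (simp add: logis_def exp_diff eB)
    moreover have "g x \<le> 1 / (1 + exp x / K)" using upper[of x] p K(3) by (simp add: field_simps)
    ultimately show ?thesis by simp
  qed
  ultimately show ?thesis
    unfolding sandwiched_def g_def f_def by auto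
qed

section \<open>Strict contraction of the sandwich\<close>

lemma rde_lower_pointwise:
  assumes "tail_integral F (- x) \<le> ln (1 + exp (b + x)) - d" "0 \<le> d"
  shows "logis (- b + d) x \<le> rde F x"
proof -
  have p: "0 < 1 + exp (b + x)" "0 < 1 + exp (x + b - d)" by (auto intro: add_pos_pos)
  have "exp d / (1 + exp (b + x)) = exp (- (ln (1 + exp (b + x)) - d))"
    using p by (simp add: exp_diff)
  also have "\<dots> \<le> rde F x" using assms(1) by (simp add: rde_def)
  finally have "exp d / (1 + exp (b + x)) \<le> rde F x" .
  \<comment> \<open>A factor \<open>exp d\<close> beats a shift by \<open>d\<close>: written with
    numerator \<open>exp d\<close>, the shifted function has \<open>exp d\<close> in the denominator
    where the right-hand side has 1.\<close>
  moreover have "logis (- b + d) x \<le> exp d / (1 + exp (b + x))"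
  proof -
    have "1 + exp (b + x) \<le> exp d * (1 + exp (x + b - d))"
      using assms(2) by (simp add: algebra_simps exp_add[symmetric])
    then show ?thesis using p by (simp add: logis_def field_simps)
  qed
  ultimately show ?thesis by simp
qed

lemma rde_upper_pointwise:
  assumes "ln (1 + exp (a + x)) + d \<le> tail_integral F (- x)" "0 \<le> d"
  shows "rde F x \<le> logis (- a - d) x"
proof -
  have p: "0 < 1 + exp (a + x)" "0 < 1 + exp (x + a + d)" by (auto intro: add_pos_pos)
  have "rde F x \<le> exp (- (ln (1 + exp (a + x)) + d))"
    using assms(1) by (simp add: rde_def)
  also have "\<dots> = 1 / (exp d * (1 + exp (a + x)))"
    using p by (simp add: exp_diff exp_minus exp_add divide_inverse mult.commute)
  also have "\<dots> \<le> logis (- a - d) x"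
  proof -
    have "1 + exp (x + a + d) \<le> exp d * (1 + exp (a + x))"
      using assms(2) by (simp add: algebra_simps exp_add[symmetric])
    then show ?thesis using p unfolding logis_def
      by (intro divide_left_mono) (auto simp: algebra_simps intro!: mult_pos_pos add_pos_pos)
  qed
  finally show ?thesis .
qed

lemma rde_logis: "rde (logis t) = logis (- t)"
proof
  fix x
  have "0 < 1 + exp (t + x)" by (simp add: add_pos_pos)
  then show "rde (logis t) x = logis (- t) x"
    by (simp add: rde_def tail_integral_logis exp_minus logis_def divide_inverse add.commute)
qed

lemma tail_integral_mono:
  assumes "tail_function F" "tail_function G" "\<And>u. x \<le> u \<Longrightarrow> F u \<le> G u"
  shows "tail_integral F x \<le> tail_integral G x"
  unfolding tail_integral_def
  by (intro set_integral_mono tail_function_integrable assms) auto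

lemma rde_anti:
  assumes "tail_function F" "tail_function G" "\<And>u. F u \<le> G u"
  shows "rde G x \<le> rde F x"
  unfolding rde_def using tail_integral_mono[OF assms] by simp

lemma sandwiched_rde:
  assumes "tail_function F" "sandwiched a b F"
  shows "sandwiched (- b) (- a) (rde F)"
  unfolding sandwiched_def
  using rde_anti[OF assms(1) tail_function_logis[of b]] rde_anti[OF tail_function_logis[of a] assms(1)] assms(2)
  by (auto simp: sandwiched_def rde_logis)

text \<open>Tells how much of a shift by \<open>d\<close> survives in the tail integral of a
  logistic function: by \<open>exp d \<ge> 1 + d\<close> the arguments of \<open>ln\<close> have
  ratio at least \<open>1 + d / (1 + exp s)\<close>, and \<open>s \<le> B\<close> makes this
  uniform.\<close>

lemma ln_ratio:
  fixes d s B :: real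
  assumes "0 \<le> d" "s \<le> B"
  shows "ln (1 + exp (- s)) + ln (1 + d / (1 + exp B)) \<le> ln (1 + exp (d - s))"
proof -
  have p: "0 < 1 + exp (- s)" "0 < 1 + exp (d - s)" "0 < 1 + exp B" "0 < 1 + exp s"
    by (simp_all add: add_pos_pos)
  have q: "0 < 1 + d / (1 + exp B)" using assms p by (auto intro: add_pos_nonneg)
  have "(1 + exp (- s)) * (1 + d / (1 + exp B)) \<le> (1 + exp (- s)) * (1 + d / (1 + exp s))"
    using assms p by (intro mult_left_mono add_left_mono divide_left_mono) auto
  also have "\<dots> = 1 + exp (- s) + d * ((1 + exp (- s)) / (1 + exp s))"
    by (simp add: algebra_simps)
  also have "(1 + exp (- s)) / (1 + exp s) = exp (- s)"
    using p by (simp add: field_simps exp_add[symmetric])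
  also have "1 + exp (- s) + d * exp (- s) \<le> 1 + exp (d - s)"
  proof -
    have "(1 + d) * exp (- s) \<le> exp d * exp (- s)"
      by (intro mult_right_mono exp_ge_add_one_self) auto
    then show ?thesis by (simp add: algebra_simps exp_add[symmetric])
  qed
  finally have "ln ((1 + exp (- s)) * (1 + d / (1 + exp B))) \<le> ln (1 + exp (d - s))"
    using p q by (subst ln_le_cancel_iff) auto
  then show ?thesis using p q by (simp add: ln_mult)
qed

lemma set_integral_Ico_mono:
  assumes F: "tail_function F" and G: "tail_function G"
    and "x \<le> y" "\<And>u. x \<le> u \<Longrightarrow> u < y \<Longrightarrow> F u + c \<le> G u"
  shows "tail_integral F x - tail_integral F y + (y - x) * c \<le> tail_integral G x - tail_integral G y"
proof -
  have i: "set_integrable lborel {x..<y} F" "set_integrable lborel {x..<y} G"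
    using F G by (auto intro: set_integrable_subset[OF tail_function_integrable[of _ x]])
  have "(LBINT u:{x..<y}. F u) + (LBINT u:{x..<y}. c) \<le> (LBINT u:{x..<y}. G u)"
  proof -
    note c = set_integrable_const_Ico[OF F, of x y c]
    have "(LBINT u:{x..<y}. F u) + (LBINT u:{x..<y}. c) = (LBINT u:{x..<y}. F u + c)"
      using i(1) c by (rule set_integral_add(2)[symmetric])
    also have "\<dots> \<le> (LBINT u:{x..<y}. G u)"
      by (rule set_integral_mono[OF set_integral_add(1)[OF i(1) c] i(2)]) (use assms(4) in auto)
    finally show ?thesis .
  qed
  then show ?thesis
    using tail_integral_diff[OF F \<open>x \<le> y\<close>] tail_integral_diff[OF G \<open>x \<le> y\<close>] \<open>x \<le> y\<close>
    by (simp add: set_integral_const_Ico[OF F])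
qed

lemma tail_integral_gain:
  assumes F: "tail_function F" and G: "tail_function G"
    and "x \<le> p" "p \<le> q" "\<And>u. F u \<le> G u" "\<And>u. p \<le> u \<Longrightarrow> u < q \<Longrightarrow> F u + c \<le> G u"
  shows "tail_integral F x + (q - p) * c \<le> tail_integral G x"
  using set_integral_Ico_mono[OF F G, of x p 0] set_integral_Ico_mono[OF F G, of p q c]
    tail_integral_mono[OF F G, of q] assms(3-6)
  by (simp add: less_imp_le)

lemma ln_gain_le:
  fixes d B :: real
  assumes "0 \<le> d"
  shows "ln (1 + d / (1 + exp B)) \<le> d" "0 \<le> ln (1 + d / (1 + exp B))"
proof -
  have p: "0 < 1 + exp B" by (auto intro: add_pos_pos)
  have "d / (1 + exp B) \<le> d / 1" using assms by (intro divide_left_mono) (auto intro: add_pos_pos)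
  moreover have "0 \<le> d / (1 + exp B)" using assms p by simp
  ultimately show "ln (1 + d / (1 + exp B)) \<le> d" "0 \<le> ln (1 + d / (1 + exp B))"
    using ln_add_one_self_le_self[of "d / (1 + exp B)"] by (auto intro: order_trans)
qed

text \<open>If \<open>- y\<close> lies beyond \<open>p\<close>, the whole tail integral uses the
  better bound. Otherwise the surplus collected beyond \<open>p\<close> is kept while integrating
  down to \<open>- y\<close>, and \<open>ln_ratio\<close> bounds it from below independently of
  \<open>y\<close>.\<close>

lemma rde_gain_upper:
  assumes F: "tail_function F" and "\<And>u. logis c u \<le> F u" "\<And>u. p \<le> u \<Longrightarrow> logis (c + d) u \<le> F u"
    and d: "0 \<le> d" "p - c \<le> B"
  shows "rde F y \<le> logis (- c - ln (1 + d / (1 + exp B))) y"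
proof (cases "p \<le> - y")
  case True
  have "tail_integral (logis (c + d)) (- y) \<le> tail_integral F (- y)"
    using assms True by (intro tail_integral_mono tail_function_logis) auto
  then have "rde F y \<le> logis (- (c + d) - 0) y"
    by (intro rde_upper_pointwise) (auto simp: tail_integral_logis)
  also have "\<dots> \<le> logis (- c - ln (1 + d / (1 + exp B))) y"
    using ln_gain_le[OF d(1)] by (intro logis_mono) auto
  finally show ?thesis .
next
  case False
  have "tail_integral (logis (c + d)) p \<le> tail_integral F p"
    using assms by (intro tail_integral_mono tail_function_logis) auto
  moreover have "tail_integral (logis c) (- y) - tail_integral (logis c) p \<le> tail_integral F (- y) - tail_integral F p"
    using set_integral_Ico_mono[OF tail_function_logis[of c] F, of "-y" p 0] False assms by auto
  moreover have "ln (1 + exp (c - p)) + ln (1 + d / (1 + exp B)) \<le> ln (1 + exp (c + d - p))"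
    using ln_ratio[OF d] by (simp add: algebra_simps)
  ultimately have "ln (1 + exp (c + y)) + ln (1 + d / (1 + exp B)) \<le> tail_integral F (- y)"
    by (simp add: tail_integral_logis)
  then show ?thesis
    by (rule rde_upper_pointwise) (rule ln_gain_le[OF d(1)])
qed

text \<open>Mirror image of \<open>rde_gain_upper\<close>. The extra \<open>d\<close> in the bound
  on \<open>p - c\<close> appears because the smaller shift \<open>c - d\<close> is now the base
  point of \<open>ln_ratio\<close>.\<close>

lemma rde_gain_lower:
  assumes F: "tail_function F" and "\<And>u. F u \<le> logis c u" "\<And>u. p \<le> u \<Longrightarrow> F u \<le> logis (c - d) u"
    and d: "0 \<le> d" "p - c + d \<le> B"
  shows "logis (- c + ln (1 + d / (1 + exp B))) y \<le> rde F y"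
proof (cases "p \<le> - y")
  case True
  have "tail_integral F (- y) \<le> tail_integral (logis (c - d)) (- y)"
    using assms True by (intro tail_integral_mono tail_function_logis) auto
  then have "logis (- (c - d) + 0) y \<le> rde F y"
    by (intro rde_lower_pointwise) (auto simp: tail_integral_logis)
  moreover have "logis (- c + ln (1 + d / (1 + exp B))) y \<le> logis (- (c - d) + 0) y"
    using ln_gain_le[OF d(1), of B] by (intro logis_mono) auto
  ultimately show ?thesis by simp
next
  case False
  have "tail_integral F p \<le> tail_integral (logis (c - d)) p"
    using assms by (intro tail_integral_mono tail_function_logis) auto
  moreover have "tail_integral F (- y) - tail_integral F p \<le> tail_integral (logis c) (- y) - tail_integral (logis c) p"
    using set_integral_Ico_mono[OF F tail_function_logis[of c], of "-y" p 0] False assms by auto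
  moreover have "ln (1 + exp (c - d - p)) + ln (1 + d / (1 + exp B)) \<le> ln (1 + exp (c - p))"
    using ln_ratio[OF d] by (simp add: algebra_simps)
  ultimately have "tail_integral F (- y) \<le> ln (1 + exp (c + y)) - ln (1 + d / (1 + exp B))"
    by (simp add: tail_integral_logis)
  then show ?thesis
    by (rule rde_lower_pointwise) (rule ln_gain_le[OF d(1)])
qed

text \<open>Converts a horizontal shift into a vertical gap. The slope of the logistic function has
  no positive lower bound on the whole line, hence the restriction to a window of radius
  \<open>A\<close>.\<close>

lemma logis_gap:
  assumes "0 \<le> h" "\<bar>u - c\<bar> \<le> A" "\<bar>u - c - h\<bar> \<le> A"
  shows "logis c u + exp (- A) * h / (1 + exp A)\<^sup>2 \<le> logis (c + h) u"
proof -
  define z w where "z = exp (u - c - h)" and "w = exp (u - c)"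
  have zw: "0 < z" "0 < w" "z \<le> exp A" "w \<le> exp A" "exp (- A) \<le> z" "w = z * exp h"
    using assms by (auto simp: z_def w_def exp_add[symmetric])
  have "exp (- A) * h \<le> z * (exp h - 1)"
    using zw assms exp_ge_add_one_self[of h] by (intro mult_mono) (auto simp: le_diff_eq add.commute)
  also have "\<dots> = w - z" using zw by (simp add: algebra_simps)
  finally have 1: "exp (- A) * h \<le> w - z" .
  have "(1 + z) * (1 + w) \<le> (1 + exp A) * (1 + exp A)"
    using zw by (intro mult_mono) auto
  note prod = this
  have "exp (- A) * h / (1 + exp A)\<^sup>2 \<le> (w - z) / ((1 + z) * (1 + w))"
  proof (rule frac_le)
    show "0 \<le> w - z" using 1 assms(1) by (intro order_trans[OF _ 1]) simp
    show "0 < (1 + z) * (1 + w)" using zw(1,2) by (simp add: add_pos_pos)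
    show "exp (- A) * h \<le> w - z" by (rule 1)
    show "(1 + z) * (1 + w) \<le> (1 + exp A)\<^sup>2" using prod unfolding power2_eq_square .
  qed
  also have "\<dots> = logis (c + h) u - logis c u"
  proof -
    have "logis (c + h) u = 1 / (1 + z)" "logis c u = 1 / (1 + w)"
      by (simp_all add: logis_def z_def w_def diff_diff_eq)
    moreover have "1 + z \<noteq> 0" "1 + w \<noteq> 0" using zw(1,2) by auto
    ultimately show ?thesis by (simp add: diff_frac_eq)
  qed
  finally show ?thesis by simp
qed

text \<open>A tail function squeezed between two shifts of the logistic tail lies, at the origin, on one
  side of the middle shift. By monotonicity it stays away from the opposite bound on a whole
  interval, which one application of \<^const>\<open>rde\<close> turns into a gain on a half-line and a second one
  into a gain everywhere.\<close>

lemma sandwiched_contraction: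
  assumes "0 < l" "0 \<le> B"
  shows "\<exists>d>0. \<forall>F a b. tail_function F \<longrightarrow> sandwiched a b F \<longrightarrow> - B \<le> a \<longrightarrow> b \<le> B \<longrightarrow> l \<le> b - a \<longrightarrow>
    sandwiched (a + d) b (rde (rde F)) \<or> sandwiched a (b - d) (rde (rde F))"
proof -
  \<comment> \<open>The middle shift is at least \<open>l / 2\<close> away from both bounds, and
    moving the argument by at most \<open>h = l / 4\<close> costs at most \<open>h\<close>, so a
    shift of \<open>h\<close> is left. \<open>A\<close> bounds the arguments given to
    \<open>logis_gap\<close>, \<open>\<kappa>\<close> is the resulting vertical gap and
    \<open>D\<close> its area over an interval of length \<open>h\<close>; \<open>B + D + h\<close>
    covers what both branches need in \<open>rde_gain_upper\<close> and
    \<open>rde_gain_lower\<close>.\<close>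
  define h where "h = l / 4"
  define A where "A = B + 2 * h"
  define \<kappa> where "\<kappa> = exp (- A) * h / (1 + exp A)\<^sup>2"
  define D where "D = h * \<kappa>"
  define d where "d = ln (1 + D / (1 + exp (B + D + h)))"
  have h: "0 < h" using assms by (simp add: h_def)
  have ep: "0 < 1 + exp t" for t :: real by (auto intro: add_pos_pos)
  have D: "0 < D" using h ep[of A] by (simp add: D_def \<kappa>_def)
  have d: "0 < d" using D ep[of "B + D + h"] unfolding d_def by (intro ln_gt_zero) (simp only: less_add_same_cancel1 zero_less_divide_iff, simp)
  show ?thesis
  proof (intro exI[of _ d] conjI allI impI d)
    fix F a b
    assume F: "tail_function F" and s: "sandwiched a b F" and ab: "- B \<le> a" "b \<le> B" "l \<le> b - a"
    have ab': "a \<le> b" using assms ab by simp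
    define m where "m = (a + b) / 2"
    have s1: "sandwiched (- b) (- a) (rde F)" by (rule sandwiched_rde[OF F s])
    have F1: "tail_function (rde F)" by (rule tail_function_rde[OF F])
    have s2: "sandwiched a b (rde (rde F))" using sandwiched_rde[OF F1 s1] by simp
    show "sandwiched (a + d) b (rde (rde F)) \<or> sandwiched a (b - d) (rde (rde F))"
    proof (cases "F 0 \<le> logis m 0")
      case True
      have gap: "F u + \<kappa> \<le> logis b u" if "0 \<le> u" "u < h" for u
      proof -
        have "F u \<le> logis m 0" using tail_function_antimono[OF F that(1)] True by simp
        also have "\<dots> = logis (m + u) u" using logis_shift[of m u 0] by simp
        also have "\<dots> \<le> logis (b - h) u"
          using that ab by (intro logis_mono) (auto simp: m_def h_def field_simps)
        finally show ?thesis
          using logis_gap[of h u "b - h" A] that ab ab' h by (auto simp: A_def \<kappa>_def abs_le_iff)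
      qed
      have "logis (- b + D) u \<le> rde F u" if "0 \<le> u" for u
      proof (rule rde_lower_pointwise)
        have "tail_integral F (- u) + (h - 0) * \<kappa> \<le> tail_integral (logis b) (- u)"
          using that h gap s
          by (intro tail_integral_gain[OF F tail_function_logis, where p = 0]) (auto simp: sandwiched_def)
        then show "tail_integral F (- u) \<le> ln (1 + exp (b + u)) - D"
          by (simp add: tail_integral_logis D_def)
      qed (use D in simp)
      then have "rde (rde F) y \<le> logis (- (- b) - d) y" for y
        unfolding d_def using s1 D ab h
        by (intro rde_gain_upper[OF F1, where p = 0]) (auto simp: sandwiched_def)
      then have "sandwiched a (b - d) (rde (rde F))"
        using s2 by (simp add: sandwiched_def)
      then show ?thesis ..
    next
      case False
      have gap: "logis a u + \<kappa> \<le> F u" if "- h \<le> u" "u < 0" for u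
      proof -
        have "logis (a + h) u \<le> logis (m + u) u"
          using that ab by (intro logis_mono) (auto simp: m_def h_def field_simps)
        also have "\<dots> = logis m 0" using logis_shift[of m u 0] by simp
        also have "\<dots> \<le> F u" using tail_function_antimono[OF F, of u 0] False that by simp
        finally show ?thesis
          using logis_gap[of h u a A] that ab ab' h by (auto simp: A_def \<kappa>_def abs_le_iff)
      qed
      have "rde F u \<le> logis (- a - D) u" if "h \<le> u" for u
      proof (rule rde_upper_pointwise)
        have "tail_integral (logis a) (- u) + (0 - (- h)) * \<kappa> \<le> tail_integral F (- u)"
          using that h gap s
          by (intro tail_integral_gain[OF tail_function_logis F]) (auto simp: sandwiched_def)
        then show "ln (1 + exp (a + u)) + D \<le> tail_integral F (- u)"
          by (simp add: tail_integral_logis D_def)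
      qed (use D in simp)
      then have "logis (- (- a) + d) y \<le> rde (rde F) y" for y
        unfolding d_def using s1 D ab ab' h
        by (intro rde_gain_lower[OF F1, where p = h]) (auto simp: sandwiched_def)
      then have "sandwiched (a + d) b (rde (rde F))"
        using s2 by (simp add: sandwiched_def)
      then show ?thesis ..
    qed
  qed
qed

text \<open>While the width is at least \<open>l\<close>, every second round removes the same amount
  \<open>d\<close>, because the shifts never leave the interval from \<open>- B\<close> to
  \<open>B\<close>. The width would end up negative.\<close>

lemma sandwiched_narrow:
  assumes F: "tail_function F" and B: "sandwiched (- B) B F" and l: "0 < l"
  shows "\<exists>k a b. sandwiched a b (tail_seq F (2 * k)) \<and> b - a < l"
proof (rule ccontr)
  assume neg: "\<not> ?thesis"
  have B0: "0 \<le> B" using sandwiched_le[OF B] by simp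
  obtain d where d: "0 < d" "\<And>F a b. tail_function F \<Longrightarrow> sandwiched a b F \<Longrightarrow> - B \<le> a \<Longrightarrow> b \<le> B \<Longrightarrow>
      l \<le> b - a \<Longrightarrow> sandwiched (a + d) b (rde (rde F)) \<or> sandwiched a (b - d) (rde (rde F))"
    using sandwiched_contraction[OF l B0] by auto
  have *: "\<exists>a b. sandwiched a b (tail_seq F (2 * k)) \<and> - B \<le> a \<and> b \<le> B \<and> b - a \<le> 2 * B - k * d" for k
  proof (induction k)
    case 0
    then show ?case using B by (intro exI[of _ "- B"] exI[of _ B]) auto
  next
    case (Suc k)
    then obtain a b where ab: "sandwiched a b (tail_seq F (2 * k))" "- B \<le> a" "b \<le> B" "b - a \<le> 2 * B - k * d"
      by auto
    have "sandwiched (a + d) b (tail_seq F (2 * Suc k)) \<or> sandwiched a (b - d) (tail_seq F (2 * Suc k))"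
      using d(2)[OF tail_function_tail_seq[OF F] ab(1-3)] neg ab(1) by (simp add: not_less)
    then show ?case
    proof
      assume "sandwiched (a + d) b (tail_seq F (2 * Suc k))"
      then show ?thesis
        using ab d(1) by (intro exI[of _ "a + d"] exI[of _ b]) (auto simp: algebra_simps)
    next
      assume "sandwiched a (b - d) (tail_seq F (2 * Suc k))"
      then show ?thesis
        using ab d(1) by (intro exI[of _ a] exI[of _ "b - d"]) (auto simp: algebra_simps)
    qed
  qed
  obtain k :: nat where "2 * B < k * d"
    using reals_Archimedean3[OF d(1)] by auto
  with *[of k] sandwiched_le show False by fastforce
qed

lemma tail_seq_add: "tail_seq F (m + n) = tail_seq (tail_seq F m) n"
  unfolding tail_seq_def add.commute[of m n] funpow_add by simp

lemma sandwiched_even: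
  assumes "tail_function F" "sandwiched a b (tail_seq F (2 * j))" "j \<le> k"
  shows "sandwiched a b (tail_seq F (2 * k))"
  using assms(3)
proof (induction k rule: dec_induct)
  case base
  then show ?case by (rule assms)
next
  case (step n)
  have t: "tail_function (tail_seq F (2 * n))" by (rule tail_function_tail_seq[OF assms(1)])
  show ?case
    using sandwiched_rde[OF tail_function_rde[OF t] sandwiched_rde[OF t step.IH]] by simp
qed

text \<open>Every lower shift found at some even time is below every upper shift found at another,
  since both persist to a common later even time. The supremum of the lower shifts therefore lies in
  each of the arbitrarily narrow sandwiches.\<close>

theorem tail_seq_attracted:
  assumes F: "tail_function F"
  shows "\<exists>\<gamma>. \<forall>l>0. \<exists>j. sandwiched (\<gamma> - l) (\<gamma> + l) (tail_seq F (2 * j))"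
proof -
  obtain B where B: "sandwiched (- B) B (tail_seq F 4)"
    using sandwiched_tail_seq_4[OF F] by auto
  define A where "A = {a. \<exists>j b. sandwiched a b (tail_seq F (2 * j))}"
  have narrow: "\<exists>j a b. sandwiched a b (tail_seq F (2 * j)) \<and> b - a < l" if l: "0 < l" for l
  proof -
    obtain k a b where kab: "sandwiched a b (tail_seq (tail_seq F 4) (2 * k))" "b - a < l"
      using sandwiched_narrow[OF tail_function_tail_seq[OF F, of 4] B l] by blast
    have "4 + 2 * k = 2 * (2 + k)" by simp
    then have "sandwiched a b (tail_seq F (2 * (2 + k)))"
      using kab(1) by (simp only: tail_seq_add[symmetric])
    with kab(2) show ?thesis by blast
  qed
  have le: "a \<le> b" if "sandwiched a b' (tail_seq F (2 * i))" "sandwiched a' b (tail_seq F (2 * j))" for a b a' b' i j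
  proof -
    have "sandwiched a b' (tail_seq F (2 * max i j))" "sandwiched a' b (tail_seq F (2 * max i j))"
      using that by (auto intro: sandwiched_even[OF F])
    then have "logis a 0 \<le> logis b 0"
      unfolding sandwiched_def by (blast intro: order_trans)
    then show ?thesis by (simp add: logis_le_iff)
  qed
  define \<gamma> where "\<gamma> = Sup A"
  have "sandwiched (- B) B (tail_seq F (2 * 2))" using B by simp
  from le[OF _ this] have bdd: "bdd_above A"
    unfolding A_def by (intro bdd_aboveI[of _ B]) blast
  have "\<exists>j. sandwiched (\<gamma> - l) (\<gamma> + l) (tail_seq F (2 * j))" if l: "0 < l" for l
  proof -
    obtain j a b where jab: "sandwiched a b (tail_seq F (2 * j))" "b - a < l"
      using narrow[OF l] by blast
    have "a \<in> A" using jab(1) by (auto simp: A_def)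
    then have "a \<le> \<gamma>" unfolding \<gamma>_def by (intro cSup_upper bdd)
    moreover have "\<gamma> \<le> b"
      unfolding \<gamma>_def using \<open>a \<in> A\<close> le[OF _ jab(1)] by (intro cSup_least) (auto simp: A_def)
    ultimately show ?thesis
      using sandwiched_mono[OF jab(1), of "\<gamma> - l" "\<gamma> + l"] jab(2) by auto
  qed
  then show ?thesis by auto
qed

section \<open>Poisson processes with independent marks\<close>

lemma tail_integral_tendsto_0:
  assumes "tail_function F"
  shows "(\<lambda>n. tail_integral F (real n + x)) \<longlonglongrightarrow> 0"
proof -
  have "(\<lambda>n. LBINT u:{real n + x..}. F u) \<longlonglongrightarrow> (LBINT u:(\<Inter>n. {real n + x..}). F u)"
    by (rule set_integral_cont_down)
       (auto simp: decseq_def intro: tail_function_integrable[OF assms])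
  moreover have "(\<Inter>n::nat. {real n + x..}) = {}"
  proof -
    have "\<exists>n::nat. y < real n + x" for y
      using reals_Archimedean2[of "y - x"] by (auto simp: algebra_simps)
    then have "y \<notin> (\<Inter>n::nat. {real n + x..})" for y
      by (metis INT_E UNIV_I atLeast_iff not_le)
    then show ?thesis by blast
  qed
  ultimately show ?thesis
    by (simp add: tail_integral_def set_lebesgue_integral_def)
qed

declare One_nat_def [simp del]

lemma sets_Int_INT:
  assumes "finite J" "\<And>j. j \<in> J \<Longrightarrow> A j \<in> sets N"
  shows "space N \<inter> (\<Inter>j\<in>J. A j) \<in> sets N"
  using assms by (cases "J = {}") (auto intro!: sets.Int sets.finite_INT)

text \<open>Intersecting with \<open>space M\<close> covers an empty \<open>J\<close>, whose plain
  intersection would be \<open>UNIV\<close>.\<close>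

lemma (in prob_space) prob_space_Int_INT:
  assumes "indep_sets F I" "J \<subseteq> I" "finite J" "\<And>j. j \<in> J \<Longrightarrow> A j \<in> F j"
  shows "prob (space M \<inter> (\<Inter>j\<in>J. A j)) = (\<Prod>j\<in>J. prob (A j))"
proof (cases "J = {}")
  case False
  have "A j \<subseteq> space M" if "j \<in> J" for j
  proof (rule sets.sets_into_space)
    have "F j \<subseteq> events" using assms(1,2) that by (auto simp: indep_sets_def)
    then show "A j \<in> events" using assms(4)[OF that] by blast
  qed
  then have "space M \<inter> (\<Inter>j\<in>J. A j) = (\<Inter>j\<in>J. A j)" using False by blast
  then show ?thesis using assms False by (simp add: indep_setsD)
qed (simp add: prob_space)

section \<open>Generating functions of Poisson counts\<close>

context prob_space
begin

lemma expectation_power_poisson: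
  fixes N :: "'a \<Rightarrow> nat"
  assumes [measurable]: "N \<in> M \<rightarrow>\<^sub>M count_space UNIV"
    and N: "\<And>n. \<P>(\<omega> in M. N \<omega> = n) = r ^ n / fact n * exp (- r)"
    and "0 \<le> r" "0 \<le> s" "s \<le> 1"
  shows "expectation (\<lambda>\<omega>. s ^ N \<omega>) = exp (- r * (1 - s))"
proof -
  have sums: "(\<lambda>n. s ^ n * (r ^ n / fact n * exp (- r))) sums exp (- r * (1 - s))"
  proof -
    have "(\<lambda>n. exp (- r) * ((r * s) ^ n /\<^sub>R fact n)) sums (exp (- r) * exp (r * s))"
      by (intro sums_mult exp_converges)
    moreover have "exp (- r) * exp (r * s) = exp (- r * (1 - s))"
      by (simp add: exp_add[symmetric] algebra_simps)
    ultimately show ?thesis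
      by (simp add: power_mult_distrib divide_inverse mult_ac)
  qed
  have "(\<integral>\<^sup>+\<omega>. ennreal (s ^ N \<omega>) \<partial>M) = (\<integral>\<^sup>+\<omega>. (\<Sum>n. ennreal (s ^ n) * indicator {\<omega> \<in> space M. N \<omega> = n} \<omega>) \<partial>M)"
  proof (rule nn_integral_cong)
    fix \<omega> assume "\<omega> \<in> space M"
    then have "(\<lambda>n. ennreal (s ^ n) * indicator {\<omega> \<in> space M. N \<omega> = n} \<omega>) =
        (\<lambda>n. if n = N \<omega> then ennreal (s ^ n) else 0)"
      by (auto simp: fun_eq_iff)
    then show "ennreal (s ^ N \<omega>) = (\<Sum>n. ennreal (s ^ n) * indicator {\<omega> \<in> space M. N \<omega> = n} \<omega>)"
      using sums_single[of "N \<omega>" "\<lambda>n. ennreal (s ^ n)"] by (simp add: sums_iff)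
  qed
  also have "\<dots> = (\<Sum>n. \<integral>\<^sup>+\<omega>. ennreal (s ^ n) * indicator {\<omega> \<in> space M. N \<omega> = n} \<omega> \<partial>M)"
    by (rule nn_integral_suminf) measurable
  also have "\<dots> = (\<Sum>n. ennreal (s ^ n * (r ^ n / fact n * exp (- r))))"
  proof (intro suminf_cong)
    fix n
    have "(\<integral>\<^sup>+\<omega>. ennreal (s ^ n) * indicator {\<omega> \<in> space M. N \<omega> = n} \<omega> \<partial>M) = ennreal (s ^ n) * emeasure M {\<omega> \<in> space M. N \<omega> = n}"
      by (subst nn_integral_cmult_indicator) auto
    also have "\<dots> = ennreal (s ^ n * (r ^ n / fact n * exp (- r)))"
      using assms by (simp add: emeasure_eq_measure N ennreal_mult'[symmetric])
    finally show "(\<integral>\<^sup>+\<omega>. ennreal (s ^ n) * indicator {\<omega> \<in> space M. N \<omega> = n} \<omega> \<partial>M) = ennreal (s ^ n * (r ^ n / fact n * exp (- r)))" .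
  qed
  also have "\<dots> = ennreal (exp (- r * (1 - s)))"
    using assms sums by (intro suminf_ennreal_eq) auto
  finally have "(\<integral>\<^sup>+\<omega>. ennreal (s ^ N \<omega>) \<partial>M) = ennreal (exp (- r * (1 - s)))" .
  then show ?thesis
    using assms measurable_compose[OF assms(1), of "\<lambda>n. s ^ n" borel]
    by (intro integral_eq_nn_integral[THEN trans]) auto
qed

text \<open>Counts in disjoint sets are independent, so their generating functions multiply. Later
  \<open>s j\<close> is the probability that the mark of a point in \<open>B j\<close> does not
  exceed its threshold.\<close>

lemma poisson_laplace:
  assumes pp: "ordered_poisson_process M \<xi>"
    and B: "\<And>j. j < (m::nat) \<Longrightarrow> B j \<in> sets borel \<and> B j \<subseteq> {0..} \<and> emeasure lborel (B j) < \<infinity>"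
    and disj: "disjoint_family_on B {..<m}"
    and s: "\<And>j. j < m \<Longrightarrow> 0 \<le> s j \<and> s j \<le> (1::real)"
  shows "expectation (\<lambda>\<omega>. \<Prod>j<m. s j ^ num_points \<xi> (B j) \<omega>) = exp (- (\<Sum>j<m. measure lborel (B j) * (1 - s j)))"
proof -
  have iv: "indep_vars (\<lambda>_. count_space UNIV) (\<lambda>j. num_points \<xi> (B j)) {..<m}"
    using pp B disj unfolding ordered_poisson_process_def by blast
  have mb: "num_points \<xi> (B j) \<in> M \<rightarrow>\<^sub>M count_space UNIV" if "j < m" for j
    using iv that by (auto simp: indep_vars_def)
  have "expectation (\<lambda>\<omega>. \<Prod>j<m. s j ^ num_points \<xi> (B j) \<omega>) = (\<Prod>j<m. expectation (\<lambda>\<omega>. s j ^ num_points \<xi> (B j) \<omega>))"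
  proof (rule indep_vars_lebesgue_integral)
    show "indep_vars (\<lambda>_. borel) (\<lambda>j \<omega>. s j ^ num_points \<xi> (B j) \<omega>) {..<m}"
      by (rule indep_vars_compose2[OF iv]) auto
    show "integrable M (\<lambda>\<omega>. s j ^ num_points \<xi> (B j) \<omega>)" if "j \<in> {..<m}" for j
      using that mb[of j] s[of j]
      by (intro integrable_const_bound[where B = 1] measurable_compose[OF _ borel_measurable_count_space])
        (auto simp: power_le_one)
  qed auto
  also have "\<dots> = (\<Prod>j<m. exp (- measure lborel (B j) * (1 - s j)))"
  proof (rule prod.cong)
    fix j assume j: "j \<in> {..<m}"
    have "\<And>n. \<P>(\<omega> in M. num_points \<xi> (B j) \<omega> = n)
               = measure lborel (B j) ^ n / fact n * exp (- measure lborel (B j))"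
      using pp B j unfolding ordered_poisson_process_def by blast
    then show "expectation (\<lambda>\<omega>. s j ^ num_points \<xi> (B j) \<omega>) = exp (- measure lborel (B j) * (1 - s j))"
      using j s mb by (intro expectation_power_poisson) auto
  qed simp
  also have "\<dots> = exp (- (\<Sum>j<m. measure lborel (B j) * (1 - s j)))"
    by (simp add: exp_sum[symmetric] sum_negf)
  finally show ?thesis .
qed

text \<open>The points are frozen and only the marks are random. Disjointness puts each point into
  at most one set \<open>B j\<close>, hence under at most one threshold, and the product over the
  finitely many points concerned can be grouped by \<open>j\<close>.\<close>

lemma prob_marks_le:
  fixes Y :: "nat \<Rightarrow> 'a \<Rightarrow> ereal" and c :: "nat \<Rightarrow> real"
  assumes Y: "indep_vars (\<lambda>_. borel) Y {1..}"
    and F: "\<And>i x. 1 \<le> i \<Longrightarrow> \<P>(\<omega> in M. ereal x < Y i \<omega>) = F x"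
    and fin: "\<And>j. j < m \<Longrightarrow> finite {i \<in> {1..}. x i \<in> B j}"
    and disj: "disjoint_family_on B {..<m}"
  shows "\<P>(\<omega> in M. \<forall>i\<ge>1. \<forall>j<m. x i \<in> B j \<longrightarrow> Y i \<omega> \<le> ereal (c j)) =
    (\<Prod>j<m. (1 - F (c j)) ^ card {i \<in> {1..}. x i \<in> B j})"
proof -
  define I where "I j = {i \<in> {1..}. x i \<in> B j}" for j
  define U where "U = (\<Union>j<m. I j)"
  define A where "A i = {y. \<forall>j<m. x i \<in> B j \<longrightarrow> y \<le> ereal (c j)}" for i
  have Ym: "Y i \<in> borel_measurable M" if "1 \<le> i" for i
    using Y that by (auto simp: indep_vars_def)
  have A: "A i \<in> sets borel" for i
    unfolding A_def by measurable
  have finU: "finite U" using fin by (auto simp: U_def I_def)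
  have unique: "j = k" if "i \<in> I j" "i \<in> I k" "j < m" "k < m" for i j k
    using that disj unfolding I_def disjoint_family_on_def by blast
  have Ai: "A i = {..ereal (c j)}" if "i \<in> I j" "j < m" for i j
    using that unique[of i j] by (auto simp: A_def I_def)
  have eq: "{\<omega> \<in> space M. \<forall>i\<ge>1. \<forall>j<m. x i \<in> B j \<longrightarrow> Y i \<omega> \<le> ereal (c j)} =
      space M \<inter> (\<Inter>i\<in>U. Y i -` A i \<inter> space M)"
  proof (intro equalityI subsetI IntI INT_I)
    fix \<omega> i assume "\<omega> \<in> {\<omega> \<in> space M. \<forall>i\<ge>1. \<forall>j<m. x i \<in> B j \<longrightarrow> Y i \<omega> \<le> ereal (c j)}" "i \<in> U"
    then show "\<omega> \<in> Y i -` A i" "\<omega> \<in> space M"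
      by (auto simp: U_def I_def A_def)
  next
    fix \<omega> assume \<omega>: "\<omega> \<in> space M \<inter> (\<Inter>i\<in>U. Y i -` A i \<inter> space M)"
    have "Y i \<omega> \<le> ereal (c j)" if "1 \<le> i" "j < m" "x i \<in> B j" for i j
    proof -
      have "i \<in> U" using that by (auto simp: U_def I_def)
      then have "Y i \<omega> \<in> A i" using \<omega> by blast
      then show ?thesis using that by (auto simp: A_def)
    qed
    then show "\<omega> \<in> {\<omega> \<in> space M. \<forall>i\<ge>1. \<forall>j<m. x i \<in> B j \<longrightarrow> Y i \<omega> \<le> ereal (c j)}"
      using \<omega> by blast
  qed blast
  have "prob (space M \<inter> (\<Inter>i\<in>U. Y i -` A i \<inter> space M)) = (\<Prod>i\<in>U. prob (Y i -` A i \<inter> space M))"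
  proof (rule prob_space_Int_INT[OF Y[unfolded indep_vars_def2, THEN conjunct2] _ finU])
    show "U \<subseteq> {1..}" by (auto simp: U_def I_def)
    show "Y i -` A i \<inter> space M \<in> {Y i -` A \<inter> space M | A. A \<in> sets borel}" for i
      using A by blast
  qed
  also have "\<dots> = (\<Prod>j<m. \<Prod>i\<in>I j. prob (Y i -` A i \<inter> space M))"
    unfolding U_def using fin unique by (intro prod.UNION_disjoint) (auto simp: I_def)
  also have "\<dots> = (\<Prod>j<m. \<Prod>i\<in>I j. 1 - F (c j))"
  proof (intro prod.cong refl)
    fix j i assume ji: "j \<in> {..<m}" "i \<in> I j"
    have i: "1 \<le> i" using ji by (simp add: I_def)
    have "Y i -` A i \<inter> space M = space M - {\<omega> \<in> space M. ereal (c j) < Y i \<omega>}"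
      using Ai[of i j] ji by auto
    moreover have "{\<omega> \<in> space M. ereal (c j) < Y i \<omega>} \<in> events"
      using Ym[OF i] by measurable
    ultimately show "prob (Y i -` A i \<inter> space M) = 1 - F (c j)"
      using F[OF i] by (simp add: prob_compl)
  qed
  finally show ?thesis
    unfolding eq I_def by simp
qed

section \<open>The minimum over a Poisson process with independent marks\<close>

context
  fixes \<xi> :: "nat \<Rightarrow> 'a \<Rightarrow> real" and Y :: "nat \<Rightarrow> 'a \<Rightarrow> ereal" and F :: "real \<Rightarrow> real"
  assumes pp: "ordered_poisson_process M \<xi>"
    and iv: "indep_var (Pi\<^sub>M {1..} (\<lambda>_. borel)) (\<lambda>\<omega>. \<lambda>i\<in>{1..}. ereal (\<xi> i \<omega>))
       (Pi\<^sub>M {1..} (\<lambda>_. borel)) (\<lambda>\<omega>. \<lambda>i\<in>{1..}. Y i \<omega>)"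
    and Y: "indep_vars (\<lambda>_. borel) Y {1..}"
    and F: "\<And>i x. 1 \<le> i \<Longrightarrow> \<P>(\<omega> in M. ereal x < Y i \<omega>) = F x"
    and tF: "tail_function F"
begin

lemma xi_measurable: "1 \<le> i \<Longrightarrow> \<xi> i \<in> borel_measurable M"
  using pp by (auto simp: ordered_poisson_process_def)

lemma Y_measurable: "1 \<le> i \<Longrightarrow> Y i \<in> borel_measurable M"
  using Y by (auto simp: indep_vars_def)

abbreviation mark_ok :: "real \<Rightarrow> 'a \<Rightarrow> nat \<Rightarrow> bool" where
  "mark_ok x \<omega> i \<equiv> Y i \<omega> \<le> ereal (\<xi> i \<omega> - x)"

abbreviation cell :: "real \<Rightarrow> real \<Rightarrow> nat \<Rightarrow> real set" where
  "cell r h j \<equiv> {r + real j * h..<r + real (Suc j) * h}"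

text \<open>Independence makes the joint law of points and marks a product measure. Integrating out
  the marks for fixed points leaves a power of \<open>1 - F (c j)\<close> for each set, whose
  expectation is a Poisson generating function.\<close>

lemma prob_marked_points:
  assumes B: "\<And>j. j < (m::nat) \<Longrightarrow> B j \<in> sets borel \<and> B j \<subseteq> {0..} \<and> emeasure lborel (B j) < \<infinity>"
    and disj: "disjoint_family_on B {..<m}"
  shows "\<P>(\<omega> in M. \<forall>i\<ge>1. \<forall>j<m. \<xi> i \<omega> \<in> B j \<longrightarrow> Y i \<omega> \<le> ereal (c j)) =
    exp (- (\<Sum>j<m. measure lborel (B j) * F (c j)))"
proof -
  let ?S = "Pi\<^sub>M {1::nat..} (\<lambda>_. borel :: ereal measure)"
  let ?X = "\<lambda>\<omega>. \<lambda>i\<in>{1..}. ereal (\<xi> i \<omega>)" and ?Y = "\<lambda>\<omega>. \<lambda>i\<in>{1..}. Y i \<omega>"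
  \<comment> \<open>\<open>indep_var\<close> takes two variables of one type, so the points are
    stored in \<open>ereal\<close> and read back as reals.\<close>
  define A where "A = {p \<in> space (?S \<Otimes>\<^sub>M ?S). \<forall>i\<in>{1..}. \<forall>j\<in>{..<m}. real_of_ereal (fst p i) \<in> B j \<longrightarrow> snd p i \<le> ereal (c j)}"
  have Bm [measurable]: "B j \<in> sets borel" if "j \<in> {..<m}" for j using B that by auto
  have A [measurable]: "A \<in> sets (?S \<Otimes>\<^sub>M ?S)"
    unfolding A_def by measurable
  have X [measurable]: "?X \<in> M \<rightarrow>\<^sub>M ?S" and Yv [measurable]: "?Y \<in> M \<rightarrow>\<^sub>M ?S"
    using iv by (auto dest: indep_var_rv1 indep_var_rv2)
  interpret DY: prob_space "distr M ?S ?Y" by (rule prob_space_distr) simp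
  have inside: "emeasure (distr M ?S ?Y) (Pair (?X \<omega>) -` A) =
      prob {\<omega>' \<in> space M. \<forall>i\<ge>1. \<forall>j<m. \<xi> i \<omega> \<in> B j \<longrightarrow> Y i \<omega>' \<le> ereal (c j)}" if "\<omega> \<in> space M" for \<omega>
  proof -
    have "Pair (?X \<omega>) -` A \<in> sets ?S"
      by (rule sets_Pair1[OF A])
    then have "emeasure (distr M ?S ?Y) (Pair (?X \<omega>) -` A) = emeasure M (?Y -` (Pair (?X \<omega>) -` A) \<inter> space M)"
      by (simp add: emeasure_distr)
    also have "?Y -` (Pair (?X \<omega>) -` A) \<inter> space M = {\<omega>' \<in> space M. \<forall>i\<ge>1. \<forall>j<m. \<xi> i \<omega> \<in> B j \<longrightarrow> Y i \<omega>' \<le> ereal (c j)}"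
      using measurable_space[OF X that] measurable_space[OF Yv]
      by (auto simp: A_def space_pair_measure)
    finally show ?thesis unfolding emeasure_eq_measure .
  qed
  have fin: "AE \<omega> in M. \<forall>j\<in>{..<m}. finite {i \<in> {1..}. \<xi> i \<omega> \<in> B j}"
    using pp B by (intro AE_finite_allI) (auto simp: ordered_poisson_process_def)
  have "{\<omega> \<in> space M. \<forall>i\<ge>1. \<forall>j<m. \<xi> i \<omega> \<in> B j \<longrightarrow> Y i \<omega> \<le> ereal (c j)} =
      (\<lambda>\<omega>. (?X \<omega>, ?Y \<omega>)) -` A \<inter> space M"
    using measurable_space[OF X] measurable_space[OF Yv]
    by (auto simp: A_def space_pair_measure)
  then have "ennreal (\<P>(\<omega> in M. \<forall>i\<ge>1. \<forall>j<m. \<xi> i \<omega> \<in> B j \<longrightarrow> Y i \<omega> \<le> ereal (c j))) =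
      emeasure (distr M (?S \<Otimes>\<^sub>M ?S) (\<lambda>\<omega>. (?X \<omega>, ?Y \<omega>))) A"
    by (simp add: emeasure_distr emeasure_eq_measure)
  also have "\<dots> = emeasure (distr M ?S ?X \<Otimes>\<^sub>M distr M ?S ?Y) A"
    using iv by (simp add: indep_var_distribution_eq)
  also have "\<dots> = (\<integral>\<^sup>+x. emeasure (distr M ?S ?Y) (Pair x -` A) \<partial>distr M ?S ?X)"
    by (rule DY.emeasure_pair_measure_alt) simp
  also have "\<dots> = (\<integral>\<^sup>+\<omega>. emeasure (distr M ?S ?Y) (Pair (?X \<omega>) -` A) \<partial>M)"
    by (rule nn_integral_distr)
       (use DY.measurable_emeasure_Pair[of A ?S] in simp_all)
  also have "\<dots> = (\<integral>\<^sup>+\<omega>. ennreal (\<Prod>j<m. (1 - F (c j)) ^ num_points \<xi> (B j) \<omega>) \<partial>M)"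
  proof (rule nn_integral_cong_AE)
    show "AE \<omega> in M. emeasure (distr M ?S ?Y) (Pair (?X \<omega>) -` A) = ennreal (\<Prod>j<m. (1 - F (c j)) ^ num_points \<xi> (B j) \<omega>)"
      using fin AE_space
    proof eventually_elim
      case (elim \<omega>)
      then show ?case
        using prob_marks_le[OF Y F, where x = "\<lambda>i. \<xi> i \<omega>" and m = m and B = B and c = c] disj
        by (simp add: inside num_points_def)
    qed
  qed
  also have "\<dots> = ennreal (expectation (\<lambda>\<omega>. \<Prod>j<m. (1 - F (c j)) ^ num_points \<xi> (B j) \<omega>))"
  proof (rule nn_integral_eq_integral)
    have "num_points \<xi> (B j) \<in> M \<rightarrow>\<^sub>M count_space UNIV" if "j < m" for j
      using pp B disj that unfolding ordered_poisson_process_def indep_vars_def by blast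
    then have "(\<lambda>\<omega>. \<Prod>j<m. (1 - F (c j)) ^ num_points \<xi> (B j) \<omega>) \<in> borel_measurable M"
      by (intro borel_measurable_prod measurable_compose[OF _ borel_measurable_count_space]) auto
    then show "integrable M (\<lambda>\<omega>. \<Prod>j<m. (1 - F (c j)) ^ num_points \<xi> (B j) \<omega>)"
      using tail_function_bounds[OF tF]
      by (intro integrable_const_bound[where B = 1])
         (auto simp: abs_prod power_abs intro!: AE_I2 prod_le_1 power_le_one)
    show "AE \<omega> in M. 0 \<le> (\<Prod>j<m. (1 - F (c j)) ^ num_points \<xi> (B j) \<omega>)"
      using tail_function_bounds[OF tF] by (auto intro!: AE_I2 prod_nonneg)
  qed
  also have "expectation (\<lambda>\<omega>. \<Prod>j<m. (1 - F (c j)) ^ num_points \<xi> (B j) \<omega>) = exp (- (\<Sum>j<m. measure lborel (B j) * F (c j)))"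
    using poisson_laplace[OF pp B disj, of "\<lambda>j. 1 - F (c j)"] tail_function_bounds[OF tF] by simp
  finally show ?thesis by simp
qed

lemma marks_event [measurable]:
  "{\<omega> \<in> space M. \<forall>i\<ge>1. r \<le> \<xi> i \<omega> \<and> \<xi> i \<omega> < R \<longrightarrow> mark_ok x \<omega> i} \<in> events"
proof -
  have [measurable]: "\<xi> i \<in> borel_measurable M" "Y i \<in> borel_measurable M" if "i \<in> {1..}" for i
    using that xi_measurable Y_measurable by auto
  have "{\<omega> \<in> space M. \<forall>i\<in>{1..}. r \<le> \<xi> i \<omega> \<and> \<xi> i \<omega> < R \<longrightarrow> mark_ok x \<omega> i} \<in> events"
    by measurable
  then show ?thesis by (simp add: Ball_def)
qed

lemma cells_event [measurable]:
  "{\<omega> \<in> space M. \<forall>i\<ge>1. \<forall>j<m. \<xi> i \<omega> \<in> {l j..<l (Suc j)} \<longrightarrow> Y i \<omega> \<le> ereal (c j)} \<in> events"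
proof -
  have [measurable]: "\<xi> i \<in> borel_measurable M" "Y i \<in> borel_measurable M" if "i \<in> {1..}" for i
    using that xi_measurable Y_measurable by auto
  have "{\<omega> \<in> space M. \<forall>i\<in>{1..}. \<forall>j\<in>{..<m}. \<xi> i \<omega> \<in> {l j..<l (Suc j)} \<longrightarrow> Y i \<omega> \<le> ereal (c j)} \<in> events"
    by measurable
  then show ?thesis by (simp add: Ball_def)
qed

lemma AE_xi_nonneg: "AE \<omega> in M. \<forall>i\<ge>1. 0 \<le> \<xi> i \<omega>"
proof -
  have "AE \<omega> in M. 0 \<le> \<xi> 1 \<omega> \<and> strict_mono_on {1..} (\<lambda>i. \<xi> i \<omega>)"
    using pp by (auto simp: ordered_poisson_process_def)
  then show ?thesis
  proof eventually_elim
    case (elim \<omega>)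
    then have "\<xi> 1 \<omega> \<le> \<xi> i \<omega>" if "1 \<le> i" for i
      using that by (cases "i = 1") (auto simp: strict_mono_on_def less_imp_le)
    then show ?case using elim by (auto intro: order_trans)
  qed
qed

lemma prob_marks_cells:
  assumes h: "0 < h" and r: "0 \<le> r"
  shows "\<P>(\<omega> in M. \<forall>i\<ge>1. \<forall>j<m. \<xi> i \<omega> \<in> cell r h j \<longrightarrow> Y i \<omega> \<le> ereal (c j)) =
    exp (- (\<Sum>j<m. h * F (c j)))"
proof -
  define B where "B j = cell r h j" for j
  have "disjoint_family_on B {..<m}"
  proof (unfold disjoint_family_on_def, intro ballI impI)
    have *: "B j \<inter> B k = {}" if "j < k" for j k
    proof -
      have "r + real (Suc j) * h \<le> r + real k * h"
        using that h by (intro add_left_mono mult_right_mono) auto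
      then show ?thesis by (auto simp: B_def)
    qed
    show "B j \<inter> B k = {}" if "j \<noteq> k" for j k
      using *[of j k] *[of k j] that by (cases j k rule: linorder_cases) auto
  qed
  moreover have "B j \<in> sets borel \<and> B j \<subseteq> {0..} \<and> emeasure lborel (B j) < \<infinity>" for j
  proof -
    have "0 \<le> r + real j * h" using h r by simp
    then have "B j \<subseteq> {0..}" unfolding B_def by (meson atLeastLessThan_iff atLeast_iff order_trans subsetI)
    then show ?thesis using h by (auto simp: B_def less_top[symmetric])
  qed
  moreover have "measure lborel (B j) = h" for j
    using h by (simp add: B_def algebra_simps)
  ultimately show ?thesis
    using prob_marked_points[of m B c] by (simp add: B_def)
qed

text \<open>The threshold \<open>\<xi> i - x\<close> varies with the point, so it is frozen at the
  left or right end of cells of width \<open>1 / n\<close>. This brackets the event, and as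
  \<open>F\<close> is monotone the two Riemann sums telescope to a difference of at most one cell
  width.\<close>

lemma prob_marks_between:
  assumes R: "r < (R::nat)"
  shows "\<P>(\<omega> in M. \<forall>i\<ge>1. real r \<le> \<xi> i \<omega> \<and> \<xi> i \<omega> < real R \<longrightarrow> mark_ok x \<omega> i) =
    exp (- (tail_integral F (real r - x) - tail_integral F (real R - x)))"
    (is "?p = exp (- ?I)")
proof -
  note antimono = tail_function_antimono[OF tF]
  have bounds: "exp (- ?I - 1 / n) \<le> ?p \<and> ?p \<le> exp (- ?I + 1 / n)" if n: "0 < n" for n :: nat
  proof -
    define h where "h = 1 / real n"
    \<comment> \<open>Integer end points let cells of width \<open>1 / n\<close> fill the interval
      exactly.\<close>
    define m where "m = (R - r) * n"
    have h: "0 < h" "r + real m * h = R" using n R by (auto simp: h_def m_def)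
    let ?l = "\<lambda>j::nat. tail_integral F (r + real j * h - x)"
    have tel: "(\<Sum>j<m. ?l j - ?l (Suc j)) = ?I"
      using sum_lessThan_telescope'[of ?l m] h by simp
    have step: "h * F (r + real (Suc j) * h - x) \<le> ?l j - ?l (Suc j)" "?l j - ?l (Suc j) \<le> h * F (r + real j * h - x)" for j
      using tail_integral_diff_bounds[OF tF, of "r + real j * h - x" "r + real (Suc j) * h - x"] h
      by (auto simp: algebra_simps)
    have "(\<Sum>j<m. h * F (r + real j * h - x)) - (\<Sum>j<m. h * F (r + real (Suc j) * h - x)) = h * (F (real r - x) - F (real R - x))"
      using sum_lessThan_telescope'[of "\<lambda>j. h * F (r + real j * h - x)" m] h
      by (simp add: sum_subtractf right_diff_distrib)
    also have "\<dots> \<le> h * 1"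
      using tail_function_bounds[OF tF, of "real r - x"] tail_function_bounds[OF tF, of "real R - x"] h
      by (intro mult_left_mono) auto
    finally have diff: "(\<Sum>j<m. h * F (r + real j * h - x)) \<le> (\<Sum>j<m. h * F (r + real (Suc j) * h - x)) + h"
      by simp
    have lo: "?I \<le> (\<Sum>j<m. h * F (r + real j * h - x))" and up: "(\<Sum>j<m. h * F (r + real (Suc j) * h - x)) \<le> ?I"
      unfolding tel[symmetric] using step by (auto intro: sum_mono)
    have cell: "\<exists>j<m. t \<in> cell r h j" if t: "r \<le> t" "t < R" for t :: real
    proof (intro exI conjI)
      define j where "j = nat \<lfloor>(t - r) / h\<rfloor>"
      have j: "real j \<le> (t - r) / h" "(t - r) / h < real j + 1"
        using t h by (auto simp: j_def)
      then have *: "r + real j * h \<le> t" "t < r + real (Suc j) * h"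
        using h by (auto simp: field_simps)
      then show "t \<in> cell r h j" by simp
      have "real j * h < real m * h" using * t h(2) by linarith
      then show "j < m" using h(1) by simp
    qed
    have "?p \<le> \<P>(\<omega> in M. \<forall>i\<ge>1. \<forall>j<m. \<xi> i \<omega> \<in> cell r h j \<longrightarrow> Y i \<omega> \<le> ereal (r + real (Suc j) * h - x))"
    proof (rule finite_measure_mono)
      have "r \<le> \<xi> i \<omega> \<and> \<xi> i \<omega> < R" if "j < m" "\<xi> i \<omega> \<in> cell r h j" for i j \<omega>
      proof -
        have "real (Suc j) * h \<le> real m * h" using that h by (intro mult_right_mono) auto
        moreover have "0 \<le> real j * h" using h by simp
        ultimately show ?thesis using that(2) h(2) unfolding atLeastLessThan_iff by linarith
      qed
      then show "{\<omega> \<in> space M. \<forall>i\<ge>1. real r \<le> \<xi> i \<omega> \<and> \<xi> i \<omega> < real R \<longrightarrow> mark_ok x \<omega> i} \<subseteq>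
          {\<omega> \<in> space M. \<forall>i\<ge>1. \<forall>j<m. \<xi> i \<omega> \<in> cell r h j \<longrightarrow> Y i \<omega> \<le> ereal (r + real (Suc j) * h - x)}"
        by (auto elim!: order_trans)
    qed (rule cells_event)
    also have "\<dots> = exp (- (\<Sum>j<m. h * F (r + real (Suc j) * h - x)))"
      by (rule prob_marks_cells[OF h(1) of_nat_0_le_iff])
    finally have 1: "?p \<le> exp (- (\<Sum>j<m. h * F (r + real (Suc j) * h - x)))" .
    have "exp (- (\<Sum>j<m. h * F (r + real j * h - x))) =
        \<P>(\<omega> in M. \<forall>i\<ge>1. \<forall>j<m. \<xi> i \<omega> \<in> cell r h j \<longrightarrow> Y i \<omega> \<le> ereal (r + real j * h - x))"
      by (rule prob_marks_cells[OF h(1) of_nat_0_le_iff, symmetric])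
    also have "\<dots> \<le> ?p"
    proof (rule finite_measure_mono)
      have "mark_ok x \<omega> i"
        if i: "1 \<le> i" "r \<le> \<xi> i \<omega>" "\<xi> i \<omega> < R"
        and c: "\<forall>i\<ge>1. \<forall>j<m. \<xi> i \<omega> \<in> cell r h j \<longrightarrow> Y i \<omega> \<le> ereal (r + real j * h - x)" for i \<omega>
      proof -
        obtain j where j: "j < m" "\<xi> i \<omega> \<in> cell r h j"
          using cell[of "\<xi> i \<omega>"] i by auto
        then have "Y i \<omega> \<le> ereal (r + real j * h - x)" using c i by blast
        also have "\<dots> \<le> ereal (\<xi> i \<omega> - x)" using j by simp
        finally show ?thesis .
      qed
      then show "{\<omega> \<in> space M. \<forall>i\<ge>1. \<forall>j<m. \<xi> i \<omega> \<in> cell r h j \<longrightarrow> Y i \<omega> \<le> ereal (r + real j * h - x)} \<subseteq>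
          {\<omega> \<in> space M. \<forall>i\<ge>1. real r \<le> \<xi> i \<omega> \<and> \<xi> i \<omega> < real R \<longrightarrow> mark_ok x \<omega> i}"
        by blast
    qed (rule marks_event)
    finally have 2: "exp (- (\<Sum>j<m. h * F (r + real j * h - x))) \<le> ?p" .
    have "exp (- ?I - h) \<le> exp (- (\<Sum>j<m. h * F (r + real j * h - x)))"
      "exp (- (\<Sum>j<m. h * F (r + real (Suc j) * h - x))) \<le> exp (- ?I + h)"
      using diff lo up by auto
    with 1 2 show ?thesis unfolding h_def[symmetric] by linarith
  qed
  have "(\<lambda>n. exp (- ?I - 1 / real n)) \<longlonglongrightarrow> exp (- ?I - 0)" "(\<lambda>n. exp (- ?I + 1 / real n)) \<longlonglongrightarrow> exp (- ?I + 0)"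
    by (intro tendsto_intros lim_1_over_n)+
  moreover have "eventually (\<lambda>n. exp (- ?I - 1 / real n) \<le> ?p) sequentially" "eventually (\<lambda>n. ?p \<le> exp (- ?I + 1 / real n)) sequentially"
    using bounds by (auto intro!: eventually_sequentiallyI[of 1])
  ultimately have "exp (- ?I - 0) \<le> ?p" "?p \<le> exp (- ?I + 0)"
    by (auto intro: tendsto_upperbound tendsto_lowerbound)
  then show ?thesis by simp
qed

lemma prob_marks_from:
  "\<P>(\<omega> in M. \<forall>i\<ge>1. real r \<le> \<xi> i \<omega> \<longrightarrow> mark_ok x \<omega> i) = exp (- tail_integral F (real r - x))"
proof -
  let ?A = "\<lambda>n::nat. {\<omega> \<in> space M. \<forall>i\<ge>1. real r \<le> \<xi> i \<omega> \<and> \<xi> i \<omega> < real (Suc n + r) \<longrightarrow> mark_ok x \<omega> i}"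
  have "(\<Inter>n. ?A n) = {\<omega> \<in> space M. \<forall>i\<ge>1. real r \<le> \<xi> i \<omega> \<longrightarrow> mark_ok x \<omega> i}"
  proof (intro equalityI subsetI)
    fix \<omega> assume \<omega>: "\<omega> \<in> (\<Inter>n. ?A n)"
    have "mark_ok x \<omega> i" if "1 \<le> i" "real r \<le> \<xi> i \<omega>" for i
    proof -
      obtain n :: nat where "\<xi> i \<omega> < real n" using reals_Archimedean2 by blast
      then have "\<xi> i \<omega> < real (Suc n + r)" by simp
      then show ?thesis using \<omega> that by blast
    qed
    then show "\<omega> \<in> {\<omega> \<in> space M. \<forall>i\<ge>1. real r \<le> \<xi> i \<omega> \<longrightarrow> mark_ok x \<omega> i}" using \<omega> by blast
  qed auto
  moreover have 1: "(\<lambda>n. prob (?A n)) \<longlonglongrightarrow> prob (\<Inter>n. ?A n)"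
  proof (rule finite_Lim_measure_decseq)
    show "range ?A \<subseteq> events" by (intro image_subsetI marks_event)
    show "decseq ?A"
    proof (intro decseq_SucI subsetI)
      fix n \<omega> assume \<omega>: "\<omega> \<in> ?A (Suc n)"
      then have "mark_ok x \<omega> i" if "1 \<le> i" "real r \<le> \<xi> i \<omega>" "\<xi> i \<omega> < real (Suc n + r)" for i
        using that by simp
      then show "\<omega> \<in> ?A n" using \<omega> by blast
    qed
  qed
  moreover have 2: "(\<lambda>n. prob (?A n)) \<longlonglongrightarrow> exp (- (tail_integral F (real r - x) - 0))"
  proof -
    have "(\<lambda>n. tail_integral F (real (Suc n + r) - x)) \<longlonglongrightarrow> 0"
      using LIMSEQ_Suc[OF LIMSEQ_ignore_initial_segment[OF tail_integral_tendsto_0[OF tF, of "-x"], of r]] by simp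
    then have "(\<lambda>n. exp (- (tail_integral F (real r - x) - tail_integral F (real (Suc n + r) - x)))) \<longlonglongrightarrow> exp (- (tail_integral F (real r - x) - 0))"
      by (intro tendsto_intros)
    then show ?thesis using prob_marks_between[of r "Suc _ + r" x] by simp
  qed
  ultimately show ?thesis
    using LIMSEQ_unique[OF 1 2] by simp
qed

lemma marks_from_event [measurable]:
  "{\<omega> \<in> space M. \<forall>i\<ge>1. r \<le> \<xi> i \<omega> \<longrightarrow> mark_ok x \<omega> i} \<in> events"
proof -
  have [measurable]: "\<xi> i \<in> borel_measurable M" "Y i \<in> borel_measurable M" if "i \<in> {1..}" for i
    using that xi_measurable Y_measurable by auto
  have "{\<omega> \<in> space M. \<forall>i\<in>{1..}. r \<le> \<xi> i \<omega> \<longrightarrow> mark_ok x \<omega> i} \<in> events"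
    by measurable
  then show ?thesis by (simp add: Ball_def)
qed

lemma prob_marks:
  "\<P>(\<omega> in M. \<forall>i\<ge>1. mark_ok x \<omega> i) = rde F x"
proof -
  have [measurable]: "\<xi> i \<in> borel_measurable M" "Y i \<in> borel_measurable M" if "i \<in> {1..}" for i
    using that xi_measurable Y_measurable by auto
  have "{\<omega> \<in> space M. \<forall>i\<in>{1..}. mark_ok x \<omega> i} \<in> events"
    by measurable
  then have "\<P>(\<omega> in M. \<forall>i\<ge>1. mark_ok x \<omega> i) =
      \<P>(\<omega> in M. \<forall>i\<ge>1. real 0 \<le> \<xi> i \<omega> \<longrightarrow> mark_ok x \<omega> i)"
    using AE_xi_nonneg by (intro measure_eq_AE marks_from_event) (auto simp: Ball_def)
  then show ?thesis using prob_marks_from[of 0 x] by (simp add: rde_def)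
qed

text \<open>Only finitely many points compete for the minimum, so that it is attained.\<close>

lemma AE_finite_competitors: "AE \<omega> in M. finite {i \<in> {1..}. \<not> mark_ok x \<omega> i}"
proof -
  let ?G = "\<lambda>r::nat. {\<omega> \<in> space M. \<forall>i\<ge>1. real r \<le> \<xi> i \<omega> \<longrightarrow> mark_ok x \<omega> i}"
  have G: "?G r \<in> events" for r by (rule marks_from_event)
  have 1: "(\<lambda>r. prob (?G r)) \<longlonglongrightarrow> prob (\<Union>r. ?G r)"
  proof (rule finite_Lim_measure_incseq)
    show "incseq ?G" by (intro incseq_SucI) auto
  qed (rule image_subsetI, rule G)
  \<comment> \<open>The probability that no point at or beyond \<open>r\<close> competes tends to 1,
    as the tail integral vanishes at infinity; below \<open>r\<close> there are only finitely many
    points anyway.\<close>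
  have "(\<lambda>r. exp (- tail_integral F (real r - x))) \<longlonglongrightarrow> exp (- 0)"
    using tail_integral_tendsto_0[OF tF, of "-x"] by (intro tendsto_intros) simp
  then have 2: "(\<lambda>r. prob (?G r)) \<longlonglongrightarrow> 1" by (simp add: prob_marks_from)
  have "(\<Union>r. ?G r) \<in> events"
    by (rule sets.countable_UN) (rule image_subsetI, rule G)
  then have "AE \<omega> in M. \<omega> \<in> (\<Union>r. ?G r)"
    by (rule iffD1[OF prob_eq_1 LIMSEQ_unique[OF 1 2]])
  moreover have "AE \<omega> in M. \<forall>r::nat. finite {i \<in> {1..}. \<xi> i \<omega> \<in> {0..<real r}}"
    unfolding AE_all_countable
  proof
    fix r :: nat
    have fin: "AE \<omega> in M. finite {i \<in> {1..}. \<xi> i \<omega> \<in> B}"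
      if "B \<in> sets borel" "B \<subseteq> {0..}" "emeasure lborel B < \<infinity>" for B
      using pp that unfolding ordered_poisson_process_def by blast
    show "AE \<omega> in M. finite {i \<in> {1..}. \<xi> i \<omega> \<in> {0..<real r}}"
      by (rule fin) (auto simp: less_top[symmetric])
  qed
  ultimately show ?thesis
    using AE_xi_nonneg
  proof eventually_elim
    case (elim \<omega>)
    then obtain r where "\<And>i. 1 \<le> i \<Longrightarrow> real r \<le> \<xi> i \<omega> \<Longrightarrow> mark_ok x \<omega> i" by blast
    then have "{i \<in> {1..}. \<not> mark_ok x \<omega> i} \<subseteq> {i \<in> {1..}. \<xi> i \<omega> \<in> {0..<real r}}"
      using elim(3) by fastforce
    then show ?case using elim(2) finite_subset by blast
  qed
qed

text \<open>The condition on the marks describes the event that \<open>x\<close> is a lower bound.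
  The strict inequality is the increasing union of these events at \<open>x + 1 / Suc n\<close>, and
  continuity of \<open>rde F\<close> shows that its probability is the same.\<close>

theorem prob_INF_greater:
  "\<P>(\<omega> in M. ereal x < (INF i\<in>{1..}. ereal (\<xi> i \<omega>) - Y i \<omega>)) = rde F x"
proof -
  have [measurable]: "\<xi> i \<in> borel_measurable M" "Y i \<in> borel_measurable M" if "i \<in> {1..}" for i
    using that xi_measurable Y_measurable by auto
  let ?I = "\<lambda>\<omega>. INF i\<in>{1..}. ereal (\<xi> i \<omega>) - Y i \<omega>"
  have I [measurable]: "?I \<in> borel_measurable M" by measurable
  have iff: "ereal y \<le> ereal a - b \<longleftrightarrow> b \<le> ereal (a - y)" for y a b
    by (cases b) auto
  have ge: "\<P>(\<omega> in M. ereal y \<le> ?I \<omega>) = rde F y" for y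
    using prob_marks[of y] by (simp add: le_INF_iff iff Ball_def)
  let ?A = "\<lambda>n. {\<omega> \<in> space M. ereal (x + 1 / Suc n) \<le> ?I \<omega>}"
  have "(\<Union>n. ?A n) = {\<omega> \<in> space M. ereal x < ?I \<omega>}"
  proof (intro equalityI subsetI)
    fix \<omega> assume \<omega>: "\<omega> \<in> {\<omega> \<in> space M. ereal x < ?I \<omega>}"
    then obtain z where z: "ereal x < ereal z" "ereal z < ?I \<omega>"
      using ereal_dense2[of "ereal x" "?I \<omega>"] by auto
    obtain n where "1 / Suc n < z - x"
      using z(1) nat_approx_posE[of "z - x"] by auto
    then have "ereal (x + 1 / Suc n) \<le> ereal z" by simp
    also have "\<dots> \<le> ?I \<omega>" using z by simp
    finally show "\<omega> \<in> (\<Union>n. ?A n)" using \<omega> by blast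
  next
    fix \<omega> assume "\<omega> \<in> (\<Union>n. ?A n)"
    then obtain n where n: "\<omega> \<in> space M" "ereal (x + 1 / Suc n) \<le> ?I \<omega>" by blast
    have "ereal x < ereal (x + 1 / Suc n)" by simp
    also note n(2)
    finally show "\<omega> \<in> {\<omega> \<in> space M. ereal x < ?I \<omega>}" using n by blast
  qed
  moreover have 1: "(\<lambda>n. prob (?A n)) \<longlonglongrightarrow> prob (\<Union>n. ?A n)"
  proof (rule finite_Lim_measure_incseq)
    show "incseq ?A"
    proof (intro incseq_SucI subsetI)
      fix n \<omega> assume "\<omega> \<in> ?A n"
      moreover have "ereal (x + 1 / Suc (Suc n)) \<le> ereal (x + 1 / Suc n)"
        by (simp add: frac_le)
      ultimately show "\<omega> \<in> ?A (Suc n)" by (blast intro: order_trans)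
    qed
  qed (rule image_subsetI, measurable)
  moreover have 2: "(\<lambda>n. prob (?A n)) \<longlonglongrightarrow> rde F (x + 0)"
    unfolding ge
    using rde_continuous[OF tF] LIMSEQ_Suc[OF lim_1_over_n]
    by (intro isCont_tendsto_compose[OF rde_continuous[OF tF]] tendsto_intros)
  ultimately show ?thesis
    using LIMSEQ_unique[OF 1 2] by simp
qed

end

end

section \<open>Messages on the tree\<close>

lemma Nil_in_words [simp]: "[] \<in> words"
  and append_in_words [simp]: "v @ w \<in> words \<longleftrightarrow> v \<in> words \<and> w \<in> words"
  and Cons_in_words [simp]: "i # w \<in> words \<longleftrightarrow> 1 \<le> i \<and> w \<in> words"
  by (auto simp: words_def)

lemma words1_iff: "v \<in> words1 \<longleftrightarrow> v \<in> words \<and> v \<noteq> []"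
  by (auto simp: words1_def)

lemma child_in_words1 [simp]: "v @ [i] \<in> words1 \<longleftrightarrow> v \<in> words \<and> 1 \<le> i"
  by (auto simp: words1_iff)

definition descendants :: "nat list \<Rightarrow> nat list set" where
  "descendants v = (\<lambda>w. v @ w) ` words"

lemma descendants_subset_words: "v \<in> words \<Longrightarrow> descendants v \<subseteq> words"
  by (auto simp: descendants_def)

text \<open>Only weights at depth below \<open>k\<close> and starting messages at depth exactly
  \<open>k\<close> under \<open>v\<close> enter. \<open>N\<close> is arbitrary so that the lemma
  applies to sub-sigma-algebras of the sample space and to coordinate spaces alike.\<close>

lemma measurable_message:
  assumes "\<And>w i. w \<in> words \<Longrightarrow> length w < k \<Longrightarrow> 1 \<le> i \<Longrightarrow> \<xi> (v @ w) i \<in> borel_measurable N"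
    and "\<And>w. w \<in> words \<Longrightarrow> length w = k \<Longrightarrow> X (v @ w) \<in> borel_measurable N"
  shows "message \<xi> X k v \<in> borel_measurable N"
  using assms
proof (induction k arbitrary: v)
  case 0
  from 0(2)[of "[]"] have "X v \<in> borel_measurable N" by simp
  then show ?case by (simp add: fun_eq_iff[symmetric] cong: measurable_cong)
next
  case (Suc k)
  have [measurable]: "message \<xi> X k (v @ [i]) \<in> borel_measurable N" if "i \<in> {1..}" for i
  proof (rule Suc.IH)
    fix w j assume "w \<in> words" "length w < k" "1 \<le> (j::nat)"
    then show "\<xi> ((v @ [i]) @ w) j \<in> borel_measurable N"
      using Suc.prems(1)[of "i # w" j] that by simp
  next
    fix w assume "w \<in> words" "length w = k"
    then show "X ((v @ [i]) @ w) \<in> borel_measurable N"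
      using Suc.prems(2)[of "i # w"] that by simp
  qed
  have [measurable]: "\<xi> v i \<in> borel_measurable N" if "i \<in> {1..}" for i
    using Suc.prems(1)[of "[]" i] that by simp
  show ?case
    unfolding message.simps by measurable
qed

lemma message_cong:
  assumes "\<And>w i. w \<in> words \<Longrightarrow> length w < k \<Longrightarrow> 1 \<le> i \<Longrightarrow> \<xi> (v @ w) i \<omega> = \<xi>' (v' @ w) i \<omega>'"
    and "\<And>w. w \<in> words \<Longrightarrow> length w = k \<Longrightarrow> X (v @ w) \<omega> = X' (v' @ w) \<omega>'"
  shows "message \<xi> X k v \<omega> = message \<xi>' X' k v' \<omega>'"
  using assms
proof (induction k arbitrary: v v')
  case 0
  from 0(2)[of "[]"] show ?case by simp
next
  case (Suc k)
  have "message \<xi> X k (v @ [i]) \<omega> = message \<xi>' X' k (v' @ [i]) \<omega>'" if "1 \<le> i" for i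
  proof (rule Suc.IH)
    fix w j assume "w \<in> words" "length w < k" "1 \<le> (j::nat)"
    then show "\<xi> ((v @ [i]) @ w) j \<omega> = \<xi>' ((v' @ [i]) @ w) j \<omega>'"
      using Suc.prems(1)[of "i # w" j] that by simp
  next
    fix w assume "w \<in> words" "length w = k"
    then show "X ((v @ [i]) @ w) \<omega> = X' ((v' @ [i]) @ w) \<omega>'"
      using Suc.prems(2)[of "i # w"] that by simp
  qed
  moreover have "\<xi> v i \<omega> = \<xi>' v' i \<omega>'" if "1 \<le> i" for i
    using Suc.prems(1)[of "[]" i] that by simp
  ultimately show ?case
    unfolding message.simps by (intro INF_cong) auto
qed

text \<open>A restart after \<open>m\<close> rounds, which lets replacements for the messages of
  that round act as new initial values.\<close>

lemma message_add: "message \<xi> X (m + n) v \<omega> = message \<xi> (message \<xi> X m) n v \<omega>"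
  by (induction n arbitrary: v) auto

lemma subtree_weights_measurable:
  assumes "\<And>w i. w \<in> words \<Longrightarrow> 1 \<le> i \<Longrightarrow> \<xi> (v @ w) i \<in> borel_measurable N"
  shows "subtree_weights \<xi> v \<in> N \<rightarrow>\<^sub>M weight_space"
proof -
  have "subtree_weights \<xi> v = (\<lambda>\<omega>. \<lambda>p\<in>words \<times> {1..}. \<xi> (v @ fst p) (snd p) \<omega>)"
    by (auto simp: subtree_weights_def fun_eq_iff restrict_def)
  then show ?thesis
    using assms by (auto intro!: measurable_restrict)
qed

lemma coordinate_measurable_vimage_algebra:
  assumes "w \<in> words" "1 \<le> i"
  shows "\<xi> (v @ w) i \<in> borel_measurable (vimage_algebra \<Omega> (subtree_weights \<xi> v) weight_space)"
proof -
  have "subtree_weights \<xi> v \<in> vimage_algebra \<Omega> (subtree_weights \<xi> v) weight_space \<rightarrow>\<^sub>M weight_space"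
    by (rule measurable_vimage_algebra1) (auto simp: space_PiM subtree_weights_def)
  then have "(\<lambda>\<omega>. subtree_weights \<xi> v \<omega> (w, i)) \<in> borel_measurable (vimage_algebra \<Omega> (subtree_weights \<xi> v) weight_space)"
    by (rule measurable_compose) (use assms in \<open>auto intro: measurable_component_singleton\<close>)
  then show ?thesis
    using assms by (simp add: subtree_weights_def)
qed

section \<open>Independence of disjoint parts of the tree\<close>

locale pwit_messages = prob_space M for M :: "'a measure" +
  fixes \<xi> :: "nat list \<Rightarrow> nat \<Rightarrow> 'a \<Rightarrow> real" and X0 :: "nat list \<Rightarrow> 'a \<Rightarrow> ereal"
  assumes pwit: "pwit M \<xi>" and init: "initial_messages M \<xi> X0"
begin

lemma weights_poisson: "v \<in> words \<Longrightarrow> ordered_poisson_process M (\<xi> v)"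
  using pwit by (auto simp: pwit_def)

lemma weight_measurable: "v \<in> words \<Longrightarrow> 1 \<le> i \<Longrightarrow> \<xi> v i \<in> borel_measurable M"
  using weights_poisson by (auto simp: ordered_poisson_process_def)

lemma X0_measurable: "v \<in> words1 \<Longrightarrow> X0 v \<in> borel_measurable M"
  using init by (auto simp: initial_messages_def indep_vars_def)

text \<open>Weights and initial messages have different types, so their joint independence is
  expressed by event systems over a disjoint sum of index sets.\<close>

definition vertex_events :: "nat list + nat list \<Rightarrow> 'a set set" where
  "vertex_events z = (case z of
     Inl v \<Rightarrow> {(\<lambda>\<omega>. \<lambda>i\<in>{1..}. \<xi> v i \<omega>) -` A \<inter> space M | A. A \<in> sets (Pi\<^sub>M {1..} (\<lambda>_. borel))}
   | Inr v \<Rightarrow> {X0 v -` A \<inter> space M | A. A \<in> sets borel})"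

lemma vimage_inter_in:
  assumes "A \<in> sets N" "B \<in> sets N"
  shows "\<exists>C. f -` A \<inter> S \<inter> (f -` B \<inter> S) = f -` C \<inter> S \<and> C \<in> sets N"
  using assms by (intro exI[of _ "A \<inter> B"]) auto

definition block_index :: "nat list set \<Rightarrow> (nat list + nat list) set" where
  "block_index K = Inl ` K \<union> Inr ` (K \<inter> words1)"

definition block :: "nat list set \<Rightarrow> 'a measure" where
  "block K = sigma (space M) (\<Union>z\<in>block_index K. vertex_events z)"

lemma vertex_events_events:
  assumes "z \<in> block_index words"
  shows "vertex_events z \<subseteq> events"
proof (cases z)
  case (Inl v)
  then have "(\<lambda>\<omega>. \<lambda>i\<in>{1..}. \<xi> v i \<omega>) \<in> M \<rightarrow>\<^sub>M Pi\<^sub>M {1..} (\<lambda>_. borel)"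
    using assms weight_measurable by (intro measurable_restrict) (auto simp: block_index_def)
  then show ?thesis using Inl by (auto simp: vertex_events_def dest: measurable_sets)
next
  case (Inr v)
  then have "X0 v \<in> borel_measurable M"
    using assms X0_measurable by (auto simp: block_index_def)
  then show ?thesis using Inr by (auto simp: vertex_events_def dest: measurable_sets)
qed

text \<open>A finite subfamily splits into weight events and message events. Within each part
  independence comes from \<open>pwit\<close> and from \<open>initial_messages\<close>; the two
  intersections lie in the two sigma-algebras that are independent of each other by
  assumption.\<close>

lemma indep_vertex_events: "indep_sets vertex_events (block_index words)"
proof (rule indep_setsI)
  fix A J
  assume J: "J \<noteq> {}" "J \<subseteq> block_index words" "finite J" and A: "\<forall>j\<in>J. A j \<in> vertex_events j"
  define J1 where "J1 = Inl -` J"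
  define J2 where "J2 = Inr -` J"
  have J12: "J = Inl ` J1 \<union> Inr ` J2"
  proof (rule set_eqI)
    fix z show "z \<in> J \<longleftrightarrow> z \<in> Inl ` J1 \<union> Inr ` J2"
      by (cases z) (auto simp: J1_def J2_def)
  qed
  have fin: "finite J1" "finite J2"
    using J(3) unfolding J1_def J2_def by (auto intro: finite_vimageI)
  have sub: "J1 \<subseteq> words" "J2 \<subseteq> words1"
    using J(2) by (auto simp: J1_def J2_def block_index_def)
  define P1 where "P1 = space M \<inter> (\<Inter>v\<in>J1. A (Inl v))"
  define P2 where "P2 = space M \<inter> (\<Inter>v\<in>J2. A (Inr v))"
  have A1: "A (Inl v) \<in> {(\<lambda>\<omega>. \<lambda>i\<in>{1..}. \<xi> v i \<omega>) -` A \<inter> space M | A. A \<in> sets (Pi\<^sub>M {1..} (\<lambda>_. borel))}" if "v \<in> J1" for v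
    using A that by (auto simp: J1_def vertex_events_def)
  have A2: "A (Inr v) \<in> {X0 v -` A \<inter> space M | A. A \<in> sets borel}" if "v \<in> J2" for v
    using A that by (auto simp: J2_def vertex_events_def)
  have p1: "prob P1 = (\<Prod>v\<in>J1. prob (A (Inl v)))"
    using pwit unfolding P1_def pwit_def indep_vars_def2
    by (intro prob_space_Int_INT[OF _ sub(1) fin(1) A1]) blast+
  have p2: "prob P2 = (\<Prod>v\<in>J2. prob (A (Inr v)))"
    using init unfolding P2_def initial_messages_def indep_vars_def2
    by (intro prob_space_Int_INT[OF _ sub(2) fin(2) A2]) blast+
  have "P1 \<in> sets (vimage_algebra (space M) (subtree_weights \<xi> []) weight_space)" (is "_ \<in> sets ?V")
  proof -
    have "A (Inl v) \<in> sets ?V" if v: "v \<in> J1" for v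
    proof -
      have "(\<lambda>\<omega>. \<lambda>i\<in>{1..}. \<xi> v i \<omega>) \<in> ?V \<rightarrow>\<^sub>M Pi\<^sub>M {1..} (\<lambda>_. borel)"
        using coordinate_measurable_vimage_algebra[of v _ \<xi> "[]" "space M"] sub v
        by (intro measurable_restrict) auto
      then show ?thesis using A1[OF v] by (auto dest: measurable_sets)
    qed
    then show ?thesis using sets_Int_INT[OF fin(1), of "\<lambda>v. A (Inl v)" ?V] \<open>\<And>v. v \<in> J1 \<Longrightarrow> A (Inl v) \<in> sets ?V\<close>
      by (simp only: P1_def space_vimage_algebra)
  qed
  moreover have "P2 \<in> sets (vimage_algebra (space M) (\<lambda>\<omega>. \<lambda>v\<in>words1. X0 v \<omega>) (Pi\<^sub>M words1 (\<lambda>_. borel)))" (is "_ \<in> sets ?W")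
  proof -
    have X: "(\<lambda>\<omega>. \<lambda>v\<in>words1. X0 v \<omega>) \<in> ?W \<rightarrow>\<^sub>M Pi\<^sub>M words1 (\<lambda>_. borel)"
      by (rule measurable_vimage_algebra1) (auto simp: space_PiM)
    have "A (Inr v) \<in> sets ?W" if v: "v \<in> J2" for v
    proof -
      have "(\<lambda>\<omega>. (\<lambda>v\<in>words1. X0 v \<omega>) v) \<in> ?W \<rightarrow>\<^sub>M borel"
        using v sub by (intro measurable_compose[OF X] measurable_component_singleton) auto
      then have "X0 v \<in> ?W \<rightarrow>\<^sub>M borel" using v sub by (simp add: subset_iff)
      then show ?thesis using A2[OF v] by (auto dest: measurable_sets)
    qed
    then show ?thesis using sets_Int_INT[OF fin(2), of "\<lambda>v. A (Inr v)" ?W] \<open>\<And>v. v \<in> J2 \<Longrightarrow> A (Inr v) \<in> sets ?W\<close>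
      by (simp only: P2_def space_vimage_algebra)
  qed
  moreover have "indep_set (sets (vimage_algebra (space M) (subtree_weights \<xi> []) weight_space))
       (sets (vimage_algebra (space M) (\<lambda>\<omega>. \<lambda>v\<in>words1. X0 v \<omega>) (Pi\<^sub>M words1 (\<lambda>_. borel))))"
    using init by (simp add: initial_messages_def)
  ultimately have "prob (P1 \<inter> P2) = prob P1 * prob P2"
    by (auto dest: indep_setD)
  moreover have "P1 \<inter> P2 = (\<Inter>j\<in>J. A j)"
  proof -
    have "A j \<subseteq> space M" if "j \<in> J" for j
      using that A1 A2 unfolding J12 by blast
    then have "(\<Inter>j\<in>J. A j) = space M \<inter> (\<Inter>j\<in>J. A j)" using J(1) by blast
    also have "\<dots> = P1 \<inter> P2" unfolding P1_def P2_def J12 by blast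
    finally show ?thesis by simp
  qed
  moreover have "(\<Prod>j\<in>J. prob (A j)) = (\<Prod>v\<in>J1. prob (A (Inl v))) * (\<Prod>v\<in>J2. prob (A (Inr v)))"
    unfolding J12 using fin by (subst prod.union_disjoint) (auto simp: prod.reindex)
  ultimately show "prob (\<Inter>j\<in>J. A j) = (\<Prod>j\<in>J. prob (A j))"
    by (simp add: p1 p2)
qed (rule vertex_events_events)

lemma block_index_mono: "K \<subseteq> L \<Longrightarrow> block_index K \<subseteq> block_index L"
  by (auto simp: block_index_def)

lemma space_block [simp]: "space (block K) = space M"
  unfolding block_def by (auto simp: space_measure_of_conv)

lemma vertex_events_Pow: "(\<Union>z\<in>block_index K. vertex_events z) \<subseteq> Pow (space M)"
  by (auto simp: vertex_events_def block_index_def)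

lemma sets_block: "sets (block K) = sigma_sets (space M) (\<Union>z\<in>block_index K. vertex_events z)"
  unfolding block_def by (rule sets_measure_of[OF vertex_events_Pow])

lemma sets_block_mono: "K \<subseteq> L \<Longrightarrow> sets (block K) \<subseteq> sets (block L)"
  unfolding sets_block using block_index_mono by (intro sigma_sets_mono') blast

lemma sets_block_events: "K \<subseteq> words \<Longrightarrow> sets (block K) \<subseteq> events"
  unfolding sets_block using block_index_mono[of K words] vertex_events_events
  by (intro sets.sigma_sets_subset) blast

lemma measurable_block_mono: "f \<in> block K \<rightarrow>\<^sub>M N \<Longrightarrow> K \<subseteq> L \<Longrightarrow> f \<in> block L \<rightarrow>\<^sub>M N"
  using sets_block_mono[of K L] by (auto simp: measurable_def)

lemma measurable_block: "f \<in> block K \<rightarrow>\<^sub>M N \<Longrightarrow> K \<subseteq> words \<Longrightarrow> f \<in> M \<rightarrow>\<^sub>M N"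
  using sets_block_events[of K] by (auto simp: measurable_def)

lemma weights_measurable_block:
  assumes "v \<in> K"
  shows "(\<lambda>\<omega>. \<lambda>i\<in>{1..}. \<xi> v i \<omega>) \<in> block K \<rightarrow>\<^sub>M Pi\<^sub>M {1..} (\<lambda>_. borel)"
proof (rule measurableI)
  fix A assume "A \<in> sets (Pi\<^sub>M {1::nat..} (\<lambda>_. borel :: real measure))"
  then have "(\<lambda>\<omega>. \<lambda>i\<in>{1..}. \<xi> v i \<omega>) -` A \<inter> space M \<in> vertex_events (Inl v)"
    by (auto simp: vertex_events_def)
  then show "(\<lambda>\<omega>. \<lambda>i\<in>{1..}. \<xi> v i \<omega>) -` A \<inter> space (block K) \<in> sets (block K)"
    using assms unfolding sets_block space_block
    by (intro sigma_sets.Basic) (auto simp: block_index_def)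
qed (auto simp: space_PiM)

lemma weight_measurable_block:
  assumes "v \<in> K" "1 \<le> i"
  shows "\<xi> v i \<in> borel_measurable (block K)"
proof -
  have "(\<lambda>\<omega>. (\<lambda>i\<in>{1..}. \<xi> v i \<omega>) i) \<in> block K \<rightarrow>\<^sub>M borel"
    using assms by (intro measurable_compose[OF weights_measurable_block] measurable_component_singleton) auto
  then show ?thesis using assms by simp
qed

lemma X0_measurable_block:
  assumes "v \<in> K" "v \<in> words1"
  shows "X0 v \<in> borel_measurable (block K)"
proof (rule measurableI)
  fix A :: "ereal set" assume "A \<in> sets borel"
  then have "X0 v -` A \<inter> space M \<in> vertex_events (Inr v)"
    by (auto simp: vertex_events_def)
  then show "X0 v -` A \<inter> space (block K) \<in> sets (block K)"
    using assms unfolding sets_block space_block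
    by (intro sigma_sets.Basic) (auto simp: block_index_def)
qed auto

text \<open>Reduces the later independence claims for messages and weights to disjointness of sets
  of vertices.\<close>

lemma indep_vars_block:
  assumes K: "\<And>j. j \<in> J \<Longrightarrow> K j \<subseteq> words" "disjoint_family_on K J"
    and Y: "\<And>j. j \<in> J \<Longrightarrow> Y j \<in> block (K j) \<rightarrow>\<^sub>M N j"
  shows "indep_vars N Y J"
proof -
  have "indep_sets (\<lambda>j. sigma_sets (space M) (\<Union>z\<in>block_index (K j). vertex_events z)) J"
  proof (rule indep_sets_collect_sigma)
    show "indep_sets vertex_events (\<Union>j\<in>J. block_index (K j))"
      using K(1) block_index_mono by (intro indep_sets_mono_index[OF _ indep_vertex_events]) blast
    show "disjoint_family_on (\<lambda>j. block_index (K j)) J"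
      using K(2) unfolding disjoint_family_on_def block_index_def by blast
    show "Int_stable (vertex_events z)" for z
    proof (rule Int_stableI)
      fix a b assume "a \<in> vertex_events z" "b \<in> vertex_events z"
      then show "a \<inter> b \<in> vertex_events z"
        by (cases z) (auto simp: vertex_events_def vimage_inter_in)
    qed
  qed
  then have "indep_sets (\<lambda>j. {Y j -` A \<inter> space M | A. A \<in> sets (N j)}) J"
  proof (rule indep_sets_mono_sets)
    fix j assume j: "j \<in> J"
    show "{Y j -` A \<inter> space M | A. A \<in> sets (N j)} \<subseteq> sigma_sets (space M) (\<Union>z\<in>block_index (K j). vertex_events z)"
      using measurable_sets[OF Y[OF j]] unfolding sets_block space_block by blast
  qed
  then show ?thesis
    unfolding indep_vars_def2 using measurable_block[OF Y K(1)] by blast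
qed

lemma indep_var_block:
  assumes "K \<subseteq> words" "L \<subseteq> words" "K \<inter> L = {}" "X \<in> block K \<rightarrow>\<^sub>M S" "Y \<in> block L \<rightarrow>\<^sub>M T"
  shows "indep_var S X T Y"
  unfolding indep_var_def
  by (rule indep_vars_block[where K = "case_bool K L"])
     (use assms in \<open>auto simp: disjoint_family_on_def UNIV_bool split: bool.splits\<close>)

lemma message_measurable_block:
  assumes "v \<in> words" "k = 0 \<Longrightarrow> v \<noteq> []" "descendants v \<subseteq> K"
  shows "message \<xi> X0 k v \<in> borel_measurable (block K)"
proof (rule measurable_message)
  fix w assume w: "w \<in> words"
  then have "v @ w \<in> K" using assms(3) by (auto simp: descendants_def)
  then show "\<xi> (v @ w) i \<in> borel_measurable (block K)" if "1 \<le> i" for i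
    using that by (rule weight_measurable_block)
  show "X0 (v @ w) \<in> borel_measurable (block K)" if "length w = k"
    using that assms w \<open>v @ w \<in> K\<close> by (intro X0_measurable_block) (auto simp: words1_iff)
qed

lemma message_measurable: "v \<in> words1 \<Longrightarrow> message \<xi> X0 k v \<in> borel_measurable M"
  using measurable_block[OF message_measurable_block[of v k "descendants v"]]
  by (simp add: descendants_subset_words words1_iff)

section \<open>One round at a vertex and its children\<close>

context
  fixes v :: "nat list" and Y :: "nat \<Rightarrow> 'a \<Rightarrow> ereal"
  assumes v: "v \<in> words"
    and Y: "\<And>i. 1 \<le> i \<Longrightarrow> Y i \<in> borel_measurable (block (descendants (v @ [i])))"
begin

lemma indep_var_weights_children:
  "indep_var (Pi\<^sub>M {1..} (\<lambda>_. borel)) (\<lambda>\<omega>. \<lambda>i\<in>{1..}. ereal (\<xi> v i \<omega>))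
     (Pi\<^sub>M {1..} (\<lambda>_. borel)) (\<lambda>\<omega>. \<lambda>i\<in>{1..}. Y i \<omega>)"
proof (rule indep_var_block)
  let ?L = "\<Union>i\<in>{1..}. descendants (v @ [i])"
  show "{v} \<subseteq> words" "?L \<subseteq> words" "{v} \<inter> ?L = {}"
    using v by (auto simp: descendants_def)
  show "(\<lambda>\<omega>. \<lambda>i\<in>{1..}. ereal (\<xi> v i \<omega>)) \<in> block {v} \<rightarrow>\<^sub>M Pi\<^sub>M {1..} (\<lambda>_. borel)"
    using weight_measurable_block[of v "{v}"] by (intro measurable_restrict) auto
  show "(\<lambda>\<omega>. \<lambda>i\<in>{1..}. Y i \<omega>) \<in> block ?L \<rightarrow>\<^sub>M Pi\<^sub>M {1..} (\<lambda>_. borel)"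
    by (intro measurable_restrict measurable_block_mono[OF Y]) auto
qed

lemma indep_vars_children: "indep_vars (\<lambda>_. borel) Y {1..}"
  by (rule indep_vars_block[where K = "\<lambda>i. descendants (v @ [i])"])
     (use v Y in \<open>auto simp: disjoint_family_on_def descendants_def\<close>)

lemmas prob_children_INF = prob_INF_greater[OF weights_poisson[OF v] indep_var_weights_children indep_vars_children]
  and AE_finite_children = AE_finite_competitors[OF weights_poisson[OF v] indep_var_weights_children indep_vars_children]

end

end

section \<open>Replacing the messages at a given depth\<close>

text \<open>The sets that can be approximated form a sigma-algebra: complements have the same
  symmetric differences, and a countable union is first cut to finitely many sets, which are then
  approximated one by one.\<close>

lemma (in prob_space) approximation_by_algebra:
  assumes alg: "algebra (space M) \<A>" and ev: "\<A> \<subseteq> events"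
    and A: "A \<in> sigma_sets (space M) \<A>" and "0 < (e::real)"
  shows "\<exists>B\<in>\<A>. prob ((A - B) \<union> (B - A)) < e"
  using A \<open>0 < e\<close>
proof (induction A arbitrary: e)
  case (Basic a)
  then show ?case by (intro bexI[of _ a]) auto
next
  case Empty
  interpret algebra "space M" \<A> by (rule alg)
  show ?case using Empty by (intro bexI[of _ "{}"]) auto
next
  case (Compl a)
  interpret algebra "space M" \<A> by (rule alg)
  obtain B where B: "B \<in> \<A>" "prob ((a - B) \<union> (B - a)) < e"
    using Compl.IH[OF Compl.prems] by blast
  have "a \<subseteq> space M" "B \<subseteq> space M"
    using sigma_sets_into_sp[OF space_closed Compl.hyps] sets_into_space B(1) by auto
  then have "(space M - a) - (space M - B) \<union> ((space M - B) - (space M - a)) = (a - B) \<union> (B - a)"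
    by blast
  then show ?case using B by (intro bexI[of _ "space M - B"]) auto
next
  case (Union a)
  interpret algebra "space M" \<A> by (rule alg)
  have a: "a i \<in> events" for i
    using Union.hyps[of i] sets.sigma_sets_subset[OF ev] by blast
  have lim: "(\<lambda>n. prob (\<Union>i<n. a i)) \<longlonglongrightarrow> prob (\<Union>n. \<Union>i<n. a i)"
    using a by (intro finite_Lim_measure_incseq) (auto simp: incseq_def intro: less_le_trans)
  moreover have "(\<Union>n. \<Union>i<n. a i) = (\<Union>i. a i)" by blast
  ultimately have "(\<lambda>n. prob (\<Union>i. a i) - prob (\<Union>i<n. a i)) \<longlonglongrightarrow> 0"
    using tendsto_diff[OF tendsto_const[of "prob (\<Union>i. a i)"] lim] by simp
  then have "eventually (\<lambda>n. prob (\<Union>i. a i) - prob (\<Union>i<n. a i) < e / 2) sequentially"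
    using Union.prems by (intro order_tendstoD(2)) auto
  then obtain N where N: "prob (\<Union>i. a i) - prob (\<Union>i<N. a i) < e / 2"
    by (auto simp: eventually_sequentially)
  \<comment> \<open>The \<open>N\<close> approximation errors add up to at most
    \<open>e / 2\<close>; the denominator \<open>N + 1\<close> admits \<open>N = 0\<close>. The
    strict inequality at the end comes from the part that was cut off.\<close>
  define d where "d = e / (2 * (real N + 1))"
  have d: "0 < d" using Union.prems by (simp add: d_def)
  have Nd: "real N * d \<le> e / 2"
    using Union.prems by (simp add: d_def field_simps)
  have "\<forall>i. \<exists>B\<in>\<A>. prob ((a i - B) \<union> (B - a i)) < d"
    using Union.IH d by blast
  then obtain B where B: "\<And>i. B i \<in> \<A>" "\<And>i. prob ((a i - B i) \<union> (B i - a i)) < d"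
    by metis
  have Be: "B i \<in> events" for i using B ev by blast
  let ?B = "\<Union>i<N. B i"
  have "prob ((\<Union>(range a) - ?B) \<union> (?B - \<Union>(range a))) \<le>
      prob ((\<Union>(range a) - (\<Union>i<N. a i)) \<union> (\<Union>i<N. (a i - B i) \<union> (B i - a i)))"
    using a Be by (intro finite_measure_mono) auto
  also have "\<dots> \<le> prob (\<Union>(range a) - (\<Union>i<N. a i)) + prob (\<Union>i<N. (a i - B i) \<union> (B i - a i))"
    using a Be by (intro measure_Un_le) auto
  also have "prob (\<Union>(range a) - (\<Union>i<N. a i)) = prob (\<Union>i. a i) - prob (\<Union>i<N. a i)"
    using a by (intro finite_measure_Diff) auto
  also have "prob (\<Union>i<N. (a i - B i) \<union> (B i - a i)) \<le> (\<Sum>i<N. prob ((a i - B i) \<union> (B i - a i)))"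
    using a Be by (intro finite_measure_subadditive_finite) auto
  also have "\<dots> \<le> (\<Sum>i<N. d)"
    using B by (intro sum_mono) (auto intro: less_imp_le)
  also have "\<dots> \<le> e / 2" using Nd by simp
  finally have "prob ((\<Union>(range a) - ?B) \<union> (?B - \<Union>(range a))) < e"
    using N by simp
  moreover have "?B \<in> \<A>" using B by (intro finite_UN) auto
  ultimately show ?case by blast
qed

lemma (in prob_space) distr_eqI_tails:
  fixes Y Z :: "'a \<Rightarrow> real"
  assumes [measurable]: "Y \<in> borel_measurable M" "Z \<in> borel_measurable M"
    and eq: "\<And>x. \<P>(\<omega> in M. x < Y \<omega>) = \<P>(\<omega> in M. x < Z \<omega>)"
  shows "distr M borel Y = distr M borel Z"
proof (rule cdf_unique)
  show "real_distribution (distr M borel Y)" "real_distribution (distr M borel Z)"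
    by (auto intro!: real_distribution_distr)
  have *: "cdf (distr M borel U) x = 1 - \<P>(\<omega> in M. x < U \<omega>)" if [measurable]: "U \<in> borel_measurable M" for U x
  proof -
    have "cdf (distr M borel U) x = prob (space M - {\<omega> \<in> space M. x < U \<omega>})"
      unfolding cdf_def by (subst measure_distr) (auto intro!: arg_cong[where f = prob])
    then show ?thesis by (simp add: prob_compl)
  qed
  show "cdf (distr M borel Y) = cdf (distr M borel Z)"
    by (simp add: fun_eq_iff * eq)
qed

section \<open>The law of the weights up to a depth together with boundary messages\<close>

context pwit_messages
begin

text \<open>The first clause also yields independence, since messages from disjoint subtrees are
  functions of disjoint blocks. As blocks contain initial messages too, both the stationary messages
  and messages derived from later rounds of the recursion qualify.\<close>

definition logistic_messages :: "(nat list \<Rightarrow> 'a \<Rightarrow> real) \<Rightarrow> bool" where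
  "logistic_messages W \<longleftrightarrow> (\<forall>v\<in>words1. W v \<in> borel_measurable (block (descendants v)) \<and>
     (\<forall>x. \<P>(\<omega> in M. x < W v \<omega>) = logis 0 x))"

text \<open>A message at the boundary depth is stored as a constant sequence, so that it has the same type as
  the weights at a vertex.\<close>

definition vertex_data :: "nat list \<Rightarrow> nat \<Rightarrow> (nat list \<Rightarrow> 'a \<Rightarrow> real) \<Rightarrow> nat list \<Rightarrow> 'a \<Rightarrow> nat \<Rightarrow> real" where
  "vertex_data v n W w \<omega> = (if length w \<le> n then (\<lambda>i\<in>{1..}. \<xi> (v @ w) i \<omega>) else (\<lambda>i\<in>{1..}. W (v @ w) \<omega>))"

abbreviation words_upto :: "nat \<Rightarrow> nat list set" where
  "words_upto n \<equiv> {w \<in> words. length w \<le> n}"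

abbreviation data_space :: "nat list set \<Rightarrow> (nat list \<Rightarrow> nat \<Rightarrow> real) measure" where
  "data_space K \<equiv> Pi\<^sub>M K (\<lambda>_. Pi\<^sub>M {1..} (\<lambda>_. borel))"

definition truncated_data :: "nat list \<Rightarrow> nat \<Rightarrow> (nat list \<Rightarrow> 'a \<Rightarrow> real) \<Rightarrow> 'a \<Rightarrow> nat list \<Rightarrow> nat \<Rightarrow> real" where
  "truncated_data v n W \<omega> = (\<lambda>w\<in>words_upto (Suc n). vertex_data v n W w \<omega>)"

text \<open>All that the next message from \<open>v\<close>, or the decision if \<open>v\<close> is
  the root, depends on. Treating it as one random element lets a single convergence result serve
  both.\<close>

definition star_of :: "nat list \<Rightarrow> (nat list \<Rightarrow> 'a \<Rightarrow> ereal) \<Rightarrow> 'a \<Rightarrow> (nat \<Rightarrow> real) \<times> (nat \<Rightarrow> ereal)" where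
  "star_of v Y \<omega> = ((\<lambda>i\<in>{1..}. \<xi> v i \<omega>), (\<lambda>i\<in>{1..}. Y (v @ [i]) \<omega>))"

abbreviation star_space :: "((nat \<Rightarrow> real) \<times> (nat \<Rightarrow> ereal)) measure" where
  "star_space \<equiv> Pi\<^sub>M {1..} (\<lambda>_. borel) \<Otimes>\<^sub>M Pi\<^sub>M {1..} (\<lambda>_. borel)"

abbreviation real_message :: "(nat list \<Rightarrow> 'a \<Rightarrow> real) \<Rightarrow> nat \<Rightarrow> nat list \<Rightarrow> 'a \<Rightarrow> ereal" where
  "real_message W \<equiv> message \<xi> (\<lambda>u \<omega>. ereal (W u \<omega>))"

lemma logistic_messages_measurable:
  assumes "logistic_messages W" "v \<in> words1"
  shows "W v \<in> borel_measurable (block (descendants v))" "W v \<in> borel_measurable M"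
  using assms measurable_block[of "W v" "descendants v"]
  by (auto simp: logistic_messages_def descendants_subset_words words1_iff)

definition boundary_block :: "nat list \<Rightarrow> nat \<Rightarrow> nat list \<Rightarrow> nat list set" where
  "boundary_block v n w = (if length w \<le> n then {v @ w} else descendants (v @ w))"

lemma vertex_data_measurable:
  assumes W: "logistic_messages W" and v: "v \<in> words" and w: "w \<in> words_upto (Suc n)"
  shows "vertex_data v n W w \<in> block (boundary_block v n w) \<rightarrow>\<^sub>M Pi\<^sub>M {1..} (\<lambda>_. borel)"
proof (cases "length w \<le> n")
  case True
  then show ?thesis
    using weights_measurable_block[of "v @ w" "{v @ w}"]
    by (simp add: vertex_data_def[abs_def] boundary_block_def)
next
  case False
  then have "v @ w \<in> words1" using v w by (auto simp: words1_iff)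
  then show ?thesis
    using logistic_messages_measurable[OF W] False
    by (auto simp: vertex_data_def[abs_def] boundary_block_def intro!: measurable_restrict)
qed

lemma boundary_block_subset_words: "v \<in> words \<Longrightarrow> w \<in> words_upto (Suc n) \<Longrightarrow> boundary_block v n w \<subseteq> words"
  by (auto simp: boundary_block_def descendants_def)

lemma vertex_data_indep:
  assumes W: "logistic_messages W" and v: "v \<in> words"
  shows "indep_vars (\<lambda>_. Pi\<^sub>M {1..} (\<lambda>_. borel)) (vertex_data v n W) (words_upto (Suc n))"
proof (rule indep_vars_block[OF boundary_block_subset_words[OF v]])
  show "disjoint_family_on (boundary_block v n) (words_upto (Suc n))"
    unfolding disjoint_family_on_def
  proof (intro ballI impI)
    fix u w assume "u \<in> words_upto (Suc n)" "w \<in> words_upto (Suc n)" "u \<noteq> w"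
    then show "boundary_block v n u \<inter> boundary_block v n w = {}"
      by (auto simp: boundary_block_def descendants_def)
  qed
next
  show "vertex_data v n W w \<in> block (boundary_block v n w) \<rightarrow>\<^sub>M Pi\<^sub>M {1..} (\<lambda>_. borel)"
    if "w \<in> words_upto (Suc n)" for w
    by (rule vertex_data_measurable[OF W v that])
qed

text \<open>Both laws are product measures with the same factors: the same weights up to depth
  \<open>n\<close>, and logistic variables one level deeper. How a boundary message is built from
  its own subtree is invisible here.\<close>

lemma truncated_data_distr:
  assumes W: "logistic_messages W" and W': "logistic_messages W'" and v: "v \<in> words"
  shows "distr M (data_space (words_upto (Suc n))) (truncated_data v n W) =
    distr M (data_space (words_upto (Suc n))) (truncated_data v n W')"
proof -
  let ?S = "Pi\<^sub>M {1::nat..} (\<lambda>_. borel :: real measure)"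
  have rv: "vertex_data v n U w \<in> M \<rightarrow>\<^sub>M ?S" if "logistic_messages U" "w \<in> words_upto (Suc n)" for U w
    using vertex_data_measurable[OF that(1) v that(2)] boundary_block_subset_words[OF v that(2)]
    by (rule measurable_block)
  have ne: "words_upto (Suc n) \<noteq> {}" using Nil_in_words by (auto intro!: exI[of _ "[]"])
  have PiM: "distr M (data_space (words_upto (Suc n))) (truncated_data v n U) =
      (\<Pi>\<^sub>M w\<in>words_upto (Suc n). distr M ?S (vertex_data v n U w))" if U: "logistic_messages U" for U
    using indep_vars_iff_distr_eq_PiM'[OF ne rv[OF U]] vertex_data_indep[OF U v, of n]
    by (simp add: truncated_data_def[abs_def])
  have "distr M ?S (vertex_data v n W w) = distr M ?S (vertex_data v n W' w)" if w: "w \<in> words_upto (Suc n)" for w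
  proof (cases "length w \<le> n")
    case True
    then show ?thesis by (simp add: vertex_data_def[abs_def])
  next
    case False
    then have u: "v @ w \<in> words1" using v w by (auto simp: words1_iff)
    note m = logistic_messages_measurable(2)[OF W u] logistic_messages_measurable(2)[OF W' u]
    have "distr M borel (W (v @ w)) = distr M borel (W' (v @ w))"
      using W W' u m by (intro distr_eqI_tails) (auto simp: logistic_messages_def)
    moreover have "distr M ?S (vertex_data v n U w) = distr (distr M borel (U (v @ w))) ?S (\<lambda>x. \<lambda>i\<in>{1..}. x)"
      if "U (v @ w) \<in> borel_measurable M" for U
      using that False by (subst distr_distr) (auto simp: vertex_data_def[abs_def] comp_def intro!: measurable_restrict)
    ultimately show ?thesis using m by simp
  qed
  then show ?thesis
    unfolding PiM[OF W] PiM[OF W'] by (intro PiM_cong) auto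
qed

lemma truncated_data_measurable:
  assumes "logistic_messages W" "v \<in> words"
  shows "truncated_data v n W \<in> M \<rightarrow>\<^sub>M data_space (words_upto (Suc n))"
  unfolding truncated_data_def[abs_def]
  using measurable_block[OF vertex_data_measurable[OF assms] boundary_block_subset_words[OF assms(2)]]
  by (rule measurable_restrict)

lemma prob_truncated_data:
  assumes "logistic_messages W" "logistic_messages W'" "v \<in> words" "S \<in> sets (data_space (words_upto (Suc n)))"
  shows "\<P>(\<omega> in M. truncated_data v n W \<omega> \<in> S) = \<P>(\<omega> in M. truncated_data v n W' \<omega> \<in> S)"
proof -
  have "\<P>(\<omega> in M. truncated_data v n U \<omega> \<in> S) = measure (distr M (data_space (words_upto (Suc n))) (truncated_data v n U)) S"
    if "logistic_messages U" for U
    using truncated_data_measurable[OF that assms(3), of n] assms(4)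
    by (auto simp: measure_distr intro!: arg_cong[where f = prob])
  then show ?thesis using assms truncated_data_distr[of W W' v n] by simp
qed

text \<open>The recursion run on the coordinate space, where the data \<open>f\<close> are
  themselves the sample point. Boundary messages are constant sequences, so reading index 1 recovers
  them.\<close>

definition star_functional :: "nat \<Rightarrow> (nat list \<Rightarrow> nat \<Rightarrow> real) \<Rightarrow> (nat \<Rightarrow> real) \<times> (nat \<Rightarrow> ereal)" where
  "star_functional n f = ((\<lambda>i\<in>{1..}. f [] i), (\<lambda>i\<in>{1..}. message (\<lambda>w i f. f w i) (\<lambda>w f. ereal (f w 1)) n [i] f))"

lemma star_functional_measurable:
  "star_functional n \<in> data_space (words_upto (Suc n)) \<rightarrow>\<^sub>M star_space"
proof -
  have c: "(\<lambda>f. f w i) \<in> borel_measurable (data_space (words_upto (Suc n)))"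
    if "w \<in> words_upto (Suc n)" "1 \<le> i" for w and i :: nat
  proof -
    have "(\<lambda>f. f w) \<in> data_space (words_upto (Suc n)) \<rightarrow>\<^sub>M Pi\<^sub>M {1..} (\<lambda>_. borel)"
      using that(1) by (rule measurable_component_singleton)
    then show ?thesis
      by (rule measurable_compose) (use that in \<open>auto intro: measurable_component_singleton\<close>)
  qed
  show ?thesis
    unfolding star_functional_def[abs_def]
    by (intro measurable_Pair measurable_restrict measurable_message borel_measurable_ereal c) auto
qed

lemma star_functional_truncated_data:
  "star_functional n (truncated_data v n W \<omega>) = star_of v (real_message W n) \<omega>"
proof -
  have "message (\<lambda>w i f. f w i) (\<lambda>w f. ereal (f w 1)) n [i] (truncated_data v n W \<omega>) = real_message W n (v @ [i]) \<omega>"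
    if "1 \<le> i" for i
    using that by (intro message_cong) (auto simp: truncated_data_def vertex_data_def)
  then show ?thesis
    by (auto simp: star_functional_def star_of_def truncated_data_def vertex_data_def fun_eq_iff restrict_def)
qed

lemma star_of_measurable:
  assumes "v \<in> words" "\<And>i. 1 \<le> i \<Longrightarrow> Y (v @ [i]) \<in> borel_measurable M"
  shows "star_of v Y \<in> M \<rightarrow>\<^sub>M star_space"
  unfolding star_of_def[abs_def] using assms weight_measurable
  by (intro measurable_Pair measurable_restrict) auto

end

lemma sets_Collect_in:
  assumes "f \<in> M \<rightarrow>\<^sub>M N" "A \<in> sets N"
  shows "{x \<in> space M. f x \<in> A} \<in> sets M"
  using measurable_sets[OF assms] by (simp add: vimage_def Int_def conj_commute)

section \<open>Events determined by weights up to a finite depth\<close>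

context pwit_messages
begin

abbreviation words_below :: "nat \<Rightarrow> nat list set" where
  "words_below m \<equiv> {w \<in> words. length w < m}"

definition truncated_weights :: "nat list \<Rightarrow> nat \<Rightarrow> 'a \<Rightarrow> nat list \<Rightarrow> nat \<Rightarrow> real" where
  "truncated_weights v m \<omega> = (\<lambda>w\<in>words_below m. \<lambda>i\<in>{1..}. \<xi> (v @ w) i \<omega>)"

definition finite_depth_events :: "nat list \<Rightarrow> 'a set set" where
  "finite_depth_events v =
     {{\<omega> \<in> space M. truncated_weights v m \<omega> \<in> B} | m B. B \<in> sets (data_space (words_below m))}"

lemma truncated_weights_in_space: "truncated_weights v m \<omega> \<in> space (data_space (words_below m))"
  by (auto simp: truncated_weights_def space_PiM)

lemma truncated_weights_measurable:
  "v \<in> words \<Longrightarrow> truncated_weights v m \<in> M \<rightarrow>\<^sub>M data_space (words_below m)"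
  unfolding truncated_weights_def[abs_def] using weight_measurable
  by (intro measurable_restrict) auto

text \<open>Two events of different depths are combined at the larger depth, which is what makes the
  finite-depth events an algebra.\<close>

lemma finite_depth_events_lift:
  assumes B: "B \<in> sets (data_space (words_below m))" and "m \<le> n"
  shows "\<exists>C\<in>sets (data_space (words_below n)).
    {\<omega> \<in> space M. truncated_weights v m \<omega> \<in> B} = {\<omega> \<in> space M. truncated_weights v n \<omega> \<in> C}"
proof -
  have sub: "words_below m \<subseteq> words_below n" using \<open>m \<le> n\<close> by auto
  define C where "C = (\<lambda>f. restrict f (words_below m)) -` B \<inter> space (data_space (words_below n))"
  have "C \<in> sets (data_space (words_below n))"
    unfolding C_def using measurable_restrict_subset[OF sub] B by (rule measurable_sets)
  moreover have "restrict (truncated_weights v n \<omega>) (words_below m) = truncated_weights v m \<omega>" for \<omega>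
    using sub unfolding truncated_weights_def by (simp add: restrict_restrict Int_absorb1)
  ultimately show ?thesis
    using truncated_weights_in_space[of v n] by (intro bexI[of _ C]) (auto simp: C_def)
qed

lemma finite_depth_events_algebra: "algebra (space M) (finite_depth_events v)"
  unfolding algebra_iff_Int
proof (intro conjI ballI)
  show "finite_depth_events v \<subseteq> Pow (space M)" by (auto simp: finite_depth_events_def)
  show "{} \<in> finite_depth_events v"
    unfolding finite_depth_events_def by (intro CollectI exI[of _ 0] exI[of _ "{}"]) auto
next
  fix a assume "a \<in> finite_depth_events v"
  then obtain m B where B: "B \<in> sets (data_space (words_below m))" "a = {\<omega> \<in> space M. truncated_weights v m \<omega> \<in> B}"
    by (auto simp: finite_depth_events_def)
  then show "space M - a \<in> finite_depth_events v"
    using truncated_weights_in_space[of v m] sets.compl_sets[OF B(1)] unfolding finite_depth_events_def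
    by (intro CollectI exI[of _ m] exI[of _ "space (data_space (words_below m)) - B"]) auto
next
  fix a b assume "a \<in> finite_depth_events v" "b \<in> finite_depth_events v"
  then obtain m B n C where B: "B \<in> sets (data_space (words_below m))" "a = {\<omega> \<in> space M. truncated_weights v m \<omega> \<in> B}"
    and C: "C \<in> sets (data_space (words_below n))" "b = {\<omega> \<in> space M. truncated_weights v n \<omega> \<in> C}"
    by (auto simp: finite_depth_events_def)
  obtain B' C' where B': "B' \<in> sets (data_space (words_below (max m n)))" "a = {\<omega> \<in> space M. truncated_weights v (max m n) \<omega> \<in> B'}"
    and C': "C' \<in> sets (data_space (words_below (max m n)))" "b = {\<omega> \<in> space M. truncated_weights v (max m n) \<omega> \<in> C'}"
    using finite_depth_events_lift[OF B(1), of "max m n" v] finite_depth_events_lift[OF C(1), of "max m n" v] B(2) C(2)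
    by auto
  then show "a \<inter> b \<in> finite_depth_events v"
    unfolding finite_depth_events_def
    by (intro CollectI exI[of _ "max m n"] exI[of _ "B' \<inter> C'"]) auto
qed

lemma finite_depth_events_events: "v \<in> words \<Longrightarrow> finite_depth_events v \<subseteq> events"
  using sets_Collect_in[OF truncated_weights_measurable]
  by (auto simp: finite_depth_events_def)

lemma weight_measurable_finite_depth:
  assumes "w \<in> words" "1 \<le> i"
  shows "\<xi> (v @ w) i \<in> borel_measurable (sigma (space M) (finite_depth_events v))"
proof (rule measurableI)
  have Pow: "finite_depth_events v \<subseteq> Pow (space M)" by (auto simp: finite_depth_events_def)
  fix A :: "real set" assume A: "A \<in> sets borel"
  define m where "m = Suc (length w)"
  have w: "w \<in> words_below m" using assms by (simp add: m_def)
  have [measurable]: "(\<lambda>f. f w i) \<in> borel_measurable (data_space (words_below m))"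
    by (rule measurable_compose[OF measurable_component_singleton[OF w]])
       (use assms in \<open>auto intro: measurable_component_singleton\<close>)
  have "{f \<in> space (data_space (words_below m)). f w i \<in> A} \<in> sets (data_space (words_below m))"
    using A by measurable
  moreover have "\<xi> (v @ w) i -` A \<inter> space M =
      {\<omega> \<in> space M. truncated_weights v m \<omega> \<in> {f \<in> space (data_space (words_below m)). f w i \<in> A}}"
    using truncated_weights_in_space[of v m] w assms by (auto simp: truncated_weights_def)
  ultimately have "\<xi> (v @ w) i -` A \<inter> space M \<in> finite_depth_events v"
    unfolding finite_depth_events_def by blast
  then show "\<xi> (v @ w) i -` A \<inter> space (sigma (space M) (finite_depth_events v)) \<in> sets (sigma (space M) (finite_depth_events v))"
    using Pow by (simp add: space_measure_of sets_measure_of)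
qed auto

end

section \<open>Endogeny of the stationary configuration\<close>

locale pwit_stationary = pwit_messages +
  fixes Xs :: "nat list \<Rightarrow> 'a \<Rightarrow> real"
  assumes stat: "stationary_configuration M \<xi> Xs"
begin

text \<open>\<open>N\<close> is general because it stands for the sigma-algebra of a subtree in one
  use and for the one generated by finite-depth events in another.\<close>

lemma Xs_measurable:
  assumes v: "v \<in> words1" and sp: "space N = space M"
    and "\<And>w i. w \<in> words \<Longrightarrow> 1 \<le> i \<Longrightarrow> \<xi> (v @ w) i \<in> borel_measurable N"
  shows "Xs v \<in> borel_measurable N"
proof -
  obtain f where f: "f \<in> borel_measurable weight_space" "\<And>\<omega>. \<omega> \<in> space M \<Longrightarrow> Xs v \<omega> = f (subtree_weights \<xi> v \<omega>)"
    using stat v unfolding stationary_configuration_def by blast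
  have "(\<lambda>\<omega>. f (subtree_weights \<xi> v \<omega>)) \<in> borel_measurable N"
    by (rule measurable_compose[OF subtree_weights_measurable f(1)]) (rule assms(3))
  then show ?thesis
    using measurable_cong[of N "Xs v" "\<lambda>\<omega>. f (subtree_weights \<xi> v \<omega>)" borel] f(2) sp by simp
qed

lemma logistic_Xs: "logistic_messages Xs"
proof -
  have "Xs v \<in> borel_measurable (block (descendants v))" if "v \<in> words1" for v
    using that by (intro Xs_measurable weight_measurable_block) (auto simp: descendants_def)
  then show ?thesis
    using stat by (auto simp: logistic_messages_def stationary_configuration_def logis_def)
qed

lemma Xs_fixed_point: "AE \<omega> in M. \<forall>v\<in>words1. real_message Xs n v \<omega> = ereal (Xs v \<omega>)"
proof -
  have "AE \<omega> in M. \<forall>v\<in>words1. \<exists>i. is_arg_min (\<lambda>j. \<xi> v j \<omega> - Xs (v @ [j]) \<omega>) (\<lambda>j. 1 \<le> j) i \<and>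
        Xs v \<omega> = \<xi> v i \<omega> - Xs (v @ [i]) \<omega>"
    using stat by (auto simp: stationary_configuration_def)
  then show ?thesis
  proof eventually_elim
    case (elim \<omega>)
    have step: "(INF i\<in>{1..}. ereal (\<xi> v i \<omega>) - ereal (Xs (v @ [i]) \<omega>)) = ereal (Xs v \<omega>)" if "v \<in> words1" for v
    proof (rule antisym)
      obtain i where i: "1 \<le> i" "\<And>j. 1 \<le> j \<Longrightarrow> \<xi> v i \<omega> - Xs (v @ [i]) \<omega> \<le> \<xi> v j \<omega> - Xs (v @ [j]) \<omega>"
        "Xs v \<omega> = \<xi> v i \<omega> - Xs (v @ [i]) \<omega>"
        using elim \<open>v \<in> words1\<close> by (auto simp: is_arg_min_linorder)
      show "(INF i\<in>{1..}. ereal (\<xi> v i \<omega>) - ereal (Xs (v @ [i]) \<omega>)) \<le> ereal (Xs v \<omega>)"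
        using i by (intro INF_lower2[of i]) auto
      show "ereal (Xs v \<omega>) \<le> (INF i\<in>{1..}. ereal (\<xi> v i \<omega>) - ereal (Xs (v @ [i]) \<omega>))"
        using i by (intro INF_greatest) auto
    qed
    have "real_message Xs n v \<omega> = ereal (Xs v \<omega>)" if "v \<in> words1" for v
      using that
    proof (induction n arbitrary: v)
      case (Suc n)
      have "real_message Xs (Suc n) v \<omega> = (INF i\<in>{1..}. ereal (\<xi> v i \<omega>) - ereal (Xs (v @ [i]) \<omega>))"
        unfolding message.simps using Suc by (intro INF_cong) (auto simp: words1_iff)
      then show ?case using step[OF Suc.prems] by simp
    qed simp
    then show ?case by blast
  qed
qed

abbreviation star_limit :: "nat list \<Rightarrow> 'a \<Rightarrow> (nat \<Rightarrow> real) \<times> (nat \<Rightarrow> ereal)" where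
  "star_limit v \<equiv> star_of v (\<lambda>u \<omega>. ereal (Xs u \<omega>))"

lemma star_limit_AE:
  assumes "v \<in> words"
  shows "AE \<omega> in M. star_of v (real_message Xs n) \<omega> = star_limit v \<omega>"
  using Xs_fixed_point[of n]
  by eventually_elim (use assms in \<open>auto simp: star_of_def fun_eq_iff restrict_def\<close>)

lemma real_message_measurable:
  assumes "logistic_messages W" "v \<in> words1"
  shows "real_message W n v \<in> borel_measurable M"
  using assms weight_measurable logistic_messages_measurable(2)[OF assms(1)]
  by (intro measurable_message borel_measurable_ereal) (auto simp: words1_iff)

lemma star_measurable:
  assumes "logistic_messages W" "v \<in> words"
  shows "star_of v (real_message W n) \<in> M \<rightarrow>\<^sub>M star_space"
  using assms by (intro star_of_measurable real_message_measurable) auto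

lemma star_limit_measurable: "v \<in> words \<Longrightarrow> star_limit v \<in> M \<rightarrow>\<^sub>M star_space"
  using logistic_messages_measurable(2)[OF logistic_Xs]
  by (intro star_of_measurable borel_measurable_ereal) auto

text \<open>The star is a function of the truncated data, whose law is the same for all logistic
  boundary messages. Choosing \<open>Xs\<close> as boundary, the recursion reproduces
  \<open>Xs\<close> almost surely.\<close>

lemma prob_star:
  assumes W: "logistic_messages W" and v: "v \<in> words" and D: "D \<in> sets star_space"
  shows "\<P>(\<omega> in M. star_of v (real_message W n) \<omega> \<in> D) = \<P>(\<omega> in M. star_limit v \<omega> \<in> D)"
proof -
  have D': "star_functional n -` D \<inter> space (data_space (words_upto (Suc n))) \<in> sets (data_space (words_upto (Suc n)))" (is "?D \<in> _")
    using star_functional_measurable D by (rule measurable_sets)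
  have "\<P>(\<omega> in M. star_of v (real_message U n) \<omega> \<in> D) = \<P>(\<omega> in M. truncated_data v n U \<omega> \<in> ?D)"
    if "logistic_messages U" for U
    using measurable_space[OF truncated_data_measurable[OF that v]]
    by (intro arg_cong[where f = prob]) (auto simp: star_functional_truncated_data[symmetric])
  then have "\<P>(\<omega> in M. star_of v (real_message W n) \<omega> \<in> D) = \<P>(\<omega> in M. star_of v (real_message Xs n) \<omega> \<in> D)"
    using prob_truncated_data[OF W logistic_Xs v D'] W logistic_Xs by simp
  also have "\<dots> = \<P>(\<omega> in M. star_limit v \<omega> \<in> D)"
  proof (rule measure_eq_AE)
    show "AE \<omega> in M. \<omega> \<in> {\<omega> \<in> space M. star_of v (real_message Xs n) \<omega> \<in> D} \<longleftrightarrow> \<omega> \<in> {\<omega> \<in> space M. star_limit v \<omega> \<in> D}"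
      using star_limit_AE[OF v, of n] by eventually_elim auto
  qed (use sets_Collect_in[OF star_measurable[OF logistic_Xs v] D] sets_Collect_in[OF star_limit_measurable[OF v] D] in simp_all)
  finally show ?thesis .
qed

abbreviation star_change :: "(nat list \<Rightarrow> 'a \<Rightarrow> real) \<Rightarrow> nat list \<Rightarrow> nat \<Rightarrow> ((nat \<Rightarrow> real) \<times> (nat \<Rightarrow> ereal)) set \<Rightarrow> 'a set" where
  "star_change W v n D \<equiv> {\<omega> \<in> space M. (star_of v (real_message W n) \<omega> \<in> D) \<noteq> (star_limit v \<omega> \<in> D)}"

text \<open>Endogeny: an event of the limiting configuration is determined by the weights, hence up to a
  small error by the weights up to some finite depth; the error keeps its probability when the
  limiting messages at a greater depth are replaced by independent logistic ones.\<close>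

theorem star_convergence:
  assumes W: "logistic_messages W" and v: "v \<in> words" and D: "D \<in> sets star_space"
  shows "(\<lambda>n. prob (star_change W v n D)) \<longlonglongrightarrow> 0"
proof (rule LIMSEQ_I)
  fix r :: real assume r: "0 < r"
  have Pow: "finite_depth_events v \<subseteq> Pow (space M)" by (auto simp: finite_depth_events_def)
  let ?N = "sigma (space M) (finite_depth_events v)"
  let ?E = "{\<omega> \<in> space M. star_limit v \<omega> \<in> D}"
  have spN: "space ?N = space M" by (simp add: space_measure_of_conv)
  have "Xs (v @ [i]) \<in> borel_measurable ?N" if "1 \<le> i" for i
    using that v weight_measurable_finite_depth[of "i # _" _ v]
    by (intro Xs_measurable) (auto simp: space_measure_of_conv)
  moreover have "\<xi> v i \<in> borel_measurable ?N" if "1 \<le> i" for i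
    using that weight_measurable_finite_depth[of "[]" i v] by simp
  ultimately have "star_limit v \<in> ?N \<rightarrow>\<^sub>M star_space"
    unfolding star_of_def[abs_def] by (intro measurable_Pair measurable_restrict borel_measurable_ereal) auto
  then have "star_limit v -` D \<inter> space ?N \<in> sets ?N" using D by (rule measurable_sets)
  then have "?E \<in> sigma_sets (space M) (finite_depth_events v)"
    using Pow spN by (simp add: sets_measure_of vimage_def Int_def conj_commute)
  then obtain B where B: "B \<in> finite_depth_events v" "prob ((?E - B) \<union> (B - ?E)) < r / 2"
    using approximation_by_algebra[OF finite_depth_events_algebra finite_depth_events_events[OF v], of ?E "r / 2"] r by auto
  then obtain m C where C: "C \<in> sets (data_space (words_below m))" and BC: "B = {\<omega> \<in> space M. truncated_weights v m \<omega> \<in> C}"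
    by (auto simp: finite_depth_events_def)
  have Bm: "B \<in> events" using B(1) finite_depth_events_events[OF v] by blast
  have Em: "?E \<in> events"
    by (rule sets_Collect_in[OF star_limit_measurable[OF v] D])
  have "prob (star_change W v n D) < r" if n: "m \<le> n" for n
  proof -
    have sub: "words_below m \<subseteq> words_upto (Suc n)" using n by auto
    let ?R = "\<lambda>f. restrict f (words_below m)"
    \<comment> \<open>Disagreement between the star event and \<open>B\<close> is a set of truncated
      data, because \<open>m \<le> n\<close> puts the weights used by \<open>C\<close> among them.
      Its probability does not depend on the boundary messages, so \<open>Xs\<close> may stand in
      for \<open>W\<close>.\<close>
    define S where "S = {f \<in> space (data_space (words_upto (Suc n))). (star_functional n f \<in> D) \<noteq> (?R f \<in> C)}"
    let ?A = "{f \<in> space (data_space (words_upto (Suc n))). star_functional n f \<in> D}"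
    let ?B = "{f \<in> space (data_space (words_upto (Suc n))). ?R f \<in> C}"
    have "?A \<in> sets (data_space (words_upto (Suc n)))" "?B \<in> sets (data_space (words_upto (Suc n)))"
      using sets_Collect_in[OF star_functional_measurable D] sets_Collect_in[OF measurable_restrict_subset[OF sub] C]
      by simp_all
    moreover have "S = (?A - ?B) \<union> (?B - ?A)" by (auto simp: S_def)
    ultimately have S: "S \<in> sets (data_space (words_upto (Suc n)))"
      by (simp only:) (intro sets.Un sets.Diff)
    have tw: "?R (truncated_data v n U \<omega>) = truncated_weights v m \<omega>" for U \<omega>
      using n unfolding truncated_data_def truncated_weights_def vertex_data_def
      by (auto simp: fun_eq_iff restrict_def)
    let ?EW = "\<lambda>U. {\<omega> \<in> space M. star_of v (real_message U n) \<omega> \<in> D}"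
    have diff: "prob ((?EW U - B) \<union> (B - ?EW U)) = \<P>(\<omega> in M. truncated_data v n U \<omega> \<in> S)" if "logistic_messages U" for U
      using measurable_space[OF truncated_data_measurable[OF that v, of n]]
      by (intro arg_cong[where f = prob]) (auto simp: S_def tw BC star_functional_truncated_data)
    have EWm: "?EW U \<in> events" if "logistic_messages U" for U
      by (rule sets_Collect_in[OF star_measurable[OF that v] D])
    have "prob ((?EW W - B) \<union> (B - ?EW W)) = prob ((?EW Xs - B) \<union> (B - ?EW Xs))"
      using prob_truncated_data[OF W logistic_Xs v S] diff W logistic_Xs by simp
    also have "\<dots> = prob ((?E - B) \<union> (B - ?E))"
    proof (rule measure_eq_AE)
      show "AE \<omega> in M. \<omega> \<in> (?EW Xs - B) \<union> (B - ?EW Xs) \<longleftrightarrow> \<omega> \<in> (?E - B) \<union> (B - ?E)"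
        using star_limit_AE[OF v, of n] by eventually_elim auto
    qed (use EWm[OF logistic_Xs] Bm Em in auto)
    finally have eq: "prob ((?EW W - B) \<union> (B - ?EW W)) = prob ((?E - B) \<union> (B - ?E))" .
    \<comment> \<open>The star event of \<open>W\<close> and the limiting event differ from
      \<open>B\<close> with the same probability, which is below \<open>r / 2\<close>, so
      \<open>B\<close> serves as a go-between.\<close>
    have "prob (star_change W v n D)
        \<le> prob (((?EW W - B) \<union> (B - ?EW W)) \<union> ((?E - B) \<union> (B - ?E)))"
      using EWm[OF W] Bm Em by (intro finite_measure_mono) auto
    also have "\<dots> \<le> prob ((?EW W - B) \<union> (B - ?EW W)) + prob ((?E - B) \<union> (B - ?E))"
      using EWm[OF W] Bm Em by (intro measure_Un_le) auto
    finally show ?thesis using eq B(2) by simp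
  qed
  then show "\<exists>no. \<forall>n\<ge>no. norm (prob (star_change W v n D) - 0) < r"
    by auto
qed

end

section \<open>Square-integrable convergence\<close>

text \<open>Reduces a squared distance to finitely many threshold events: two numbers between
  \<open>- K\<close> and \<open>K\<close> that are more than \<open>d\<close> apart are separated by
  a grid of mesh \<open>d\<close>, and if one of them lies outside, the larger absolute value
  controls the difference.\<close>

lemma square_diff_grid_bound:
  fixes a b d K :: real
  assumes "0 < d" "0 \<le> K"
  defines "J \<equiv> nat \<lceil>2 * K / d\<rceil>"
  shows "(a - b)\<^sup>2 \<le> d\<^sup>2 + 4 * K\<^sup>2 * (\<Sum>j\<le>J. of_bool ((- K + real j * d < a) \<noteq> (- K + real j * d < b)))
    + 4 * (a\<^sup>2 * of_bool (K < \<bar>a\<bar>)) + 4 * (b\<^sup>2 * of_bool (K < \<bar>b\<bar>))"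
proof -
  define S where "S = (\<Sum>j\<le>J. of_bool ((- K + real j * d < a) \<noteq> (- K + real j * d < b)) :: real)"
  have S: "0 \<le> S" unfolding S_def by (intro sum_nonneg) auto
  have KS: "0 \<le> 4 * K\<^sup>2 * S" using S by simp
  have sq: "(a - b)\<^sup>2 \<le> 4 * (max \<bar>a\<bar> \<bar>b\<bar>)\<^sup>2"
  proof -
    have "\<bar>a - b\<bar> \<le> 2 * max \<bar>a\<bar> \<bar>b\<bar>" by auto
    then have "\<bar>a - b\<bar>\<^sup>2 \<le> (2 * max \<bar>a\<bar> \<bar>b\<bar>)\<^sup>2" by (intro power_mono) auto
    then show ?thesis by (simp add: power_mult_distrib)
  qed
  show ?thesis
  proof (cases "\<bar>a\<bar> \<le> K \<and> \<bar>b\<bar> \<le> K")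
    case False
    then have "(a - b)\<^sup>2 \<le> 4 * (a\<^sup>2 * of_bool (K < \<bar>a\<bar>)) + 4 * (b\<^sup>2 * of_bool (K < \<bar>b\<bar>))"
      using sq by (auto simp: max_def intro: add_increasing add_increasing2 split: if_splits)
    then show ?thesis using KS unfolding S_def[symmetric] by (auto intro: order_trans)
  next
    case True
    show ?thesis
    proof (cases "\<bar>a - b\<bar> \<le> d")
      case le: True
      have "\<bar>a - b\<bar>\<^sup>2 \<le> d\<^sup>2" using le by (intro power_mono) auto
      then have "(a - b)\<^sup>2 \<le> d\<^sup>2 + 4 * K\<^sup>2 * S" using KS unfolding power2_abs by linarith
      then show ?thesis using True unfolding S_def[symmetric] by simp
    next
      case gt: False
      \<comment> \<open>The first grid point at or above the smaller number. It is less than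
        \<open>d\<close> above it, hence below the larger number.\<close>
      define j where "j = nat \<lceil>(min a b + K) / d\<rceil>"
      have m0: "0 \<le> (min a b + K) / d" using True assms by auto
      have j: "(min a b + K) / d \<le> real j" "real j < (min a b + K) / d + 1"
        using m0 unfolding j_def by linarith+
      have "min a b \<le> - K + real j * d" "- K + real j * d < min a b + d"
        using j assms(1) by (auto simp: field_simps)
      then have "(- K + real j * d < a) \<noteq> (- K + real j * d < b)"
        using gt by (auto simp: min_def split: if_splits)
      moreover have "j \<le> J"
      proof -
        have "(min a b + K) / d \<le> 2 * K / d" using True assms by (intro divide_right_mono) auto
        then show ?thesis unfolding j_def J_def by (intro nat_mono ceiling_mono)
      qed
      ultimately have "1 \<le> S"
        unfolding S_def using member_le_sum[of j "{..J}" "\<lambda>j. of_bool ((- K + real j * d < a) \<noteq> (- K + real j * d < b)) :: real"]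
        by auto
      then have "4 * K\<^sup>2 * 1 \<le> 4 * K\<^sup>2 * S" by (intro mult_left_mono) auto
      moreover have "(max \<bar>a\<bar> \<bar>b\<bar>)\<^sup>2 \<le> K\<^sup>2" using True by (intro power_mono) auto
      ultimately have "(a - b)\<^sup>2 \<le> 4 * K\<^sup>2 * S" using sq by linarith
      then show ?thesis using True unfolding S_def[symmetric] by (auto intro: order_trans)
    qed
  qed
qed

context prob_space
begin

text \<open>Equal laws replace uniform integrability: the second moment of \<open>Y n\<close> beyond
  \<open>K\<close> is that of \<open>Z\<close>, hence small uniformly in \<open>n\<close>. Between
  \<open>- K\<close> and \<open>K\<close> finitely many thresholds suffice.\<close>

lemma L2_convergence_from_indicators:
  fixes Y :: "nat \<Rightarrow> 'a \<Rightarrow> real" and Z :: "'a \<Rightarrow> real"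
  assumes [measurable]: "\<And>n. Y n \<in> borel_measurable M" "Z \<in> borel_measurable M"
    and law: "\<And>n. distr M borel (Y n) = distr M borel Z"
    and Z2: "integrable M (\<lambda>\<omega>. (Z \<omega>)\<^sup>2)"
    and ind: "\<And>q. (\<lambda>n. \<P>(\<omega> in M. (q < Y n \<omega>) \<noteq> (q < Z \<omega>))) \<longlonglongrightarrow> 0"
  shows "(\<lambda>n. expectation (\<lambda>\<omega>. (Y n \<omega> - Z \<omega>)\<^sup>2)) \<longlonglongrightarrow> 0"
    and "\<And>n. integrable M (\<lambda>\<omega>. (Y n \<omega> - Z \<omega>)\<^sup>2)"
proof -
  let ?t = "\<lambda>K x :: real. x\<^sup>2 * of_bool (K < \<bar>x\<bar>)"
  have Y2: "integrable M (\<lambda>\<omega>. (Y n \<omega>)\<^sup>2)" for n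
    using integrable_distr_eq[of "Y n" M borel "\<lambda>x. x\<^sup>2"] integrable_distr_eq[of Z M borel "\<lambda>x. x\<^sup>2"] Z2 law[of n]
    by simp
  show int: "integrable M (\<lambda>\<omega>. (Y n \<omega> - Z \<omega>)\<^sup>2)" for n
  proof (rule Bochner_Integration.integrable_bound[where f = "\<lambda>\<omega>. 2 * (Y n \<omega>)\<^sup>2 + 2 * (Z \<omega>)\<^sup>2"])
    show "AE \<omega> in M. norm ((Y n \<omega> - Z \<omega>)\<^sup>2) \<le> norm (2 * (Y n \<omega>)\<^sup>2 + 2 * (Z \<omega>)\<^sup>2)"
    proof (intro AE_I2)
      fix \<omega>
      have "0 \<le> (Y n \<omega> + Z \<omega>)\<^sup>2" by simp
      then have "(Y n \<omega> - Z \<omega>)\<^sup>2 \<le> 2 * (Y n \<omega>)\<^sup>2 + 2 * (Z \<omega>)\<^sup>2"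
        by (simp add: power2_eq_square algebra_simps)
      then show "norm ((Y n \<omega> - Z \<omega>)\<^sup>2) \<le> norm (2 * (Y n \<omega>)\<^sup>2 + 2 * (Z \<omega>)\<^sup>2)"
        by simp
    qed
  qed (use Y2 Z2 in auto)
  have "(\<lambda>k. expectation (\<lambda>\<omega>. ?t (real k) (Z \<omega>))) \<longlonglongrightarrow> expectation (\<lambda>\<omega>. 0)"
  proof (rule integral_dominated_convergence[where w = "\<lambda>\<omega>. (Z \<omega>)\<^sup>2"])
    show "AE \<omega> in M. (\<lambda>k. ?t (real k) (Z \<omega>)) \<longlonglongrightarrow> 0"
    proof (intro AE_I2)
      fix \<omega>
      obtain k0 :: nat where "\<bar>Z \<omega>\<bar> < real k0" using reals_Archimedean2 by blast
      then have "eventually (\<lambda>k. ?t (real k) (Z \<omega>) = 0) sequentially"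
        by (intro eventually_sequentiallyI[of k0]) auto
      then show "(\<lambda>k. ?t (real k) (Z \<omega>)) \<longlonglongrightarrow> 0"
        by (rule tendsto_eventually)
    qed
  qed (use Z2 in \<open>auto simp: of_bool_def\<close>)
  then have tail: "(\<lambda>k. expectation (\<lambda>\<omega>. ?t (real k) (Z \<omega>))) \<longlonglongrightarrow> 0" by simp
  show "(\<lambda>n. expectation (\<lambda>\<omega>. (Y n \<omega> - Z \<omega>)\<^sup>2)) \<longlonglongrightarrow> 0"
  proof (rule LIMSEQ_I)
    fix e :: real assume e: "0 < e"
    \<comment> \<open>Three parts of \<open>e / 3\<close>: the mesh gives \<open>d\<^sup>2\<close>,
      the threshold events stay below the second part, and the two tail terms with factor 4 stay
      below \<open>8 * e / 24\<close>.\<close>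
    define d where "d = sqrt (e / 3)"
    have d: "0 < d" "d\<^sup>2 = e / 3" using e by (auto simp: d_def)
    have "eventually (\<lambda>k. expectation (\<lambda>\<omega>. ?t (real k) (Z \<omega>)) < e / 24) sequentially"
      using e by (intro order_tendstoD(2)[OF tail]) auto
    then obtain k where k: "expectation (\<lambda>\<omega>. ?t (real k) (Z \<omega>)) < e / 24"
      by (auto simp: eventually_sequentially)
    define K where "K = real k"
    define J where "J = nat \<lceil>2 * K / d\<rceil>"
    define q where "q j = - K + real j * d" for j
    let ?b = "\<lambda>n j \<omega>. of_bool ((q j < Y n \<omega>) \<noteq> (q j < Z \<omega>)) :: real"
    let ?P = "\<lambda>n j. \<P>(\<omega> in M. (q j < Y n \<omega>) \<noteq> (q j < Z \<omega>))"
    have "(\<lambda>n. 4 * K\<^sup>2 * (\<Sum>j\<le>J. ?P n j)) \<longlonglongrightarrow> 4 * K\<^sup>2 * (\<Sum>j\<le>J. 0)"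
      by (intro tendsto_intros ind)
    then have "eventually (\<lambda>n. 4 * K\<^sup>2 * (\<Sum>j\<le>J. ?P n j) < e / 3) sequentially"
      using e by (intro order_tendstoD(2)) auto
    then obtain N where N: "\<And>n. N \<le> n \<Longrightarrow> 4 * K\<^sup>2 * (\<Sum>j\<le>J. ?P n j) < e / 3"
      by (auto simp: eventually_sequentially)
    have "expectation (\<lambda>\<omega>. (Y n \<omega> - Z \<omega>)\<^sup>2) < e" if n: "N \<le> n" for n
    proof -
      have tailY: "expectation (\<lambda>\<omega>. ?t K (Y n \<omega>)) = expectation (\<lambda>\<omega>. ?t K (Z \<omega>))"
        using integral_distr[of "Y n" M borel "\<lambda>x. ?t K x"] integral_distr[of Z M borel "\<lambda>x. ?t K x"] law[of n]
        by (simp add: of_bool_def)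
      have iZ: "integrable M (\<lambda>\<omega>. ?t K (U \<omega>))" if [measurable]: "U \<in> borel_measurable M" and "integrable M (\<lambda>\<omega>. (U \<omega>)\<^sup>2)" for U
        by (rule Bochner_Integration.integrable_bound[OF that(2)]) (auto simp: of_bool_def)
      have iP: "integrable M (\<lambda>\<omega>. ?b n j \<omega> :: real)" for j
        by (rule integrable_const_bound[where B = 1]) (auto simp: of_bool_def)
      have eP: "expectation (\<lambda>\<omega>. ?b n j \<omega>) = ?P n j" for j
      proof -
        have "expectation (\<lambda>\<omega>. ?b n j \<omega>) = expectation (indicator {\<omega> \<in> space M. (q j < Y n \<omega>) \<noteq> (q j < Z \<omega>)})"
          by (intro Bochner_Integration.integral_cong) (auto simp: indicator_def)
        also have "\<dots> = ?P n j" by (subst Bochner_Integration.integral_indicator) (auto intro!: arg_cong[where f = prob])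
        finally show ?thesis .
      qed
      have lin: "expectation (\<lambda>\<omega>. c + k * (\<Sum>j\<le>J. f j \<omega>) + 4 * g \<omega> + 4 * h \<omega>) =
          c + k * (\<Sum>j\<le>J. expectation (\<lambda>\<omega>. f j \<omega>)) + 4 * expectation g + 4 * expectation h"
        if "\<And>j. integrable M (\<lambda>\<omega>. f j \<omega>)" "integrable M g" "integrable M h"
        for c k and f :: "nat \<Rightarrow> 'a \<Rightarrow> real" and g h
        using that by (simp add: prob_space)
      have "expectation (\<lambda>\<omega>. (Y n \<omega> - Z \<omega>)\<^sup>2) \<le> expectation (\<lambda>\<omega>. d\<^sup>2 + 4 * K\<^sup>2 * (\<Sum>j\<le>J. ?b n j \<omega>)
          + 4 * (?t K (Y n \<omega>)) + 4 * (?t K (Z \<omega>)))"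
      proof (rule integral_mono[OF int])
        show "integrable M (\<lambda>\<omega>. d\<^sup>2 + 4 * K\<^sup>2 * (\<Sum>j\<le>J. ?b n j \<omega>)
          + 4 * (?t K (Y n \<omega>)) + 4 * (?t K (Z \<omega>)))"
          using iZ Y2 Z2 by (intro Bochner_Integration.integrable_add integrable_mult_right Bochner_Integration.integrable_sum iP) auto
        show "(Y n \<omega> - Z \<omega>)\<^sup>2 \<le> d\<^sup>2 + 4 * K\<^sup>2 * (\<Sum>j\<le>J. ?b n j \<omega>)
          + 4 * (?t K (Y n \<omega>)) + 4 * (?t K (Z \<omega>))" for \<omega>
          unfolding q_def J_def using square_diff_grid_bound[of d K "Y n \<omega>" "Z \<omega>"] d by (simp add: K_def)
      qed
      also have "\<dots> = d\<^sup>2 + 4 * K\<^sup>2 * (\<Sum>j\<le>J. ?P n j) + 4 * expectation (\<lambda>\<omega>. ?t K (Y n \<omega>))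
          + 4 * expectation (\<lambda>\<omega>. ?t K (Z \<omega>))"
        using iZ[OF _ Y2[of n]] iZ[OF _ Z2] iP by (subst lin) (simp_all only: eP assms(1,2))
      also have "\<dots> < e"
        using k[folded K_def] N[OF n] d(2) tailY by linarith
      finally show ?thesis .
    qed
    moreover have "0 \<le> expectation (\<lambda>\<omega>. (Y n \<omega> - Z \<omega>)\<^sup>2)" for n
      by (rule integral_nonneg_AE) auto
    ultimately show "\<exists>no. \<forall>n\<ge>no. norm (expectation (\<lambda>\<omega>. (Y n \<omega> - Z \<omega>)\<^sup>2) - 0) < e"
      by (intro exI[of _ N]) auto
  qed
qed

text \<open>A sum over layers: \<open>n\<^sup>2\<close> is at most the sum of
  \<open>2 * (k + 1)\<close> over \<open>k < n\<close>, and \<open>\<bar>Z\<bar>\<close> exceeds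
  \<open>k\<close> with probability at most \<open>2 * exp (- k)\<close>. What remains is the
  derivative of a geometric series.\<close>

lemma logistic_square_integrable:
  fixes Z :: "'a \<Rightarrow> real"
  assumes [measurable]: "Z \<in> borel_measurable M"
    and Z: "\<And>x. \<P>(\<omega> in M. x < Z \<omega>) = logis 0 x"
  shows "integrable M (\<lambda>\<omega>. (Z \<omega>)\<^sup>2)"
proof (rule integrableI_nonneg)
  have tail: "\<P>(\<omega> in M. real k < \<bar>Z \<omega>\<bar>) \<le> 2 * exp (- 1) ^ k" for k
  proof -
    have exp_k: "exp (- real k) = exp (- 1) ^ k" by (simp add: exp_of_nat_mult[symmetric])
    have "\<P>(\<omega> in M. real k < \<bar>Z \<omega>\<bar>) \<le> prob ({\<omega> \<in> space M. real k < Z \<omega>} \<union> (space M - {\<omega> \<in> space M. - real k < Z \<omega>}))"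
      by (intro finite_measure_mono) auto
    also have "\<dots> \<le> \<P>(\<omega> in M. real k < Z \<omega>) + prob (space M - {\<omega> \<in> space M. - real k < Z \<omega>})"
      by (intro measure_Un_le) auto
    also have "\<dots> = logis 0 (real k) + (1 - logis 0 (- real k))"
      by (simp add: prob_compl Z)
    also have "logis 0 (real k) \<le> exp (- real k)"
      by (simp add: logis_def exp_minus divide_simps add_pos_pos)
    also have "1 - logis 0 (- real k) \<le> exp (- real k)"
    proof -
      have "0 < 1 + exp (- real k)" by (simp add: add_pos_pos)
      then show ?thesis by (simp add: logis_def field_simps)
    qed
    finally show ?thesis by (simp add: exp_k)
  qed
  have "(\<integral>\<^sup>+\<omega>. ennreal ((Z \<omega>)\<^sup>2) \<partial>M) \<le> (\<integral>\<^sup>+\<omega>. (\<Sum>k. ennreal (2 * real (Suc k)) * indicator {\<omega> \<in> space M. real k < \<bar>Z \<omega>\<bar>} \<omega>) \<partial>M)"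
  proof (rule nn_integral_mono)
    fix \<omega> assume \<omega>: "\<omega> \<in> space M"
    define n where "n = nat \<lceil>\<bar>Z \<omega>\<bar>\<rceil>"
    have n: "\<bar>Z \<omega>\<bar> \<le> real n" unfolding n_def by linarith
    have lt: "real k < \<bar>Z \<omega>\<bar>" if "k < n" for k using that unfolding n_def by linarith
    have "\<bar>Z \<omega>\<bar>\<^sup>2 \<le> (real n)\<^sup>2" using n by (intro power_mono) auto
    also have "(real n)\<^sup>2 \<le> (\<Sum>k<n. 2 * real (Suc k))"
      by (induction n) (auto simp: power2_eq_square algebra_simps)
    finally have "ennreal ((Z \<omega>)\<^sup>2) \<le> ennreal (\<Sum>k<n. 2 * real (Suc k))" by (simp add: ennreal_leI)
    also have "\<dots> = (\<Sum>k<n. ennreal (2 * real (Suc k)))" by (subst sum_ennreal) auto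
    also have "\<dots> = (\<Sum>k<n. ennreal (2 * real (Suc k)) * indicator {\<omega> \<in> space M. real k < \<bar>Z \<omega>\<bar>} \<omega>)"
      using lt \<omega> by (intro sum.cong) auto
    also have "\<dots> \<le> (\<Sum>k. ennreal (2 * real (Suc k)) * indicator {\<omega> \<in> space M. real k < \<bar>Z \<omega>\<bar>} \<omega>)"
      by (rule sum_le_suminf) auto
    finally show "ennreal ((Z \<omega>)\<^sup>2) \<le> (\<Sum>k. ennreal (2 * real (Suc k)) * indicator {\<omega> \<in> space M. real k < \<bar>Z \<omega>\<bar>} \<omega>)" .
  qed
  also have "\<dots> = (\<Sum>k. \<integral>\<^sup>+\<omega>. ennreal (2 * real (Suc k)) * indicator {\<omega> \<in> space M. real k < \<bar>Z \<omega>\<bar>} \<omega> \<partial>M)"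
    by (rule nn_integral_suminf) measurable
  also have "\<dots> \<le> (\<Sum>k. ennreal (4 * (real (Suc k) * exp (- 1) ^ k)))"
  proof (intro suminf_le)
    fix k
    have "(\<integral>\<^sup>+\<omega>. ennreal (2 * real (Suc k)) * indicator {\<omega> \<in> space M. real k < \<bar>Z \<omega>\<bar>} \<omega> \<partial>M) = ennreal (2 * real (Suc k)) * emeasure M {\<omega> \<in> space M. real k < \<bar>Z \<omega>\<bar>}"
      by (rule nn_integral_cmult_indicator) measurable
    also have "\<dots> = ennreal (2 * real (Suc k) * \<P>(\<omega> in M. real k < \<bar>Z \<omega>\<bar>))"
      by (simp only: emeasure_eq_measure) (rule ennreal_mult'[symmetric], simp)
    also have "\<dots> \<le> ennreal (2 * real (Suc k) * (2 * exp (- 1) ^ k))"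
      using tail by (intro ennreal_leI mult_left_mono) auto
    also have "2 * real (Suc k) * (2 * exp (- 1) ^ k) = 4 * (real (Suc k) * exp (- 1) ^ k)" by simp
    finally show "(\<integral>\<^sup>+\<omega>. ennreal (2 * real (Suc k)) * indicator {\<omega> \<in> space M. real k < \<bar>Z \<omega>\<bar>} \<omega> \<partial>M) \<le> ennreal (4 * (real (Suc k) * exp (- 1) ^ k))" .
  qed auto
  also have "\<dots> = ennreal (4 * (1 / (1 - exp (- 1))\<^sup>2))"
    using geometric_deriv_sums[of "exp (- 1 :: real)"]
    by (intro suminf_ennreal_eq sums_mult) auto
  also have "\<dots> < \<infinity>" by simp
  finally show "(\<integral>\<^sup>+\<omega>. ennreal ((Z \<omega>)\<^sup>2) \<partial>M) < \<infinity>" .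
qed auto

text \<open>Given the value of \<open>C\<close>, hitting it is a null event for \<open>X\<close>;
  Fubini does the rest. Its use is to exclude ties in the arg min.\<close>

lemma prob_eq_indep_no_atoms:
  fixes C X :: "'a \<Rightarrow> ereal"
  assumes iv: "indep_var borel C borel X" and X: "\<And>c. \<P>(\<omega> in M. X \<omega> = c) = 0"
  shows "AE \<omega> in M. X \<omega> \<noteq> C \<omega>"
proof -
  have [measurable]: "C \<in> borel_measurable M" "X \<in> borel_measurable M"
    using iv by (auto dest: indep_var_rv1 indep_var_rv2)
  interpret DX: prob_space "distr M borel X" by (rule prob_space_distr) simp
  let ?A = "{p :: ereal \<times> ereal. fst p = snd p}"
  have A: "?A \<in> sets (borel \<Otimes>\<^sub>M borel)"
  proof -
    have "{p \<in> space (borel \<Otimes>\<^sub>M borel). (fst p :: ereal) = snd p} \<in> sets (borel \<Otimes>\<^sub>M borel)" by measurable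
    then show ?thesis by (simp add: space_pair_measure)
  qed
  have "emeasure M {\<omega> \<in> space M. C \<omega> = X \<omega>} = emeasure (distr M (borel \<Otimes>\<^sub>M borel) (\<lambda>\<omega>. (C \<omega>, X \<omega>))) ?A"
    using A by (subst emeasure_distr) (auto intro!: arg_cong[where f = "emeasure M"])
  also have "\<dots> = emeasure (distr M borel C \<Otimes>\<^sub>M distr M borel X) ?A"
    using iv by (simp add: indep_var_distribution_eq)
  also have "\<dots> = (\<integral>\<^sup>+c. emeasure (distr M borel X) (Pair c -` ?A) \<partial>distr M borel C)"
    using A by (intro DX.emeasure_pair_measure_alt) simp
  also have "\<dots> = (\<integral>\<^sup>+c. 0 \<partial>distr M borel C)"
  proof (rule nn_integral_cong)
    fix c
    have "Pair c -` ?A = {c}" by auto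
    moreover have "X -` {c} \<inter> space M = {\<omega> \<in> space M. X \<omega> = c}" by auto
    ultimately show "emeasure (distr M borel X) (Pair c -` ?A) = 0"
      using X[of c] by (simp add: emeasure_distr emeasure_eq_measure)
  qed
  finally have "emeasure M {\<omega> \<in> space M. C \<omega> = X \<omega>} = 0" by simp
  then show ?thesis
    by (intro AE_I[where N = "{\<omega> \<in> space M. C \<omega> = X \<omega>}"]) auto
qed

end

section \<open>Coupling with logistic messages\<close>

lemma nn_integral_Ico_le:
  fixes x :: ereal
  shows "(\<integral>\<^sup>+t. indicator {t. 0 \<le> t \<and> ereal t < x} t \<partial>lborel) \<le> e2ennreal (max 0 x)"
proof (cases x)
  case (real r)
  show ?thesis
  proof (cases "0 \<le> r")
    case True
    have "{t. 0 \<le> t \<and> ereal t < x} = {0..<r}" using real by auto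
    then show ?thesis using real True by (simp add: max_def)
  next
    case False
    then have "{t. 0 \<le> t \<and> ereal t < x} = {}" using real by auto
    then show ?thesis by simp
  qed
next
  case PInf
  then show ?thesis by simp
next
  case MInf
  then have "{t. 0 \<le> t \<and> ereal t < x} = {}" by auto
  then show ?thesis by simp
qed

text \<open>The layer-cake formula, through which the finite mean of the positive part becomes
  integrability of the tail function.\<close>

lemma (in prob_space) nn_integral_tail_le:
  fixes X :: "'a \<Rightarrow> ereal"
  assumes [measurable]: "X \<in> borel_measurable M"
  shows "(\<integral>\<^sup>+t. indicator {0..} t * emeasure M {\<omega> \<in> space M. ereal t < X \<omega>} \<partial>lborel) \<le> (\<integral>\<^sup>+\<omega>. e2ennreal (max 0 (X \<omega>)) \<partial>M)"
proof -
  interpret pair_sigma_finite M lborel ..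
  let ?f = "\<lambda>\<omega> t. indicator {t. 0 \<le> t \<and> ereal t < X \<omega>} t :: ennreal"
  have [measurable]: "(\<lambda>(\<omega>, t). ?f \<omega> t) \<in> borel_measurable (M \<Otimes>\<^sub>M lborel)"
  proof -
    have "(\<lambda>p. if 0 \<le> snd p \<and> ereal (snd p) < X (fst p) then 1 else 0 :: ennreal) \<in> borel_measurable (M \<Otimes>\<^sub>M lborel)"
      by measurable
    then show ?thesis by (simp add: case_prod_beta' indicator_def of_bool_def)
  qed
  have "(\<integral>\<^sup>+t. indicator {0..} t * emeasure M {\<omega> \<in> space M. ereal t < X \<omega>} \<partial>lborel) = (\<integral>\<^sup>+t. \<integral>\<^sup>+\<omega>. ?f \<omega> t \<partial>M \<partial>lborel)"
  proof (rule nn_integral_cong)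
    fix t :: real
    have "(\<integral>\<^sup>+\<omega>. ?f \<omega> t \<partial>M) = (\<integral>\<^sup>+\<omega>. indicator {0..} t * indicator {\<omega> \<in> space M. ereal t < X \<omega>} \<omega> \<partial>M)"
      by (rule nn_integral_cong) (auto simp: indicator_def)
    also have "\<dots> = indicator {0..} t * emeasure M {\<omega> \<in> space M. ereal t < X \<omega>}"
      by (rule nn_integral_cmult_indicator) measurable
    finally show "indicator {0..} t * emeasure M {\<omega> \<in> space M. ereal t < X \<omega>} = (\<integral>\<^sup>+\<omega>. ?f \<omega> t \<partial>M)" by simp
  qed
  also have "\<dots> = (\<integral>\<^sup>+\<omega>. \<integral>\<^sup>+t. ?f \<omega> t \<partial>lborel \<partial>M)"
    by (rule Fubini') measurable
  also have "\<dots> \<le> (\<integral>\<^sup>+\<omega>. e2ennreal (max 0 (X \<omega>)) \<partial>M)"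
    by (intro nn_integral_mono nn_integral_Ico_le)
  finally show ?thesis .
qed

text \<open>Taking the minimum of weights minus messages reverses order and turns an added constant
  into its negative. A band of half-width \<open>l\<close> thus keeps its width, while its centre
  alternates between \<open>c\<close> and \<open>- c\<close>.\<close>

lemma message_shift_bounds:
  fixes c l :: real
  assumes "\<And>u. u \<in> words1 \<Longrightarrow> ereal (W u \<omega>) + ereal (c - l) \<le> Y u \<omega> \<and> Y u \<omega> \<le> ereal (W u \<omega>) + ereal (c + l)"
    and "v \<in> words1"
  shows "message \<xi> (\<lambda>u \<omega>. ereal (W u \<omega>)) n v \<omega> + ereal ((- 1) ^ n * c - l) \<le> message \<xi> Y n v \<omega> \<and>
    message \<xi> Y n v \<omega> \<le> message \<xi> (\<lambda>u \<omega>. ereal (W u \<omega>)) n v \<omega> + ereal ((- 1) ^ n * c + l)"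
  using assms(2)
proof (induction n arbitrary: v)
  case 0
  then show ?case using assms(1)[of v] by simp
next
  case (Suc n)
  let ?W = "\<lambda>i. message \<xi> (\<lambda>u \<omega>. ereal (W u \<omega>)) n (v @ [i]) \<omega>"
  let ?Y = "\<lambda>i. message \<xi> Y n (v @ [i]) \<omega>"
  let ?s = "(- 1) ^ n * c"
  have IH: "?W i + ereal (?s - l) \<le> ?Y i" "?Y i \<le> ?W i + ereal (?s + l)" if "1 \<le> i" for i
    using Suc.IH[of "v @ [i]"] Suc.prems that by (auto simp: words1_iff)
  have e1: "ereal x - a + ereal (- t) \<le> ereal x - b" if "b \<le> a + ereal t" for x t and a b :: ereal
    using that by (cases a; cases b) auto
  have e2: "ereal x - b \<le> ereal x - a + ereal (- t)" if "a + ereal t \<le> b" for x t and a b :: ereal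
    using that by (cases a; cases b) auto
  have e3: "a \<le> b + ereal (- t)" if "a + ereal t \<le> b" for t and a b :: ereal
    using that by (cases a; cases b) auto
  have INF_add: "(INF i\<in>{1..}. ereal (\<xi> v i \<omega>) - a i) + ereal t \<le> (INF i\<in>{1..}. ereal (\<xi> v i \<omega>) - b i)"
    if "\<And>i. 1 \<le> i \<Longrightarrow> ereal (\<xi> v i \<omega>) - a i + ereal t \<le> ereal (\<xi> v i \<omega>) - b i" for a b :: "nat \<Rightarrow> ereal" and t
    using that by (intro INF_greatest) (auto intro!: order_trans[OF add_right_mono[OF INF_lower]])
  have "(INF i\<in>{1..}. ereal (\<xi> v i \<omega>) - ?W i) + ereal (- (?s + l)) \<le> (INF i\<in>{1..}. ereal (\<xi> v i \<omega>) - ?Y i)"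
    by (intro INF_add e1 IH)
  moreover have "(INF i\<in>{1..}. ereal (\<xi> v i \<omega>) - ?Y i) + ereal (?s - l) \<le> (INF i\<in>{1..}. ereal (\<xi> v i \<omega>) - ?W i)"
  proof (rule INF_add)
    fix i :: nat assume "1 \<le> i"
    then show "ereal (\<xi> v i \<omega>) - ?Y i + ereal (?s - l) \<le> ereal (\<xi> v i \<omega>) - ?W i"
      using IH(1)[of i] by (cases "?W i"; cases "?Y i") auto
  qed
  then have "(INF i\<in>{1..}. ereal (\<xi> v i \<omega>) - ?Y i) \<le> (INF i\<in>{1..}. ereal (\<xi> v i \<omega>) - ?W i) + ereal (- (?s - l))"
    by (rule e3)
  moreover have "(- 1) ^ Suc n * c - l = - (?s + l)" "(- 1) ^ Suc n * c + l = - (?s - l)" by simp_all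
  ultimately show ?case unfolding message.simps by simp
qed

text \<open>From the second iterate on the tail is continuous, and strictly decreasing because the
  previous iterate is positive everywhere; the sandwich supplies the end points for the intermediate
  value theorem. The logit of the tail is then increasing in \<open>x\<close> and crosses the level
  \<open>q\<close> exactly at \<open>x0\<close>.\<close>

lemma tail_seq_logistic_inverse:
  assumes F: "tail_function F" and s: "sandwiched a b (tail_seq F k)" and k: "2 \<le> k"
  shows "\<exists>x0. tail_seq F k x0 = logis 0 q \<and> (\<forall>x. q < ln ((1 - tail_seq F k x) / tail_seq F k x) \<longleftrightarrow> x0 < x)"
proof -
  obtain j where j: "k = Suc (Suc j)" using k by (metis add_2_eq_Suc le_Suc_ex)
  let ?G = "tail_seq F (Suc j)"
  let ?H = "tail_seq F k"
  have H: "?H = rde ?G" by (simp add: j)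
  have G: "tail_function ?G" by (rule tail_function_tail_seq[OF F])
  have Gpos: "0 < ?G x" for x
    using rde_bounds[OF tail_function_tail_seq[OF F]] by simp
  have strict: "?H y < ?H x" if "x < y" for x y
  proof -
    have "0 < (y - x) * ?G (- x)" using that Gpos[of "-x"] by simp
    also have "\<dots> \<le> tail_integral ?G (- y) - tail_integral ?G (- x)"
      using tail_integral_diff_bounds(1)[OF G, of "-y" "-x"] that by simp
    finally show ?thesis unfolding H rde_def by simp
  qed
  have "\<exists>x\<ge>q + a. x \<le> q + b \<and> ?H x = logis 0 q"
  proof (rule IVT2)
    show "?H (q + b) \<le> logis 0 q"
      using s[unfolded sandwiched_def, rule_format, of "q + b"] logis_shift[of 0 b q] by simp
    show "logis 0 q \<le> ?H (q + a)"
      using s[unfolded sandwiched_def, rule_format, of "q + a"] logis_shift[of 0 a q] by simp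
    show "q + a \<le> q + b" using sandwiched_le[OF s] by simp
    show "\<forall>x. q + a \<le> x \<and> x \<le> q + b \<longrightarrow> isCont ?H x"
      unfolding H using rde_continuous[OF G] by blast
  qed
  then obtain x0 where x0: "?H x0 = logis 0 q" by blast
  have "q < ln ((1 - ?H x) / ?H x) \<longleftrightarrow> x0 < x" for x
  proof -
    have h: "0 < ?H x" "?H x < 1"
      using s logis_pos[of a x] logis_less_1[of b x] unfolding sandwiched_def by (meson less_le_trans le_less_trans)+
    have "q < ln ((1 - ?H x) / ?H x) \<longleftrightarrow> exp q < (1 - ?H x) / ?H x"
      using h by (metis diff_gt_0_iff_gt divide_pos_pos exp_gt_zero ln_exp ln_less_cancel_iff)
    also have "\<dots> \<longleftrightarrow> ?H x < logis 0 q"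
      using h add_pos_pos[OF zero_less_one exp_gt_zero[of q]] by (simp add: logis_def field_simps)
    also have "\<dots> \<longleftrightarrow> x0 < x"
      unfolding x0[symmetric] using strict[of x0 x] strict[of x x0] by (cases x x0 rule: linorder_cases) auto
    finally show ?thesis .
  qed
  then show ?thesis using x0 by blast
qed

text \<open>Reads the sandwich horizontally: \<open>ln ((1 - h) / h)\<close> is the point where
  \<open>logis 0\<close> takes the value \<open>h\<close>, so vertical bounds by two shifted tails
  become bounds on \<open>x\<close>.\<close>

lemma logit_bounds:
  assumes "logis a x \<le> h" "h \<le> logis b x"
  shows "ln ((1 - h) / h) + a \<le> x" "x \<le> ln ((1 - h) / h) + b"
proof -
  have h: "0 < h" "h < 1"
    using assms logis_pos[of a x] logis_less_1[of b x] by linarith+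
  have p: "0 < 1 + exp (x - t)" for t by (simp add: add_pos_pos)
  have "(1 - h) / h \<le> exp (x - a)"
    using assms(1) h p[of a] by (simp add: logis_def field_simps)
  then have "ln ((1 - h) / h) \<le> ln (exp (x - a))" using h by (subst ln_le_cancel_iff) auto
  then show "ln ((1 - h) / h) + a \<le> x" by simp
  have "exp (x - b) \<le> (1 - h) / h"
    using assms(2) h p[of b] by (simp add: logis_def field_simps)
  then have "ln (exp (x - b)) \<le> ln ((1 - h) / h)" using h by (subst ln_le_cancel_iff) auto
  then show "x \<le> ln ((1 - h) / h) + b" by simp
qed

section \<open>Tails of the messages and their quantile coupling\<close>

context pwit_messages
begin

definition initial_tail :: "real \<Rightarrow> real" where
  "initial_tail x = \<P>(\<omega> in M. ereal x < X0 [1] \<omega>)"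

lemma one_in_words1 [simp]: "[1] \<in> words1"
  by (simp add: words1_iff)

lemma prob_X0: "v \<in> words1 \<Longrightarrow> \<P>(\<omega> in M. ereal x < X0 v \<omega>) = initial_tail x"
proof -
  assume v: "v \<in> words1"
  have "\<P>(\<omega> in M. ereal x < X0 u \<omega>) = measure (distr M borel (X0 u)) {ereal x<..}" if "u \<in> words1" for u
    using X0_measurable[OF that] by (subst measure_distr) (auto intro!: arg_cong[where f = prob])
  moreover have "distr M borel (X0 v) = distr M borel (X0 [1])"
    using init v one_in_words1 unfolding initial_messages_def by blast
  ultimately show ?thesis using v by (simp add: initial_tail_def)
qed

lemma tail_function_initial: "tail_function initial_tail"
  unfolding tail_function_def
proof (intro conjI allI)
  have [measurable]: "X0 [1] \<in> borel_measurable M" by (rule X0_measurable) simp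
  show am: "antimono initial_tail"
    unfolding antimono_def initial_tail_def
    by (auto intro!: finite_measure_mono elim!: le_less_trans[rotated])
  show "0 \<le> initial_tail x" "initial_tail x \<le> 1" for x by (auto simp: initial_tail_def)
  obtain x :: real where "initial_tail x \<noteq> 0"
    using init one_in_words1 unfolding initial_messages_def initial_tail_def by blast
  then show "\<exists>x. 0 < initial_tail x"
    by (intro exI[of _ x]) (auto simp: initial_tail_def zero_less_measure_iff)
  have [measurable]: "initial_tail \<in> borel_measurable borel" by (rule borel_measurable_antimono[OF am])
  have "(\<integral>\<^sup>+t. ennreal (indicator {0..} t *\<^sub>R initial_tail t) \<partial>lborel) =
      (\<integral>\<^sup>+t. indicator {0..} t * emeasure M {\<omega> \<in> space M. ereal t < X0 [1] \<omega>} \<partial>lborel)"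
    by (rule nn_integral_cong) (auto simp: initial_tail_def emeasure_eq_measure split: split_indicator)
  also have "\<dots> \<le> (\<integral>\<^sup>+\<omega>. e2ennreal (max 0 (X0 [1] \<omega>)) \<partial>M)"
    by (rule nn_integral_tail_le) measurable
  also have "\<dots> < \<infinity>"
    using init one_in_words1 unfolding initial_messages_def by blast
  finally show "set_integrable lborel {0..} initial_tail"
    unfolding set_integrable_def
    by (intro integrableI_nonneg) (auto simp: initial_tail_def intro!: AE_I2)
qed

lemma prob_message: "v \<in> words1 \<Longrightarrow> \<P>(\<omega> in M. ereal x < message \<xi> X0 k v \<omega>) = tail_seq initial_tail k x"
proof (induction k arbitrary: v x)
  case 0
  then show ?case by (simp add: prob_X0)
next
  case (Suc k)
  have v: "v \<in> words" using Suc.prems by (simp add: words1_iff)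
  show ?case
    unfolding message.simps tail_seq_Suc
  proof (rule prob_children_INF[OF v])
    fix i :: nat assume i: "1 \<le> i"
    show "message \<xi> X0 k (v @ [i]) \<in> borel_measurable (block (descendants (v @ [i])))"
      using v i by (intro message_measurable_block) auto
  next
    fix i :: nat and x assume i: "1 \<le> i"
    show "\<P>(\<omega> in M. ereal x < message \<xi> X0 k (v @ [i]) \<omega>) = tail_seq initial_tail k x"
      using v i by (intro Suc.IH) simp
  qed (rule tail_function_tail_seq[OF tail_function_initial])
qed

lemma logis_tendsto: "(\<lambda>n. logis t (real n)) \<longlonglongrightarrow> 0" "(\<lambda>n. logis t (- real n)) \<longlonglongrightarrow> 1"
proof -
  show "(\<lambda>n. logis t (real n)) \<longlonglongrightarrow> 0" unfolding logis_def by real_asymp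
  show "(\<lambda>n. logis t (- real n)) \<longlonglongrightarrow> 1" unfolding logis_def by real_asymp
qed

lemma message_finite:
  assumes s: "sandwiched a b (tail_seq initial_tail k)"
  shows "AE \<omega> in M. \<forall>v\<in>words1. \<bar>message \<xi> X0 k v \<omega>\<bar> \<noteq> \<infinity>"
proof (rule AE_ball_countable')
  fix v assume v: "v \<in> words1"
  let ?X = "message \<xi> X0 k v"
  have [measurable]: "?X \<in> borel_measurable M" by (rule message_measurable[OF v])
  have "\<P>(\<omega> in M. ?X \<omega> = \<infinity>) \<le> logis b (real n)" for n :: nat
  proof -
    have "\<P>(\<omega> in M. ?X \<omega> = \<infinity>) \<le> \<P>(\<omega> in M. ereal (real n) < ?X \<omega>)"
      by (intro finite_measure_mono) auto
    also have "\<dots> \<le> logis b (real n)"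
      unfolding prob_message[OF v] using s by (simp add: sandwiched_def)
    finally show ?thesis .
  qed
  then have "\<P>(\<omega> in M. ?X \<omega> = \<infinity>) \<le> 0"
    by (intro LIMSEQ_le_const[OF logis_tendsto(1)[of b]]) auto
  then have 1: "AE \<omega> in M. ?X \<omega> \<noteq> \<infinity>"
    by (intro AE_I[where N = "{\<omega> \<in> space M. ?X \<omega> = \<infinity>}"]) (auto simp: emeasure_eq_measure measure_le_0_iff)
  have "\<P>(\<omega> in M. ?X \<omega> = - \<infinity>) \<le> 1 - logis a (- real n)" for n :: nat
  proof -
    have "\<P>(\<omega> in M. ?X \<omega> = - \<infinity>) \<le> prob (space M - {\<omega> \<in> space M. ereal (- real n) < ?X \<omega>})"
      by (intro finite_measure_mono) auto
    also have "\<dots> \<le> 1 - logis a (- real n)"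
      using s prob_message[OF v, of "- real n" k] by (simp add: sandwiched_def prob_compl)
    finally show ?thesis .
  qed
  moreover have "(\<lambda>n. 1 - logis a (- real n)) \<longlonglongrightarrow> 1 - 1"
    by (intro tendsto_intros logis_tendsto)
  ultimately have "\<P>(\<omega> in M. ?X \<omega> = - \<infinity>) \<le> 1 - 1"
    by (intro LIMSEQ_le_const[of "\<lambda>n. 1 - logis a (- real n)"]) auto
  then have 2: "AE \<omega> in M. ?X \<omega> \<noteq> - \<infinity>"
    by (intro AE_I[where N = "{\<omega> \<in> space M. ?X \<omega> = - \<infinity>}"]) (auto simp: emeasure_eq_measure measure_le_0_iff)
  from 1 2 show "AE \<omega> in M. \<bar>?X \<omega>\<bar> \<noteq> \<infinity>" by eventually_elim auto
qed (rule countable_subset[OF subset_UNIV], simp)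

text \<open>Quantile coupling of the messages after \<open>k\<close> rounds with logistic ones.\<close>

definition coupled_message :: "nat \<Rightarrow> nat list \<Rightarrow> 'a \<Rightarrow> real" where
  "coupled_message k v \<omega> = (let h = tail_seq initial_tail k (real_of_ereal (message \<xi> X0 k v \<omega>)) in ln ((1 - h) / h))"

text \<open>Exceeding \<open>q\<close> is the same as the original message exceeding the point
  \<open>x0\<close> where its tail equals \<open>logis 0 q\<close>. Locality is inherited, as only
  the message from \<open>v\<close> itself is transformed.\<close>

lemma coupled_message_logistic:
  assumes s: "sandwiched a b (tail_seq initial_tail k)" and k: "2 \<le> k"
  shows "logistic_messages (coupled_message k)"
  unfolding logistic_messages_def
proof (intro ballI conjI allI)
  fix v assume v: "v \<in> words1"
  let ?X = "message \<xi> X0 k v"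
  have [measurable]: "tail_seq initial_tail k \<in> borel_measurable borel"
    by (rule tail_function_measurable[OF tail_function_tail_seq[OF tail_function_initial]])
  have [measurable]: "?X \<in> borel_measurable (block (descendants v))"
    using v by (intro message_measurable_block) (auto simp: words1_iff)
  show "coupled_message k v \<in> borel_measurable (block (descendants v))"
    unfolding coupled_message_def[abs_def] Let_def by measurable
  then have [measurable]: "coupled_message k v \<in> borel_measurable M"
    using v descendants_subset_words[of v] by (intro measurable_block[of _ "descendants v"]) (auto simp: words1_iff)
  have [measurable]: "?X \<in> borel_measurable M" by (rule message_measurable[OF v])
  fix q
  obtain x0 where x0: "tail_seq initial_tail k x0 = logis 0 q"
    "\<And>x. q < ln ((1 - tail_seq initial_tail k x) / tail_seq initial_tail k x) \<longleftrightarrow> x0 < x"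
    using tail_seq_logistic_inverse[OF tail_function_initial s k, of q] by blast
  have "\<P>(\<omega> in M. q < coupled_message k v \<omega>) = \<P>(\<omega> in M. ereal x0 < ?X \<omega>)"
  proof (rule measure_eq_AE)
    show "AE \<omega> in M. \<omega> \<in> {\<omega> \<in> space M. q < coupled_message k v \<omega>} \<longleftrightarrow> \<omega> \<in> {\<omega> \<in> space M. ereal x0 < ?X \<omega>}"
      using message_finite[OF s]
    proof eventually_elim
      case (elim \<omega>)
      have "\<bar>?X \<omega>\<bar> \<noteq> \<infinity>" by (rule bspec[OF elim v])
      then obtain x where "?X \<omega> = ereal x" by (cases "?X \<omega>") auto
      then show ?case by (simp add: coupled_message_def Let_def x0(2))
    qed
  qed measurable
  then show "\<P>(\<omega> in M. q < coupled_message k v \<omega>) = logis 0 q"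
    by (simp add: prob_message[OF v] x0(1))
qed

text \<open>The only exceptional outcomes are those with an infinite message in round
  \<open>k\<close>. The later rounds are deterministic, so one null set serves all \<open>n\<close>
  and \<open>v\<close>.\<close>

lemma coupled_message_bounds:
  assumes s: "sandwiched (c - l) (c + l) (tail_seq initial_tail k)"
  shows "AE \<omega> in M. \<forall>n. \<forall>v\<in>words1.
    real_message (coupled_message k) n v \<omega> + ereal ((- 1) ^ n * c - l) \<le> message \<xi> X0 (k + n) v \<omega> \<and>
    message \<xi> X0 (k + n) v \<omega> \<le> real_message (coupled_message k) n v \<omega> + ereal ((- 1) ^ n * c + l)"
  using message_finite[OF s]
proof eventually_elim
  case (elim \<omega>)
  have "ereal (coupled_message k u \<omega>) + ereal (c - l) \<le> message \<xi> X0 k u \<omega> \<and>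
      message \<xi> X0 k u \<omega> \<le> ereal (coupled_message k u \<omega>) + ereal (c + l)" if u: "u \<in> words1" for u
  proof -
    obtain x where x: "message \<xi> X0 k u \<omega> = ereal x" using elim u by (cases "message \<xi> X0 k u \<omega>") auto
    show ?thesis
      using logit_bounds[of "c - l" x "tail_seq initial_tail k x" "c + l"] s
      by (simp add: x coupled_message_def Let_def sandwiched_def)
  qed
  then show ?case
    unfolding message_add by (intro allI ballI message_shift_bounds) auto
qed

end

section \<open>Convergence of messages and decisions\<close>

text \<open>The default 0 is not an index, so a value \<open>i \<ge> 1\<close> can only come from a
  unique minimiser.\<close>

lemma the_arg_min_iff:
  fixes g :: "nat \<Rightarrow> 'b::linorder"
  assumes "1 \<le> i"
  shows "the_arg_min g = i \<longleftrightarrow> (\<forall>j\<in>{1..}. j \<noteq> i \<longrightarrow> g i < g j)"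
proof
  assume eq: "the_arg_min g = i"
  then have ex: "\<exists>!i. is_arg_min g (\<lambda>j. 1 \<le> j) i"
    using assms by (auto simp: the_arg_min_def split: if_splits)
  then have i: "is_arg_min g (\<lambda>j. 1 \<le> j) i"
    using theI'[OF ex] eq by (simp add: the_arg_min_def)
  show "\<forall>j\<in>{1..}. j \<noteq> i \<longrightarrow> g i < g j"
  proof (intro ballI impI)
    fix j assume j: "j \<in> {1..}" "j \<noteq> i"
    then have nj: "\<not> is_arg_min g (\<lambda>j. 1 \<le> j) j" using ex i by blast
    have "g i \<le> g j" using i j by (simp add: is_arg_min_linorder)
    moreover have "g i \<noteq> g j"
    proof
      assume "g i = g j"
      then have "is_arg_min g (\<lambda>j. 1 \<le> j) j" using i j by (simp add: is_arg_min_linorder)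
      with nj show False ..
    qed
    ultimately show "g i < g j" by simp
  qed
next
  assume *: "\<forall>j\<in>{1..}. j \<noteq> i \<longrightarrow> g i < g j"
  then have i: "is_arg_min g (\<lambda>j. 1 \<le> j) i"
    unfolding is_arg_min_linorder
  proof (intro conjI allI impI)
    show "g i \<le> g j" if "1 \<le> j" for j
      using * that by (cases "j = i") (auto intro: less_imp_le)
  qed (rule assms)
  moreover have "j = i" if "is_arg_min g (\<lambda>j. 1 \<le> j) j" for j
  proof (rule ccontr)
    assume "j \<noteq> i"
    moreover have "1 \<le> j" "g j \<le> g i"
      using that assms unfolding is_arg_min_linorder by simp_all
    ultimately show False using bspec[OF *, of j] by simp
  qed
  ultimately have ex: "\<exists>!i. is_arg_min g (\<lambda>j. 1 \<le> j) i" by (rule ex1I)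
  show "the_arg_min g = i"
    unfolding the_arg_min_def using the1_equality[OF ex i] ex by (simp only: if_True)
qed

lemma measurable_the_arg_min:
  fixes f :: "nat \<Rightarrow> 'a \<Rightarrow> 'b::{linorder_topology, second_countable_topology}"
  assumes [measurable]: "\<And>i. i \<in> {1..} \<Longrightarrow> f i \<in> borel_measurable M"
  shows "(\<lambda>\<omega>. the_arg_min (\<lambda>i. f i \<omega>)) \<in> M \<rightarrow>\<^sub>M count_space UNIV"
proof -
  let ?g = "\<lambda>\<omega>. the_arg_min (\<lambda>i. f i \<omega>)"
  have pos: "?g -` {i} \<inter> space M \<in> sets M" if i: "i \<in> {1..}" for i
  proof -
    have "{\<omega> \<in> space M. \<forall>j\<in>{1..}. j \<noteq> i \<longrightarrow> f i \<omega> < f j \<omega>} \<in> sets M"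
      using i by measurable
    moreover have "?g -` {i} \<inter> space M = {\<omega> \<in> space M. \<forall>j\<in>{1..}. j \<noteq> i \<longrightarrow> f i \<omega> < f j \<omega>}"
    proof -
      have "?g \<omega> = i \<longleftrightarrow> (\<forall>j\<in>{1..}. j \<noteq> i \<longrightarrow> f i \<omega> < f j \<omega>)" for \<omega>
        using i by (intro the_arg_min_iff) simp
      then show ?thesis by (simp only: vimage_def Int_def mem_Collect_eq singleton_iff conj_commute)
    qed
    ultimately show ?thesis by (simp only:)
  qed
  have zero: "?g -` {0} \<inter> space M \<in> sets M"
  proof -
    have "(\<Union>i\<in>{1..}. ?g -` {i} \<inter> space M) \<in> sets M"
    proof (rule sets.countable_UN')
      show "(\<lambda>i. ?g -` {i} \<inter> space M) ` {1..} \<subseteq> sets M" by (rule image_subsetI) (rule pos)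
    qed simp
    then have "space M - (\<Union>i\<in>{1..}. ?g -` {i} \<inter> space M) \<in> sets M" by (rule sets.compl_sets)
    moreover have "?g -` {0} \<inter> space M = space M - (\<Union>i\<in>{1..}. ?g -` {i} \<inter> space M)"
    proof -
      have a: "(\<Union>i\<in>{1..}. ?g -` {i} \<inter> space M) = {\<omega> \<in> space M. 1 \<le> ?g \<omega>}" by simp blast
      have b: "?g -` {0} \<inter> space M = {\<omega> \<in> space M. \<not> 1 \<le> ?g \<omega>}"
        by (simp add: vimage_def Int_def conj_commute not_le)
      show ?thesis unfolding a b by blast
    qed
    ultimately show ?thesis by (simp only:)
  qed
  have "?g -` {i} \<inter> space M \<in> sets M" for i
  proof (cases "i = 0")
    case True
    then show ?thesis using zero by (simp only:)
  next
    case False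
    show ?thesis by (rule pos) (use False in simp)
  qed
  then show ?thesis
    by (subst measurable_count_space_eq2_countable) auto
qed

lemma tendsto_0_ennrealI:
  fixes f :: "nat \<Rightarrow> ennreal"
  assumes "\<And>e::real. 0 < e \<Longrightarrow> \<exists>N. \<forall>n\<ge>N. f n \<le> ennreal e"
  shows "f \<longlonglongrightarrow> 0"
proof (rule order_tendstoI)
  fix a :: ennreal assume "0 < a"
  then obtain b where b: "0 < b" "b < a" using dense by blast
  then obtain r where r: "b = ennreal r" "0 \<le> r" by (cases b) auto
  obtain N where "\<forall>n\<ge>N. f n \<le> ennreal r" using assms[of r] b(1) r by auto
  then show "eventually (\<lambda>n. f n < a) sequentially"
    using b(2) r(1) by (auto simp: eventually_sequentially intro!: exI[of _ N] intro: le_less_trans)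
qed simp

section \<open>Mean-square convergence of the messages\<close>

context pwit_stationary
begin

definition star_min :: "(nat \<Rightarrow> real) \<times> (nat \<Rightarrow> ereal) \<Rightarrow> ereal" where
  "star_min p = (INF i\<in>{1..}. ereal (fst p i) - snd p i)"

lemma star_space_coordinates [measurable]:
  assumes "i \<in> {1..}"
  shows "(\<lambda>p. fst p i) \<in> borel_measurable star_space" "(\<lambda>p. snd p i) \<in> borel_measurable star_space"
  using measurable_compose[OF measurable_fst measurable_component_singleton[OF assms]]
    measurable_compose[OF measurable_snd measurable_component_singleton[OF assms]]
  by blast+

lemma star_min_measurable [measurable]: "star_min \<in> borel_measurable star_space"
  unfolding star_min_def[abs_def] by measurable

lemma star_min_star_of: "star_min (star_of v Y \<omega>) = (INF i\<in>{1..}. ereal (\<xi> v i \<omega>) - Y (v @ [i]) \<omega>)"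
  unfolding star_min_def star_of_def by (intro INF_cong) auto

lemma real_message_Suc: "real_message W (Suc n) v \<omega> = star_min (star_of v (real_message W n) \<omega>)"
  by (simp add: star_min_star_of)

lemma star_min_limit: "v \<in> words1 \<Longrightarrow> AE \<omega> in M. star_min (star_limit v \<omega>) = ereal (Xs v \<omega>)"
  using Xs_fixed_point[of 1]
  by eventually_elim (auto simp: star_min_star_of One_nat_def)

lemma Xs_square_integrable: "v \<in> words1 \<Longrightarrow> integrable M (\<lambda>\<omega>. (Xs v \<omega>)\<^sup>2)"
  using logistic_messages_measurable(2)[OF logistic_Xs] logistic_Xs
  by (intro logistic_square_integrable) (auto simp: logistic_messages_def)

context
  fixes W :: "nat list \<Rightarrow> 'a \<Rightarrow> real"
  assumes W: "logistic_messages W"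
begin

text \<open>Finiteness of the next message depends only on the law of the star, and for the limiting
  star the next message is the real number \<open>Xs v\<close> almost surely.\<close>

lemma real_message_finite: "AE \<omega> in M. \<forall>n. \<forall>v\<in>words1. \<bar>real_message W n v \<omega>\<bar> \<noteq> \<infinity>"
  unfolding AE_all_countable
proof (intro allI AE_ball_countable')
  fix n v assume v: "v \<in> words1"
  then have vw: "v \<in> words" by (simp add: words1_iff)
  show "AE \<omega> in M. \<bar>real_message W n v \<omega>\<bar> \<noteq> \<infinity>"
  proof (cases n)
    case (Suc m)
    let ?D = "{p \<in> space star_space. \<bar>star_min p\<bar> = \<infinity>}"
    have D: "?D \<in> sets star_space" by measurable
    have "\<P>(\<omega> in M. star_of v (real_message W m) \<omega> \<in> ?D) = \<P>(\<omega> in M. star_limit v \<omega> \<in> ?D)"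
      by (rule prob_star[OF W vw D])
    also have "\<dots> = prob {}"
    proof (rule measure_eq_AE)
      show "AE \<omega> in M. \<omega> \<in> {\<omega> \<in> space M. star_limit v \<omega> \<in> ?D} \<longleftrightarrow> \<omega> \<in> {}"
        using star_min_limit[OF v] by eventually_elim auto
    qed (use sets_Collect_in[OF star_limit_measurable[OF vw] D] in simp_all)
    finally have "\<P>(\<omega> in M. star_of v (real_message W m) \<omega> \<in> ?D) = 0" by simp
    then have "AE \<omega> in M. star_of v (real_message W m) \<omega> \<notin> ?D"
      using sets_Collect_in[OF star_measurable[OF W vw] D]
      by (intro AE_I[where N = "{\<omega> \<in> space M. star_of v (real_message W m) \<omega> \<in> ?D}"]) (auto simp: emeasure_eq_measure)
    then show ?thesis
      using AE_space
      by eventually_elim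
        (use measurable_space[OF star_measurable[OF W vw]] in \<open>auto simp: Suc real_message_Suc simp del: message.simps\<close>)
  qed simp
qed (rule countable_subset[OF subset_UNIV], simp)

text \<open>That the message exceeds \<open>q\<close> is an event of the star one round earlier. For
  such events \<open>prob_star\<close> gives equality of laws and \<open>star_convergence\<close>
  the convergence of indicators, the two inputs of
  \<open>L2_convergence_from_indicators\<close>.\<close>

lemma real_message_L2:
  assumes v: "v \<in> words1"
  shows "(\<lambda>n. expectation (\<lambda>\<omega>. (real_of_ereal (real_message W (Suc n) v \<omega>) - Xs v \<omega>)\<^sup>2)) \<longlonglongrightarrow> 0"
    and "integrable M (\<lambda>\<omega>. (real_of_ereal (real_message W (Suc n) v \<omega>) - Xs v \<omega>)\<^sup>2)"
proof -
  have vw: "v \<in> words" using v by (simp add: words1_iff)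
  let ?Y = "\<lambda>n \<omega>. real_of_ereal (real_message W (Suc n) v \<omega>)"
  have Y: "?Y n \<in> borel_measurable M" for n
    using real_message_measurable[OF W v, of "Suc n"] by (simp del: message.simps)
  have X: "Xs v \<in> borel_measurable M" by (rule logistic_messages_measurable(2)[OF logistic_Xs v])
  let ?D = "\<lambda>q. {p \<in> space star_space. q < real_of_ereal (star_min p)}"
  have D: "?D q \<in> sets star_space" for q by measurable
  have YD: "q < ?Y n \<omega> \<longleftrightarrow> star_of v (real_message W n) \<omega> \<in> ?D q" if "\<omega> \<in> space M" for q n \<omega>
    using measurable_space[OF star_measurable[OF W vw] that] by (simp add: real_message_Suc del: message.simps)
  have XD: "AE \<omega> in M. q < Xs v \<omega> \<longleftrightarrow> star_limit v \<omega> \<in> ?D q" for q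
    using star_min_limit[OF v] AE_space
    by eventually_elim (use measurable_space[OF star_limit_measurable[OF vw]] in auto)
  have law: "distr M borel (?Y n) = distr M borel (Xs v)" for n
  proof (rule distr_eqI_tails[OF Y X])
    fix q
    have "{\<omega> \<in> space M. q < ?Y n \<omega>} = {\<omega> \<in> space M. star_of v (real_message W n) \<omega> \<in> ?D q}"
      using YD by blast
    then have "\<P>(\<omega> in M. q < ?Y n \<omega>) = \<P>(\<omega> in M. star_limit v \<omega> \<in> ?D q)"
      using prob_star[OF W vw D] by simp
    also have "\<dots> = \<P>(\<omega> in M. q < Xs v \<omega>)"
    proof (rule measure_eq_AE)
      show "AE \<omega> in M. \<omega> \<in> {\<omega> \<in> space M. star_limit v \<omega> \<in> ?D q} \<longleftrightarrow> \<omega> \<in> {\<omega> \<in> space M. q < Xs v \<omega>}"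
        using XD[of q] by eventually_elim auto
    qed (use X sets_Collect_in[OF star_limit_measurable[OF vw] D] in simp_all)
    finally show "\<P>(\<omega> in M. q < ?Y n \<omega>) = \<P>(\<omega> in M. q < Xs v \<omega>)" .
  qed
  have ind: "(\<lambda>n. \<P>(\<omega> in M. (q < ?Y n \<omega>) \<noteq> (q < Xs v \<omega>))) \<longlonglongrightarrow> 0" for q
  proof -
    have "\<P>(\<omega> in M. (q < ?Y n \<omega>) \<noteq> (q < Xs v \<omega>)) =
        prob (star_change W v n (?D q))" for n
    proof (rule measure_eq_AE)
      show "AE \<omega> in M. \<omega> \<in> {\<omega> \<in> space M. (q < ?Y n \<omega>) \<noteq> (q < Xs v \<omega>)} \<longleftrightarrow> \<omega> \<in> star_change W v n (?D q)"
        using XD[of q] AE_space by eventually_elim (use YD in blast)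
      show "{\<omega> \<in> space M. (q < ?Y n \<omega>) \<noteq> (q < Xs v \<omega>)} \<in> events"
        using Y X by measurable
      let ?A = "{\<omega> \<in> space M. star_of v (real_message W n) \<omega> \<in> ?D q}" and ?B = "{\<omega> \<in> space M. star_limit v \<omega> \<in> ?D q}"
      have "(?A - ?B) \<union> (?B - ?A) \<in> events"
        by (intro sets.Un sets.Diff sets_Collect_in[OF star_measurable[OF W vw] D] sets_Collect_in[OF star_limit_measurable[OF vw] D])
      moreover have "(?A - ?B) \<union> (?B - ?A) = star_change W v n (?D q)"
        by blast
      ultimately show "star_change W v n (?D q) \<in> events"
        by (simp only:)
    qed
    then show ?thesis using star_convergence[OF W vw D] by simp
  qed
  show "(\<lambda>n. expectation (\<lambda>\<omega>. (?Y n \<omega> - Xs v \<omega>)\<^sup>2)) \<longlonglongrightarrow> 0"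
    by (rule L2_convergence_from_indicators(1)[OF Y X law Xs_square_integrable[OF v] ind])
  show "integrable M (\<lambda>\<omega>. (?Y n \<omega> - Xs v \<omega>)\<^sup>2)"
    by (rule L2_convergence_from_indicators(2)[OF Y X law Xs_square_integrable[OF v] ind])
qed

end

text \<open>With \<open>m\<close> even, \<open>(- 1) ^ n\<close> is also the sign that belongs to
  the total number \<open>m + n\<close> of rounds.\<close>

definition coupled :: "real \<Rightarrow> real \<Rightarrow> (nat list \<Rightarrow> 'a \<Rightarrow> real) \<Rightarrow> nat \<Rightarrow> bool" where
  "coupled c l W m \<longleftrightarrow> logistic_messages W \<and> even m \<and> (AE \<omega> in M. \<forall>n. \<forall>v\<in>words1.
     real_message W n v \<omega> + ereal ((- 1) ^ n * c - l) \<le> message \<xi> X0 (m + n) v \<omega> \<and>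
     message \<xi> X0 (m + n) v \<omega> \<le> real_message W n v \<omega> + ereal ((- 1) ^ n * c + l))"

lemma coupling_exists: "\<exists>c. \<forall>l>0. \<exists>W m. coupled c l W m"
proof -
  obtain c where c: "\<And>l. 0 < l \<Longrightarrow> \<exists>j. sandwiched (c - l) (c + l) (tail_seq initial_tail (2 * j))"
    using tail_seq_attracted[OF tail_function_initial] by blast
  have "\<exists>W m. coupled c l W m" if l: "0 < l" for l
  proof -
    obtain j where "sandwiched (c - l) (c + l) (tail_seq initial_tail (2 * j))" using c[OF l] by blast
    \<comment> \<open>The quantile coupling needs at least two rounds, hence \<open>max j 1\<close>;
      the sandwich persists at later even times.\<close>
    then have s: "sandwiched (c - l) (c + l) (tail_seq initial_tail (2 * max j 1))"
      by (rule sandwiched_even[OF tail_function_initial]) simp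
    have "2 \<le> 2 * max j 1" by simp
    then have "coupled c l (coupled_message (2 * max j 1)) (2 * max j 1)"
      unfolding coupled_def using coupled_message_logistic[OF s] coupled_message_bounds[OF s] by simp
    then show ?thesis by blast
  qed
  then show ?thesis by blast
qed

lemma message_convergence:
  assumes c: "\<forall>l>0. \<exists>W m. coupled c l W m" and v: "v \<in> words1"
  shows "(\<lambda>k. \<integral>\<^sup>+\<omega>. e2ennreal ((message \<xi> X0 k v \<omega> - ereal (Xs v \<omega> + (- 1) ^ k * c))\<^sup>2) \<partial>M) \<longlonglongrightarrow> 0"
    (is "(\<lambda>k. \<integral>\<^sup>+\<omega>. ?err k \<omega> \<partial>M) \<longlonglongrightarrow> 0")
proof (rule tendsto_0_ennrealI)
  fix e :: real assume e: "0 < e"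
  \<comment> \<open>A square of a sum is at most twice the sum of the squares, so the coupling error
    contributes \<open>2 * l\<^sup>2 = e / 2\<close> and the distance of the coupled messages from
    the limit less than \<open>2 * (e / 4)\<close>.\<close>
  define l where "l = sqrt (e / 4)"
  have l: "0 < l" "l\<^sup>2 = e / 4" using e by (auto simp: l_def)
  obtain W m where Wm: "coupled c l W m" using c l(1) by blast
  then have W: "logistic_messages W" and m: "even m" by (auto simp: coupled_def)
  let ?Y = "\<lambda>n \<omega>. real_of_ereal (real_message W (Suc n) v \<omega>)"
  have "eventually (\<lambda>n. expectation (\<lambda>\<omega>. (?Y n \<omega> - Xs v \<omega>)\<^sup>2) < e / 4) sequentially"
    using e by (intro order_tendstoD(2)[OF real_message_L2(1)[OF W v]]) auto
  then obtain N where N: "\<And>n. N \<le> n \<Longrightarrow> expectation (\<lambda>\<omega>. (?Y n \<omega> - Xs v \<omega>)\<^sup>2) < e / 4"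
    by (auto simp: eventually_sequentially)
  have "(\<integral>\<^sup>+\<omega>. ?err k \<omega> \<partial>M) \<le> ennreal e" if k: "m + Suc N \<le> k" for k
  proof -
    obtain d where d: "k = m + Suc N + d" using le_Suc_ex[OF k] by blast
    define n where "n = N + d"
    have n: "k = m + Suc n" "N \<le> n" using d by (simp_all add: n_def)
    have sign: "(- 1 :: real) ^ k = (- 1) ^ Suc n" using m by (simp add: n power_add)
    have "AE \<omega> in M. ?err k \<omega> \<le> ennreal (2 * l\<^sup>2 + 2 * (?Y n \<omega> - Xs v \<omega>)\<^sup>2)"
      using real_message_finite[OF W] Wm[unfolded coupled_def, THEN conjunct2, THEN conjunct2]
    proof eventually_elim
      case (elim \<omega>)
      have "\<bar>real_message W (Suc n) v \<omega>\<bar> \<noteq> \<infinity>" using bspec[OF spec[OF elim(1), of "Suc n"] v] .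
      then obtain u where u: "real_message W (Suc n) v \<omega> = ereal u" by (cases "real_message W (Suc n) v \<omega>") (auto simp del: message.simps)
      define s where "s = (- 1) ^ Suc n * c"
      have "ereal u + ereal (s - l) \<le> message \<xi> X0 k v \<omega>" "message \<xi> X0 k v \<omega> \<le> ereal u + ereal (s + l)"
        using bspec[OF spec[OF elim(2), of "Suc n"] v] unfolding n(1) u s_def by auto
      then obtain x where x: "message \<xi> X0 k v \<omega> = ereal x" "u + s - l \<le> x" "x \<le> u + s + l"
        by (cases "message \<xi> X0 k v \<omega>") auto
      have "(x - u - s)\<^sup>2 \<le> l\<^sup>2" using x by (intro power2_le_iff_abs_le[THEN iffD2]) (use l in auto)
      moreover have "0 \<le> ((x - u - s) - (u - Xs v \<omega>))\<^sup>2" by simp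
      ultimately have "(x - (Xs v \<omega> + s))\<^sup>2 \<le> 2 * l\<^sup>2 + 2 * (u - Xs v \<omega>)\<^sup>2"
        by (simp add: power2_eq_square algebra_simps)
      then show ?case
        unfolding sign s_def[symmetric] x(1) u
        by (simp only: ereal_minus ereal_power e2ennreal_ereal real_of_ereal.simps) (rule ennreal_leI)
    qed
    then have "(\<integral>\<^sup>+\<omega>. ?err k \<omega> \<partial>M) \<le>
        (\<integral>\<^sup>+\<omega>. ennreal (2 * l\<^sup>2 + 2 * (?Y n \<omega> - Xs v \<omega>)\<^sup>2) \<partial>M)"
      by (rule nn_integral_mono_AE)
    also have "\<dots> = ennreal (expectation (\<lambda>\<omega>. 2 * l\<^sup>2 + 2 * (?Y n \<omega> - Xs v \<omega>)\<^sup>2))"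
      using real_message_L2(2)[OF W v, of n] by (intro nn_integral_eq_integral) (auto simp del: message.simps)
    also have "expectation (\<lambda>\<omega>. 2 * l\<^sup>2 + 2 * (?Y n \<omega> - Xs v \<omega>)\<^sup>2) = 2 * l\<^sup>2 + 2 * expectation (\<lambda>\<omega>. (?Y n \<omega> - Xs v \<omega>)\<^sup>2)"
      using real_message_L2(2)[OF W v, of n] by (simp add: prob_space del: message.simps)
    also have "ennreal \<dots> \<le> ennreal e"
      using N[OF n(2)] l(2) by (intro ennreal_leI) linarith
    finally show ?thesis .
  qed
  then show "\<exists>N. \<forall>k\<ge>N. (\<integral>\<^sup>+\<omega>. ?err k \<omega> \<partial>M) \<le> ennreal e"
    by blast
qed

end

section \<open>Decisions at the root\<close>

context pwit_stationary
begin

text \<open>A bare arg min can change under arbitrarily small errors. A margin over all competitors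
  makes it stable, and as a measurable set of stars it can be fed to
  \<open>star_convergence\<close>.\<close>

definition gap_set :: "nat \<Rightarrow> real \<Rightarrow> ((nat \<Rightarrow> real) \<times> (nat \<Rightarrow> ereal)) set" where
  "gap_set i d = {p \<in> space star_space. \<forall>j\<in>{1..}. j \<noteq> i \<longrightarrow>
     fst p i - real_of_ereal (snd p i) + d < fst p j - real_of_ereal (snd p j)}"

lemma gap_set_measurable: "i \<in> {1..} \<Longrightarrow> gap_set i d \<in> sets star_space"
  unfolding gap_set_def by measurable

lemma star_of_gap_set:
  assumes "1 \<le> i"
  shows "star_of v Y \<omega> \<in> gap_set i d \<longleftrightarrow> (\<forall>j\<in>{1..}. j \<noteq> i \<longrightarrow>
     \<xi> v i \<omega> - real_of_ereal (Y (v @ [i]) \<omega>) + d < \<xi> v j \<omega> - real_of_ereal (Y (v @ [j]) \<omega>))"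
  using assms by (auto simp: gap_set_def star_of_def space_pair_measure space_PiM)

text \<open>The right-hand side involves only the root weights and the subtrees of the other
  children, so it is independent of \<open>Xs [i]\<close>, whose law has no atoms.\<close>

lemma AE_no_tie:
  assumes i: "1 \<le> i"
  shows "AE \<omega> in M. ereal (Xs [i] \<omega>) \<noteq> ereal (\<xi> [] i \<omega>) - (INF j\<in>{1..} - {i}. ereal (\<xi> [] j \<omega>) - ereal (Xs [j] \<omega>))"
    (is "AE \<omega> in M. _ \<noteq> ?C \<omega>")
proof (rule prob_eq_indep_no_atoms)
  let ?K = "words - descendants [i]"
  have Xi: "[i] \<in> words1" using i by (simp add: words1_iff)
  show "indep_var borel ?C borel (\<lambda>\<omega>. ereal (Xs [i] \<omega>))"
  proof (rule indep_var_block[of ?K "descendants [i]"])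
    show "descendants [i] \<subseteq> words" using i by (intro descendants_subset_words) simp
    have [measurable]: "\<xi> [] j \<in> borel_measurable (block ?K)" if "1 \<le> j" for j
      using that by (intro weight_measurable_block) (auto simp: descendants_def)
    have [measurable]: "Xs [j] \<in> borel_measurable (block ?K)" if "j \<in> {1..} - {i}" for j
    proof (rule measurable_block_mono[OF logistic_messages_measurable(1)[OF logistic_Xs]])
      show "[j] \<in> words1" using that by (simp add: words1_iff)
      show "descendants [j] \<subseteq> ?K" using that by (auto simp: descendants_def)
    qed
    have "(\<lambda>\<omega>. INF j\<in>{1..} - {i}. ereal (\<xi> [] j \<omega>) - ereal (Xs [j] \<omega>)) \<in> borel_measurable (block ?K)"
      by (intro borel_measurable_INF borel_measurable_ereal_diff borel_measurable_ereal) auto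
    then show "?C \<in> borel_measurable (block ?K)" using i by measurable
    show "(\<lambda>\<omega>. ereal (Xs [i] \<omega>)) \<in> borel_measurable (block (descendants [i]))"
      using logistic_messages_measurable(1)[OF logistic_Xs Xi] by measurable
  qed auto
  have [measurable]: "Xs [i] \<in> borel_measurable M" by (rule logistic_messages_measurable(2)[OF logistic_Xs Xi])
  have tail: "\<P>(\<omega> in M. x < Xs [i] \<omega>) = logis 0 x" for x
    using logistic_Xs Xi by (simp add: logistic_messages_def)
  show "\<P>(\<omega> in M. ereal (Xs [i] \<omega>) = c) = 0" for c
  proof (cases c)
    case (real r)
    have "\<P>(\<omega> in M. ereal (Xs [i] \<omega>) = c) \<le> logis 0 (r - 1 / real (Suc n)) - logis 0 r" for n
    proof -
      have "\<P>(\<omega> in M. ereal (Xs [i] \<omega>) = c) \<le> prob ({\<omega> \<in> space M. r - 1 / real (Suc n) < Xs [i] \<omega>} - {\<omega> \<in> space M. r < Xs [i] \<omega>})"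
        using real by (intro finite_measure_mono) auto
      also have "\<dots> = logis 0 (r - 1 / real (Suc n)) - logis 0 r"
        unfolding tail[symmetric] by (intro finite_measure_Diff) (auto elim: less_trans[rotated])
      finally show ?thesis .
    qed
    moreover have "(\<lambda>n. logis 0 (r - 1 / real (Suc n)) - logis 0 r) \<longlonglongrightarrow> logis 0 (r - 0) - logis 0 r"
    proof -
      have "isCont (logis 0) (r - 0)"
        unfolding logis_def by (intro continuous_intros) (auto simp: add_pos_pos less_imp_neq[symmetric])
      then show ?thesis
        by (intro tendsto_diff tendsto_const isCont_tendsto_compose[of _ "logis 0"] LIMSEQ_Suc[OF lim_1_over_n])
    qed
    ultimately have "\<P>(\<omega> in M. ereal (Xs [i] \<omega>) = c) \<le> logis 0 (r - 0) - logis 0 r"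
      by (intro LIMSEQ_le_const) auto
    then show ?thesis by (simp add: measure_le_0_iff)
  qed simp_all
qed

text \<open>Only finitely many children come below a given level, so the minimum is attained. Since
  \<open>AE_no_tie\<close> compares child \<open>i\<close> with the infimum of all others, and not
  with each of them, it yields a positive distance and not merely a unique minimiser.\<close>

lemma AE_gap: "AE \<omega> in M. \<exists>i\<in>{1..}. \<exists>d>0. star_limit [] \<omega> \<in> gap_set i d"
proof -
  have Y: "(\<lambda>\<omega>. ereal (Xs [i] \<omega>)) \<in> borel_measurable (block (descendants ([] @ [i])))" if "1 \<le> i" for i
    using logistic_messages_measurable(1)[OF logistic_Xs, of "[i]"] that
    by (auto simp: words1_iff intro!: borel_measurable_ereal)
  have "AE \<omega> in M. finite {i \<in> {1..}. \<not> ereal (Xs [i] \<omega>) \<le> ereal (\<xi> [] i \<omega> - real n)}" for n :: nat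
  proof (rule AE_finite_children[OF Nil_in_words Y])
    fix i :: nat and x assume "1 \<le> i"
    then show "\<P>(\<omega> in M. ereal x < ereal (Xs [i] \<omega>)) = logis 0 x"
      using logistic_Xs by (simp add: logistic_messages_def words1_iff)
  qed (auto intro: tail_function_logis)
  then have "AE \<omega> in M. \<forall>n::nat. finite {i \<in> {1..}. \<not> ereal (Xs [i] \<omega>) \<le> ereal (\<xi> [] i \<omega> - real n)}"
    by (simp add: AE_all_countable)
  moreover have "AE \<omega> in M. \<forall>i\<in>{1..}. ereal (Xs [i] \<omega>) \<noteq> ereal (\<xi> [] i \<omega>) - (INF j\<in>{1..} - {i}. ereal (\<xi> [] j \<omega>) - ereal (Xs [j] \<omega>))"
    by (intro AE_ball_countable' AE_no_tie) auto
  ultimately show ?thesis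
  proof eventually_elim
    case (elim \<omega>)
    define f where "f j = \<xi> [] j \<omega> - Xs [j] \<omega>" for j
    \<comment> \<open>A level above the value of child 1: a minimiser over the finite set below this
      level exists and is a minimiser over all children.\<close>
    obtain n :: nat where n: "f 1 < real n" using reals_Archimedean2 by blast
    define S where "S = {j \<in> {1..}. f j < real n}"
    have "S = {i \<in> {1..}. \<not> ereal (Xs [i] \<omega>) \<le> ereal (\<xi> [] i \<omega> - real n)}"
      by (auto simp: S_def f_def)
    then have S: "finite S" using elim(1) by simp
    have "1 \<in> S" using n by (simp add: S_def)
    then obtain i where i: "i \<in> S" "\<And>j. j \<in> S \<Longrightarrow> f i \<le> f j"
      using arg_min_if_finite[OF S, of f] by (metis emptyE not_le)
    have i1: "1 \<le> i" using i by (simp add: S_def)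
    have min: "f i \<le> f j" if "1 \<le> j" for j
      using i(2)[OF \<open>1 \<in> S\<close>] n i(2)[of j] that by (cases "f j < real n") (auto simp: S_def)
    define U where "U = (INF j\<in>{1..} - {i}. ereal (\<xi> [] j \<omega>) - ereal (Xs [j] \<omega>))"
    have "ereal (f i) \<le> U"
      unfolding U_def using min by (intro INF_greatest) (auto simp: f_def)
    moreover have "ereal (Xs [i] \<omega>) \<noteq> ereal (\<xi> [] i \<omega>) - U"
      using elim(2) i1 by (simp add: U_def)
    then have "ereal (f i) \<noteq> U" by (cases U) (auto simp: f_def)
    ultimately have "ereal (f i) < U" by simp
    then obtain z where z: "ereal (f i) < ereal z" "ereal z < U"
      using ereal_dense2 by blast
    have "f i + (z - f i) < f j" if "j \<in> {1..}" "j \<noteq> i" for j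
    proof -
      have "ereal z < ereal (f j)"
        using z(2) by (rule less_le_trans) (use that in \<open>auto simp: U_def f_def intro!: INF_lower2[of j]\<close>)
      then show ?thesis by simp
    qed
    then have "star_limit [] \<omega> \<in> gap_set i (z - f i)"
      using i1 by (simp add: star_of_gap_set f_def)
    then show ?case
      using z(1) i1 by (intro bexI[of _ i] exI[of _ "z - f i"]) auto
  qed
qed

lemma gap_set_mono:
  assumes "d \<le> e"
  shows "gap_set i e \<subseteq> gap_set i d"
proof
  fix p assume p: "p \<in> gap_set i e"
  have "fst p i - real_of_ereal (snd p i) + d < fst p j - real_of_ereal (snd p j)" if "j \<in> {1..}" "j \<noteq> i" for j
  proof -
    have "fst p i - real_of_ereal (snd p i) + e < fst p j - real_of_ereal (snd p j)"
      using p that unfolding gap_set_def by blast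
    then show ?thesis using assms by linarith
  qed
  then show "p \<in> gap_set i d" using p unfolding gap_set_def by blast
qed

lemma stationary_decision_gap:
  assumes "1 \<le> i" "0 \<le> d" "star_limit [] \<omega> \<in> gap_set i d"
  shows "stationary_root_decision \<xi> Xs \<omega> = i"
proof -
  have "\<xi> [] i \<omega> - Xs [i] \<omega> + d < \<xi> [] j \<omega> - Xs [j] \<omega>" if "j \<in> {1..}" "j \<noteq> i" for j
    using assms(3) that by (simp add: star_of_gap_set[OF assms(1)])
  then show ?thesis
    unfolding stationary_root_decision_def the_arg_min_iff[OF assms(1)]
    using assms(2) by force
qed

text \<open>The shift \<open>s\<close> is the same for all children and cancels in every comparison;
  each of the two compared terms is off by at most \<open>l\<close>, which a margin of
  \<open>2 * l\<close> absorbs.\<close>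

lemma decision_gap:
  assumes i: "1 \<le> i" and gap: "star_of [] Y \<omega> \<in> gap_set i (2 * l)"
    and b: "\<And>j. 1 \<le> j \<Longrightarrow> \<bar>Y [j] \<omega>\<bar> \<noteq> \<infinity> \<and> Y [j] \<omega> + ereal (s - l) \<le> Z j \<and> Z j \<le> Y [j] \<omega> + ereal (s + l)"
  shows "the_arg_min (\<lambda>i. ereal (\<xi> [] i \<omega>) - Z i) = i"
  unfolding the_arg_min_iff[OF i]
proof (intro ballI impI)
  fix j assume j: "j \<in> {1..}" "j \<noteq> i"
  then have "1 \<le> j" by simp
  obtain yi zi where yi: "Y [i] \<omega> = ereal yi" "Z i = ereal zi" "yi + (s - l) \<le> zi" "zi \<le> yi + (s + l)"
    using b[OF i] by (cases "Y [i] \<omega>"; cases "Z i") auto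
  obtain yj zj where yj: "Y [j] \<omega> = ereal yj" "Z j = ereal zj" "yj + (s - l) \<le> zj" "zj \<le> yj + (s + l)"
    using b[OF \<open>1 \<le> j\<close>] by (cases "Y [j] \<omega>"; cases "Z j") auto
  have "\<xi> [] i \<omega> - yi + 2 * l < \<xi> [] j \<omega> - yj"
    using bspec[OF gap[unfolded star_of_gap_set[OF i]] j(1)] j(2) by (simp add: yi yj)
  then show "ereal (\<xi> [] i \<omega>) - Z i < ereal (\<xi> [] j \<omega>) - Z j"
    using yi yj by simp
qed

lemma root_decision_measurable: "root_decision \<xi> X0 k \<in> M \<rightarrow>\<^sub>M count_space UNIV"
  unfolding root_decision_def[abs_def]
proof (rule measurable_the_arg_min)
  fix i :: nat assume i: "i \<in> {1..}"
  have [measurable]: "\<xi> [] i \<in> borel_measurable M" "message \<xi> X0 k [i] \<in> borel_measurable M"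
    using i by (auto intro: weight_measurable message_measurable simp: words1_iff)
  show "(\<lambda>\<omega>. ereal (\<xi> [] i \<omega>) - message \<xi> X0 k [i] \<omega>) \<in> borel_measurable M" by measurable
qed

lemma stationary_decision_measurable: "stationary_root_decision \<xi> Xs \<in> M \<rightarrow>\<^sub>M count_space UNIV"
  unfolding stationary_root_decision_def[abs_def]
proof (rule measurable_the_arg_min)
  fix i :: nat assume i: "i \<in> {1..}"
  have [measurable]: "\<xi> [] i \<in> borel_measurable M" "Xs [i] \<in> borel_measurable M"
    using i by (auto intro: weight_measurable logistic_messages_measurable(2)[OF logistic_Xs] simp: words1_iff)
  show "(\<lambda>\<omega>. \<xi> [] i \<omega> - Xs [i] \<omega>) \<in> borel_measurable M" by measurable
qed

lemma decision_convergence: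
  assumes c: "\<forall>l>0. \<exists>W m. coupled c l W m"
  shows "(\<lambda>k. \<P>(\<omega> in M. root_decision \<xi> X0 k \<omega> \<noteq> stationary_root_decision \<xi> Xs \<omega>)) \<longlonglongrightarrow> 0"
    (is "(\<lambda>k. prob (?bad k)) \<longlonglongrightarrow> 0")
proof (rule LIMSEQ_I)
  fix e :: real assume e: "0 < e"
  let ?d = "\<lambda>n. 1 / real (Suc n)"
  let ?G = "\<lambda>n i. {\<omega> \<in> space M. star_limit [] \<omega> \<in> gap_set i (2 * ?d n)}"
  \<comment> \<open>A winner among the first \<open>n\<close> children with margin
    \<open>2 * ?d n\<close>. Tying both restrictions to one \<open>n\<close> leaves finitely many
    gap events, so that \<open>star_convergence\<close> can be summed over them.\<close>
  let ?H = "\<lambda>n. \<Union>i\<in>{1..n}. ?G n i"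
  have Gm: "?G n i \<in> events" if "1 \<le> i" for n i
    using that by (intro sets_Collect_in[OF star_limit_measurable[OF Nil_in_words] gap_set_measurable]) simp
  have Hm: "?H n \<in> events" for n
    using Gm by (intro sets.finite_UN) auto
  have "incseq ?H"
  proof (rule incseq_SucI)
    fix n
    have "gap_set i (2 * ?d n) \<subseteq> gap_set i (2 * ?d (Suc n))" for i
      by (intro gap_set_mono mult_left_mono divide_left_mono) auto
    then show "?H n \<subseteq> ?H (Suc n)" by fastforce
  qed
  then have lim: "(\<lambda>n. prob (?H n)) \<longlonglongrightarrow> prob (\<Union>n. ?H n)"
    using Hm by (intro finite_Lim_measure_incseq) auto
  have "AE \<omega> in M. \<omega> \<in> (\<Union>n. ?H n)"
    using AE_gap AE_space
  proof eventually_elim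
    case (elim \<omega>)
    then obtain i d where id: "1 \<le> i" "0 < d" "star_limit [] \<omega> \<in> gap_set i d" by auto
    obtain n0 where n0: "?d n0 < d / 2" using nat_approx_posE[of "d / 2"] id(2) by auto
    have "?d (max n0 i) \<le> ?d n0" by (intro divide_left_mono) auto
    then have "2 * ?d (max n0 i) \<le> d" using n0 by linarith
    then have "star_limit [] \<omega> \<in> gap_set i (2 * ?d (max n0 i))"
      using gap_set_mono id(3) by blast
    then have "\<omega> \<in> ?H (max n0 i)" using id(1) elim by (intro UN_I[of i]) auto
    then show ?case by blast
  qed
  moreover have "(\<Union>n. ?H n) \<in> events"
    by (rule sets.countable_UN) (rule image_subsetI, rule Hm)
  ultimately have "prob (\<Union>n. ?H n) = 1" by (simp only: prob_eq_1)
  with lim have "eventually (\<lambda>n. 1 - e / 2 < prob (?H n)) sequentially"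
    using e by (intro order_tendstoD(1)) auto
  then obtain n where n: "1 - e / 2 < prob (?H n)"
    by (auto simp: eventually_sequentially)
  define l where "l = ?d n"
  have l: "0 < l" by (simp add: l_def)
  obtain W m where Wm: "coupled c l W m" using c l by blast
  then have W: "logistic_messages W" by (simp add: coupled_def)
  let ?D = "\<lambda>r i. star_change W [] r (gap_set i (2 * l))"
  have Dm: "?D r i \<in> events" if i: "i \<in> {1..}" for r i
  proof -
    let ?A = "{\<omega> \<in> space M. star_of [] (real_message W r) \<omega> \<in> gap_set i (2 * l)}"
    let ?B = "{\<omega> \<in> space M. star_limit [] \<omega> \<in> gap_set i (2 * l)}"
    have "(?A - ?B) \<union> (?B - ?A) \<in> events"
      by (intro sets.Un sets.Diff sets_Collect_in[OF star_measurable[OF W Nil_in_words] gap_set_measurable[OF i]]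
          sets_Collect_in[OF star_limit_measurable[OF Nil_in_words] gap_set_measurable[OF i]])
    moreover have "(?A - ?B) \<union> (?B - ?A) = ?D r i" by blast
    ultimately show ?thesis by (simp only:)
  qed
  have "(\<lambda>r. \<Sum>i\<in>{1..n}. prob (?D r i)) \<longlonglongrightarrow> (\<Sum>i\<in>{1..n}. 0)"
    by (intro tendsto_sum star_convergence[OF W Nil_in_words gap_set_measurable]) auto
  then have "eventually (\<lambda>r. (\<Sum>i\<in>{1..n}. prob (?D r i)) < e / 2) sequentially"
    using e by (intro order_tendstoD(2)) auto
  then obtain N where N: "\<And>r. N \<le> r \<Longrightarrow> (\<Sum>i\<in>{1..n}. prob (?D r i)) < e / 2"
    by (auto simp: eventually_sequentially)
  have "prob (?bad k) < e" if k: "m + N \<le> k" for k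
  proof -
    obtain d where d: "k = m + N + d" using le_Suc_ex[OF k] by blast
    define r where "r = N + d"
    have r: "k = m + r" "N \<le> r" using d by (simp_all add: r_def)
    \<comment> \<open>Outside \<open>?E\<close> the limiting star has margin \<open>2 * l\<close> at
      some \<open>i\<close>, and the star of the coupled messages has it too;
      \<open>decision_gap\<close> then makes both decisions equal to \<open>i\<close>.\<close>
    let ?E = "(space M - ?H n) \<union> (\<Union>i\<in>{1..n}. ?D r i)"
    have Dm': "(\<Union>i\<in>{1..n}. ?D r i) \<in> events"
      using Dm by (intro sets.finite_UN) auto
    have "prob (?bad k) \<le> prob ?E"
    proof (rule finite_measure_mono_AE)
      show "AE \<omega> in M. \<omega> \<in> ?bad k \<longrightarrow> \<omega> \<in> ?E"
        using real_message_finite[OF W] Wm[unfolded coupled_def, THEN conjunct2, THEN conjunct2] AE_space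
      proof eventually_elim
        case (elim \<omega>)
        have "root_decision \<xi> X0 k \<omega> = stationary_root_decision \<xi> Xs \<omega>"
          if i: "i \<in> {1..n}" "\<omega> \<in> ?G n i" and nD: "\<omega> \<notin> ?D r i" for i
        proof -
          have i1: "1 \<le> i" using i by simp
          have lim: "star_limit [] \<omega> \<in> gap_set i (2 * l)" using i(2) by (simp add: l_def)
          then have st: "star_of [] (real_message W r) \<omega> \<in> gap_set i (2 * l)" using nD elim(3) by blast
          have "root_decision \<xi> X0 k \<omega> = i"
            unfolding root_decision_def
          proof (rule decision_gap[OF i1 st])
            fix j :: nat assume "1 \<le> j"
            then have "[j] \<in> words1" by (simp add: words1_iff)
            then show "\<bar>real_message W r [j] \<omega>\<bar> \<noteq> \<infinity> \<and> real_message W r [j] \<omega> + ereal ((- 1) ^ r * c - l) \<le> message \<xi> X0 k [j] \<omega> \<and>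
                message \<xi> X0 k [j] \<omega> \<le> real_message W r [j] \<omega> + ereal ((- 1) ^ r * c + l)"
              unfolding r(1)
              by (intro conjI bspec[OF spec[OF elim(1)]] bspec[OF spec[OF elim(2)], THEN conjunct1] bspec[OF spec[OF elim(2)], THEN conjunct2])
          qed
          moreover have "stationary_root_decision \<xi> Xs \<omega> = i"
            using l by (intro stationary_decision_gap[OF i1 _ lim]) simp
          ultimately show ?thesis by simp
        qed
        then show ?case by blast
      qed
      show "?E \<in> events" using Hm Dm' by blast
    qed
    also have "\<dots> \<le> prob (space M - ?H n) + prob (\<Union>i\<in>{1..n}. ?D r i)"
      using Hm[of n] Dm' by (intro measure_Un_le) auto
    also have "prob (space M - ?H n) = 1 - prob (?H n)" by (rule prob_compl[OF Hm])
    also have "prob (\<Union>i\<in>{1..n}. ?D r i) \<le> (\<Sum>i\<in>{1..n}. prob (?D r i))"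
      using Dm by (intro finite_measure_subadditive_finite) auto
    finally show ?thesis using n N[OF r(2)] by linarith
  qed
  then show "\<exists>no. \<forall>k\<ge>no. norm (prob (?bad k) - 0) < e"
    by (intro exI[of _ "m + N"]) auto
qed

text \<open>The subsequence \<open>f\<close> has constant parity of sign: even rounds give
  \<open>b = c\<close> and odd rounds \<open>b = - c\<close>, so that one constant produces both
  limits.\<close>

lemma messages_converge_L2:
  assumes c: "\<forall>l>0. \<exists>W m. coupled c l W m" and v: "v \<in> words1"
    and f: "filterlim f at_top sequentially" "\<And>k. (- 1) ^ f k * c = b"
  shows "converges_L2 M (\<lambda>k. message \<xi> X0 (f k) v) (\<lambda>\<omega>. Xs v \<omega> + b)"
  unfolding converges_L2_def
proof (intro conjI allI)
  have X [measurable]: "Xs v \<in> borel_measurable M" by (rule logistic_messages_measurable(2)[OF logistic_Xs v])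
  show "message \<xi> X0 (f k) v \<in> borel_measurable M" for k by (rule message_measurable[OF v])
  show "(\<lambda>\<omega>. Xs v \<omega> + b) \<in> borel_measurable M" by measurable
  show "integrable M (\<lambda>\<omega>. (Xs v \<omega> + b)\<^sup>2)"
  proof (rule Bochner_Integration.integrable_bound[where f = "\<lambda>\<omega>. 2 * (Xs v \<omega>)\<^sup>2 + 2 * b\<^sup>2"])
    show "AE \<omega> in M. norm ((Xs v \<omega> + b)\<^sup>2) \<le> norm (2 * (Xs v \<omega>)\<^sup>2 + 2 * b\<^sup>2)"
    proof (intro AE_I2)
      fix \<omega>
      have "0 \<le> (Xs v \<omega> - b)\<^sup>2" by simp
      then have "(Xs v \<omega> + b)\<^sup>2 \<le> 2 * (Xs v \<omega>)\<^sup>2 + 2 * b\<^sup>2"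
        by (simp add: power2_eq_square algebra_simps)
      then show "norm ((Xs v \<omega> + b)\<^sup>2) \<le> norm (2 * (Xs v \<omega>)\<^sup>2 + 2 * b\<^sup>2)" by simp
    qed
  qed (use Xs_square_integrable[OF v] in auto)
  show "(\<lambda>k. \<integral>\<^sup>+\<omega>. e2ennreal ((message \<xi> X0 (f k) v \<omega> - ereal (Xs v \<omega> + b))\<^sup>2) \<partial>M) \<longlonglongrightarrow> 0"
    using filterlim_compose[OF message_convergence[OF c v] f(1)] by (simp add: f(2))
qed

end

theorem theorem5p2:
  fixes M :: "'a measure"
    and \<xi> :: "nat list \<Rightarrow> nat \<Rightarrow> 'a \<Rightarrow> real"
    and X0 :: "nat list \<Rightarrow> 'a \<Rightarrow> ereal"
    and Xstar :: "nat list \<Rightarrow> 'a \<Rightarrow> real"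
  assumes "prob_space M"
    and "pwit M \<xi>"
    and "initial_messages M \<xi> X0"
    and "stationary_configuration M \<xi> Xstar"
  shows "(\<exists>\<gamma>::real. \<forall>v \<in> words1.
            converges_L2 M (\<lambda>k. message \<xi> X0 (2 * k) v) (\<lambda>\<omega>. Xstar v \<omega> + \<gamma>) \<and>
            converges_L2 M (\<lambda>k. message \<xi> X0 (2 * k + 1) v) (\<lambda>\<omega>. Xstar v \<omega> - \<gamma>)) \<and>
         converges_in_probability M (root_decision \<xi> X0) (stationary_root_decision \<xi> Xstar)"
proof -
  interpret pwit_stationary M \<xi> X0 Xstar
    using assms by (intro pwit_stationary.intro pwit_messages.intro pwit_messages_axioms.intro pwit_stationary_axioms.intro)
  obtain c where c: "\<forall>l>0. \<exists>W m. coupled c l W m" using coupling_exists by blast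
  have "filterlim (\<lambda>k::nat. 2 * k) at_top sequentially" "filterlim (\<lambda>k::nat. 2 * k + 1) at_top sequentially"
    by (rule filterlim_subseq, simp add: strict_mono_def)+
  then have "converges_L2 M (\<lambda>k. message \<xi> X0 (2 * k) v) (\<lambda>\<omega>. Xstar v \<omega> + c) \<and>
      converges_L2 M (\<lambda>k. message \<xi> X0 (2 * k + 1) v) (\<lambda>\<omega>. Xstar v \<omega> - c)" if "v \<in> words1" for v
    using messages_converge_L2[OF c that, of "\<lambda>k. 2 * k" c] messages_converge_L2[OF c that, of "\<lambda>k. 2 * k + 1" "- c"]
    by (simp del: message.simps)
  moreover have "converges_in_probability M (root_decision \<xi> X0) (stationary_root_decision \<xi> Xstar)"
    unfolding converges_in_probability_def
    using root_decision_measurable stationary_decision_measurable decision_convergence[OF c] by blast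
  ultimately show ?thesis by blast
qed

end
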